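(* Fix $s\in\mathbb{C}$ and let $\mathcal{E}_s$ be the complex vector space of functions on $(\mathbb{R}\setminus\mathbb{Z})\times(\mathbb{R}\setminus\mathbb{Z})$ spanned by \[L^{+}(s,a,c),\quad L^{-}(s,a,c),\quad e^{-2\pi i a c}L^{+}(1-s,1-c,a),\quad e^{-2\pi i a c}L^{-}(1-s,1-c,a).\] Then $\mathcal{E}_s$ is two-dimensional, and: (i) every $f\in\mathcal{E}_s$ satisfies $({\rm D}_L f)(a,c)=-s f(a,c)$ at all $(a,c)\in\mathbb{R}\times\mathbb{R}$ with $a,c\notin\mathbb{Z}$, where ${\rm D}_L=\frac{1}{2\pi i}\frac{\partial}{\partial a}\frac{\partial}{\partial c}+c\frac{\partial}{\partial c}$; (ii) for every $m\ge1$, every $f\in\mathcal{E}_s$ satisfies ${\rm T}_m f=m^{-s}f$ on $(\mathbb{R}\setminus\mathbb{Z})\times(\mathbb{R}\setminus\frac1m\mathbb{Z})$, where ${\rm T}_m f(a,c)=\frac1m\sum_{k=0}^{m-1}f\big(\frac{a+k}{m},mc\big)$; (iii) $\mathcal{E}_s$ is invariant under the involution ${\rm J}f(a,c)=e^{-2\pi i a}f(1-a,1-c)$ and decomposes as $\mathcal{E}_s=\mathcal{E}_s^+\oplus\mathcal{E}_s^-$ into one-dimensional eigenspaces $\mathcal{E}_s^{\pm}=\langle F_s^{\pm}\rangle$ with ${\rm J}(F_s^{\pm})=\pm F_s^{\pm}$; (iv) the operator ${\rm R}(F)(a,c)=e^{-2\pi i a c}F(1-c,a)$ satisfies ${\rm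 R}(\mathcal{E}_s)=\mathcal{E}_{1-s}$, and \[{\rm R}\big(L^{\pm}(s,\cdot,\cdot)\big)(a,c)=w_\pm^{-1}\gamma^{\pm}(1-s)\,L^{\pm}(1-s,a,c),\] with $w_+=1$, $w_-=i$.
   Context: For real $a,c\notin\mathbb{Z}$ and $\Re(s)>0$ define $L^{+}(s,a,c)=\sum_{n\in\mathbb{Z}}e^{2\pi i n a}|n+c|^{-s}$ and $L^{-}(s,a,c)=\sum_{n\in\mathbb{Z}}\operatorname{sgn}(n+c)e^{2\pi i n a}|n+c|^{-s}$ (convergent as limits of symmetric partial sums); for fixed such $(a,c)$ these continue analytically in $s$ to entire functions of $s$, and this continuation is used for all $s\in\mathbb{C}$. For $0<a,c<1$, $L^{\pm}(s,a,c)=\zeta(s,a,c)\pm e^{-2\pi i a}\zeta(s,1-a,1-c)$ with $\zeta(s,a,c)=\sum_{n\ge0}e^{2\pi i n a}(n+c)^{-s}$ the Lerch zeta function. The gamma factors: $\Gamma_{\mathbb{R}}(s)=\pi^{-s/2}\Gamma(s/2)$, $\gamma^{+}(s)=\Gamma_{\mathbb{R}}(s)/\Gamma_{\mathbb{R}}(1-s)$, and $\gamma^{-}(s)=\dfrac{\pi^{-(s+1)/2}\Gamma(\frac{s+1}{2})}{\pi^{-(2-s)/2}\Gamma(\frac{2-s}{2})}$.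
   Formalization: In (iv), where γ^±(1−s) has a pole (s=1,3,5,… for +; s=2,4,… for −), the right side is undefined (pole times zero); there the identity is stated as a limit: the right side at z tends to R(L^±(s)) as z→s. At all other s it is literal equality. *)

theory Defs
  imports "HOL-Complex_Analysis.Complex_Analysis" "HOL-Library.Function_Algebras"
begin

(* The complex vector space of functions of two real variables. A function on
   (R - Z) x (R - Z) is represented by its extension by zero to R x R. *)

definition cscale :: "complex \<Rightarrow> (real \<Rightarrow> real \<Rightarrow> complex) \<Rightarrow> (real \<Rightarrow> real \<Rightarrow> complex)" where
  "cscale z f = (\<lambda>a c. z * f a c)"

global_interpretation cfun: vector_space cscale
  by unfold_locales (auto simp: cscale_def fun_eq_iff algebra_simps)

definition Lplus_sum :: "complex \<Rightarrow> real \<Rightarrow> real \<Rightarrow> nat \<Rightarrow> complex" where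
  "Lplus_sum s a c N =
     (\<Sum>n\<in>{- int N..int N}. exp (2 * of_real pi * \<i> * of_int n * of_real a)
        * of_real \<bar>of_int n + c\<bar> powr (- s))"

definition Lminus_sum :: "complex \<Rightarrow> real \<Rightarrow> real \<Rightarrow> nat \<Rightarrow> complex" where
  "Lminus_sum s a c N =
     (\<Sum>n\<in>{- int N..int N}. of_real (sgn (of_int n + c))
        * exp (2 * of_real pi * \<i> * of_int n * of_real a)
        * of_real \<bar>of_int n + c\<bar> powr (- s))"

(* The entire function that is the pointwise limit of the partial sums on Re z > 0;
   by the identity theorem there is at most one. *)

definition entire_continuation :: "(complex \<Rightarrow> nat \<Rightarrow> complex) \<Rightarrow> complex \<Rightarrow> complex" where
  "entire_continuation S =
     (THE g. g holomorphic_on UNIV \<and> (\<forall>z. Re z > 0 \<longrightarrow> S z \<longlonglongrightarrow> g z))"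

definition Lplus :: "complex \<Rightarrow> real \<Rightarrow> real \<Rightarrow> complex" where
  "Lplus s a c =
     (if a \<in> \<int> \<or> c \<in> \<int> then 0 else entire_continuation (\<lambda>z. Lplus_sum z a c) s)"

definition Lminus :: "complex \<Rightarrow> real \<Rightarrow> real \<Rightarrow> complex" where
  "Lminus s a c =
     (if a \<in> \<int> \<or> c \<in> \<int> then 0 else entire_continuation (\<lambda>z. Lminus_sum z a c) s)"

(* The library has Gamma = 0 at the poles and x / 0 = 0. Hence the quotients below have
   the correct value 0 where only the denominator has a pole, but a junk value 0 where the
   numerator has one (numerator and denominator never have a pole simultaneously). *)

definition Gamma_R :: "complex \<Rightarrow> complex" where
  "Gamma_R s = of_real pi powr (- s / 2) * Gamma (s / 2)"

definition gamma_plus :: "complex \<Rightarrow> complex" where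
  "gamma_plus s = Gamma_R s / Gamma_R (1 - s)"

definition gamma_minus :: "complex \<Rightarrow> complex" where
  "gamma_minus s =
     (of_real pi powr (- (s + 1) / 2) * Gamma ((s + 1) / 2))
     / (of_real pi powr (- (2 - s) / 2) * Gamma ((2 - s) / 2))"

definition w_plus :: complex where "w_plus = 1"
definition w_minus :: complex where "w_minus = \<i>"

definition R_op :: "(real \<Rightarrow> real \<Rightarrow> complex) \<Rightarrow> (real \<Rightarrow> real \<Rightarrow> complex)" where
  "R_op f = (\<lambda>a c. exp (- 2 * of_real pi * \<i> * of_real a * of_real c) * f (1 - c) a)"

definition J_op :: "(real \<Rightarrow> real \<Rightarrow> complex) \<Rightarrow> (real \<Rightarrow> real \<Rightarrow> complex)" where
  "J_op f = (\<lambda>a c. exp (- 2 * of_real pi * \<i> * of_real a) * f (1 - a) (1 - c))"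

definition T_op :: "nat \<Rightarrow> (real \<Rightarrow> real \<Rightarrow> complex) \<Rightarrow> (real \<Rightarrow> real \<Rightarrow> complex)" where
  "T_op m f = (\<lambda>a c. 1 / of_nat m * (\<Sum>k<m. f ((a + real k) / real m) (real m * c)))"

definition partial_a :: "(real \<Rightarrow> real \<Rightarrow> complex) \<Rightarrow> (real \<Rightarrow> real \<Rightarrow> complex)" where
  "partial_a f = (\<lambda>a c. vector_derivative (\<lambda>x. f x c) (at a))"

definition partial_c :: "(real \<Rightarrow> real \<Rightarrow> complex) \<Rightarrow> (real \<Rightarrow> real \<Rightarrow> complex)" where
  "partial_c f = (\<lambda>a c. vector_derivative (\<lambda>y. f a y) (at c))"

definition D_L :: "(real \<Rightarrow> real \<Rightarrow> complex) \<Rightarrow> (real \<Rightarrow> real \<Rightarrow> complex)" where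
  "D_L f = (\<lambda>a c. 1 / (2 * of_real pi * \<i>) * partial_a (partial_c f) a c
                    + of_real c * partial_c f a c)"

definition Lerch_space :: "complex \<Rightarrow> (real \<Rightarrow> real \<Rightarrow> complex) set" where
  "Lerch_space s = cfun.span
     {Lplus s, Lminus s,
      (\<lambda>a c. exp (- 2 * of_real pi * \<i> * of_real a * of_real c) * Lplus (1 - s) (1 - c) a),
      (\<lambda>a c. exp (- 2 * of_real pi * \<i> * of_real a * of_real c) * Lminus (1 - s) (1 - c) a)}"

definition Lerch_space_plus :: "complex \<Rightarrow> (real \<Rightarrow> real \<Rightarrow> complex) set" where
  "Lerch_space_plus s = {f \<in> Lerch_space s. J_op f = f}"

definition Lerch_space_minus :: "complex \<Rightarrow> (real \<Rightarrow> real \<Rightarrow> complex) set" where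
  "Lerch_space_minus s = {f \<in> Lerch_space s. J_op f = - f}"

end

(* Let k = 0 for L^+ and k = 1 for L^-.  Writing Gamma_R(s+k) L(s,a,c) as the Mellin transform
   of the theta series sum_n e^(2 pi i n a) (n+c)^k exp(-pi t (n+c)^2), splitting at t = 1 and
   applying theta inversion (Poisson summation) to the part t < 1 gives Riemann's formula: two
   rapidly converging sums of incomplete gamma integrals that are interchanged by R.  It defines
   an entire function Lambda_k of s for all a, c outside Z, the functional equation and
   the J-symmetry are reindexings of the two sums, and
     d/dc Lambda_0(s) = -2 pi Lambda_1(s+1),    d/dc Lambda_1(s) = -s Lambda_0(s+1),
   which with the functional equation also gives the a-derivatives and hence D_L.  The operators
   T_m are treated for Re s > 0 on partial sums and then by the identity theorem.  All four
   spanning functions are multiples of Lambda_0(s) or Lambda_1(s), by reciprocals of Gamma_R that never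
   vanish simultaneously, so Lambda_0(s), Lambda_1(s) form a basis; they are nonzero because
   Lambda_k blows up like |c|^(-s) as c -> 0 when Re s > 0. *)

theory Submission
  imports Defs "HOL-Probability.Probability"
begin

section \<open>Differentiation under the integral sign\<close>

text \<open>For 0 < Re s <= 1 the series converge only conditionally, so on t < 1 absolute
  convergence cannot justify exchanging sum and integral. Instead the symmetric partial theta sums
  are bounded by C t^(-k/2), uniformly in the truncation, by summation by parts with a outside Z.
  Against t^((Re s + k)/2 - 1) this is integrable at 0 for every Re s > 0, which identifies the
  limit on the whole half-plane at once. The weight (n+c)^k with gamma parameter (s+k)/2 handles
  both parities together, since (n+c)^k |n+c|^(-k) = sgn(n+c)^k. Neither of the two sums is closed
  under d/dc alone for k = 1: integration by parts leaves Gaussian sums at t = 1, and these cancel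
  only between the two halves, by theta inversion at its fixed point t = 1. Sums over the integers
  are Bochner integrals for counting measure, so one dominated convergence argument differentiates
  series and integrals alike.\<close>

lemma has_derivative_lebesgue_integral:
  fixes f :: "'p::real_normed_vector \<Rightarrow> 'b \<Rightarrow> 'e::{banach,second_countable_topology}"
  assumes U: "open U" "x0 \<in> U"
    and int: "\<And>x. x \<in> U \<Longrightarrow> integrable M (f x)"
    and deriv: "\<And>t. t \<in> space M \<Longrightarrow> ((\<lambda>x. f x t) has_derivative D t) (at x0)"
    and meas: "\<And>h. (\<lambda>t. D t h) \<in> borel_measurable M"
    and lip: "\<And>x t. x \<in> U \<Longrightarrow> t \<in> space M \<Longrightarrow> norm (f x t - f x0 t) \<le> g t * norm (x - x0)"
    and bound: "\<And>h t. t \<in> space M \<Longrightarrow> norm (D t h) \<le> g t * norm h"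
    and g: "integrable M g"
  shows "((\<lambda>x. \<integral>t. f x t \<partial>M) has_derivative (\<lambda>h. \<integral>t. D t h \<partial>M)) (at x0)"
proof -
  have intD: "integrable M (\<lambda>t. D t h)" for h
    by (rule Bochner_Integration.integrable_bound[where f="\<lambda>t. g t * norm h"])
      (use g meas bound in \<open>auto intro!: AE_I2 order_trans[OF bound] abs_ge_self\<close>)
  have lin: "t \<in> space M \<Longrightarrow> linear (D t)" for t
    using deriv has_derivative_linear by blast
  have bl: "bounded_linear (\<lambda>h. \<integral>t. D t h \<partial>M)"
  proof (rule bounded_linear_intro)
    show "(\<integral>t. D t (x + y) \<partial>M) = (\<integral>t. D t x \<partial>M) + (\<integral>t. D t y \<partial>M)" for x y
      unfolding Bochner_Integration.integral_add[OF intD intD, symmetric]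
      by (rule Bochner_Integration.integral_cong) (auto simp: linear_add[OF lin])
    show "(\<integral>t. D t (r *\<^sub>R x) \<partial>M) = r *\<^sub>R (\<integral>t. D t x \<partial>M)" for x r
      unfolding integral_scaleR_right[symmetric]
      by (rule Bochner_Integration.integral_cong) (auto simp: linear_scale[OF lin])
    show "norm (\<integral>t. D t x \<partial>M) \<le> norm x * (\<integral>t. g t \<partial>M)" for x
    proof -
      have "norm (\<integral>t. D t x \<partial>M) \<le> (\<integral>t. norm (D t x) \<partial>M)"
        by (rule integral_norm_bound)
      also have "\<dots> \<le> (\<integral>t. g t * norm x \<partial>M)"
        by (rule integral_mono) (use g intD bound in auto)
      finally have "norm (\<integral>t. D t x \<partial>M) \<le> (\<integral>t. g t * norm x \<partial>M)" .
      then show ?thesis by (simp add: mult.commute)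
    qed
  qed
  \<comment> \<open>The normalised remainder tends to 0 pointwise by differentiability and is at
    most \<open>2 * g\<close>, one \<open>g\<close> from the difference quotient and one from
    \<open>D\<close>; dominated convergence along sequences finishes.\<close>
  define r where "r = (\<lambda>y t. norm (f y t - f x0 t - D t (y - x0)) / norm (y - x0))"
  have meas_r: "r y \<in> borel_measurable M" if "y \<in> U" for y
    using borel_measurable_integrable[OF int[OF that]] borel_measurable_integrable[OF int[OF U(2)]] meas
    unfolding r_def by measurable
  have r_bound: "norm (r y t) \<le> 2 * g t" if "y \<in> U" "t \<in> space M" "y \<noteq> x0" for y t
    using norm_triangle_ineq4[of "f y t - f x0 t" "D t (y - x0)"] lip[OF that(1,2)] bound[OF that(2), of "y - x0"] that(3)
    by (simp add: r_def divide_simps algebra_simps)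
  show ?thesis
    unfolding has_derivative_iff_norm
  proof (intro conjI bl)
    show "((\<lambda>y. norm ((\<integral>t. f y t \<partial>M) - (\<integral>t. f x0 t \<partial>M) - (\<integral>t. D t (y - x0) \<partial>M)) / norm (y - x0)) \<longlongrightarrow> 0) (at x0)"
      unfolding tendsto_at_iff_sequentially comp_def
    proof (intro allI impI)
      fix X :: "nat \<Rightarrow> 'p" assume X: "\<forall>i. X i \<in> UNIV - {x0}" "X \<longlonglongrightarrow> x0"
      then obtain N where N: "X n \<in> U" if "n \<ge> N" for n
        using topological_tendstoD[OF X(2) U] by (auto simp: eventually_sequentially)
      have "(\<lambda>n. norm ((\<integral>t. f (X (n+N)) t \<partial>M) - (\<integral>t. f x0 t \<partial>M) - (\<integral>t. D t (X (n+N) - x0) \<partial>M)) / norm (X (n+N) - x0)) \<longlonglongrightarrow> 0"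
      proof (rule Lim_null_comparison)
        show "\<forall>\<^sub>F n in sequentially. norm (norm ((\<integral>t. f (X (n+N)) t \<partial>M) - (\<integral>t. f x0 t \<partial>M) - (\<integral>t. D t (X (n+N) - x0) \<partial>M)) / norm (X (n+N) - x0)) \<le> (\<integral>t. r (X (n+N)) t \<partial>M)"
        proof (intro always_eventually allI)
          fix n
          let ?x = "X (n+N)"
          have "(\<integral>t. f ?x t \<partial>M) - (\<integral>t. f x0 t \<partial>M) - (\<integral>t. D t (?x - x0) \<partial>M) = (\<integral>t. f ?x t - f x0 t - D t (?x - x0) \<partial>M)"
            using int[OF N[of "n+N"]] int[OF U(2)] intD by simp
          then have "norm ((\<integral>t. f ?x t \<partial>M) - (\<integral>t. f x0 t \<partial>M) - (\<integral>t. D t (?x - x0) \<partial>M)) \<le> (\<integral>t. norm (f ?x t - f x0 t - D t (?x - x0)) \<partial>M)"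
            by simp
          then show "norm (norm ((\<integral>t. f ?x t \<partial>M) - (\<integral>t. f x0 t \<partial>M) - (\<integral>t. D t (?x - x0) \<partial>M)) / norm (?x - x0)) \<le> (\<integral>t. r ?x t \<partial>M)"
            unfolding r_def by (simp add: divide_right_mono)
        qed
        have "(\<lambda>n. \<integral>t. r (X (n+N)) t \<partial>M) \<longlonglongrightarrow> (\<integral>t. 0 \<partial>M)"
        proof (rule integral_dominated_convergence[where w="\<lambda>t. 2 * g t"])
          show "AE t in M. (\<lambda>n. r (X (n+N)) t) \<longlonglongrightarrow> 0"
          proof (rule AE_I2)
            fix t assume t: "t \<in> space M"
            have "((\<lambda>y. r y t) \<longlongrightarrow> 0) (at x0)"
              using deriv[OF t] unfolding has_derivative_iff_norm r_def by blast
            then have "(\<lambda>n. r (X n) t) \<longlonglongrightarrow> 0"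
              unfolding tendsto_at_iff_sequentially comp_def using X by blast
            then show "(\<lambda>n. r (X (n+N)) t) \<longlonglongrightarrow> 0" by (rule LIMSEQ_ignore_initial_segment)
          qed
        qed (use g meas_r N r_bound X(1) in auto)
        then show "(\<lambda>n. \<integral>t. r (X (n+N)) t \<partial>M) \<longlonglongrightarrow> 0" by simp
      qed
      then show "(\<lambda>n. norm ((\<integral>t. f (X n) t \<partial>M) - (\<integral>t. f x0 t \<partial>M) - (\<integral>t. D t (X n - x0) \<partial>M)) / norm (X n - x0)) \<longlonglongrightarrow> 0"
        by (rule LIMSEQ_offset)
    qed
  qed
qed

text \<open>The mean value inequality on the convex set \<open>U\<close> turns the bound on
  \<open>f'\<close> into the Lipschitz hypothesis of the Frechet version, with the same dominating
  function.\<close>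

lemma has_vector_derivative_lebesgue_integral:
  fixes f :: "real \<Rightarrow> 'b \<Rightarrow> 'e::{banach,second_countable_topology}"
  assumes U: "open U" "convex U" "x0 \<in> U"
    and int: "\<And>x. x \<in> U \<Longrightarrow> integrable M (f x)"
    and deriv: "\<And>x t. x \<in> U \<Longrightarrow> t \<in> space M \<Longrightarrow> ((\<lambda>x. f x t) has_vector_derivative f' x t) (at x)"
    and meas: "f' x0 \<in> borel_measurable M"
    and bound: "\<And>x t. x \<in> U \<Longrightarrow> t \<in> space M \<Longrightarrow> norm (f' x t) \<le> g t"
    and g: "integrable M g"
  shows "((\<lambda>x. \<integral>t. f x t \<partial>M) has_vector_derivative (\<integral>t. f' x0 t \<partial>M)) (at x0)"
proof -
  have "((\<lambda>x. \<integral>t. f x t \<partial>M) has_derivative (\<lambda>h. \<integral>t. h *\<^sub>R f' x0 t \<partial>M)) (at x0)"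
  proof (rule has_derivative_lebesgue_integral[OF U(1,3) int _ _ _ _ g])
    show "((\<lambda>x. f x t) has_derivative (\<lambda>h. h *\<^sub>R f' x0 t)) (at x0)" if "t \<in> space M" for t
      using deriv[OF U(3) that] by (simp add: has_vector_derivative_def)
    show "norm (f x t - f x0 t) \<le> g t * norm (x - x0)" if "x \<in> U" "t \<in> space M" for x t
    proof (rule differentiable_bound[OF U(2)])
      fix y assume y: "y \<in> U"
      show "((\<lambda>x. f x t) has_derivative (\<lambda>h. h *\<^sub>R f' y t)) (at y within U)"
        using deriv[OF y that(2)] by (simp add: has_vector_derivative_def has_derivative_at_withinI)
      show "onorm (\<lambda>h. h *\<^sub>R f' y t) \<le> g t"
        by (rule onorm_le) (use bound[OF y that(2)] in \<open>simp add: mult.commute mult_left_mono\<close>)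
    qed (use that U in auto)
    show "norm (h *\<^sub>R f' x0 t) \<le> g t * norm h" if "t \<in> space M" for h t
      using bound[OF U(3) that] by (simp add: mult.commute mult_left_mono)
  qed (use meas in auto)
  then show ?thesis by (simp add: has_vector_derivative_def)
qed

lemma has_field_derivative_lebesgue_integral:
  fixes f :: "complex \<Rightarrow> 'b \<Rightarrow> complex"
  assumes U: "open U" "convex U" "x0 \<in> U"
    and int: "\<And>x. x \<in> U \<Longrightarrow> integrable M (f x)"
    and deriv: "\<And>x t. x \<in> U \<Longrightarrow> t \<in> space M \<Longrightarrow> ((\<lambda>x. f x t) has_field_derivative f' x t) (at x)"
    and meas: "f' x0 \<in> borel_measurable M"
    and bound: "\<And>x t. x \<in> U \<Longrightarrow> t \<in> space M \<Longrightarrow> norm (f' x t) \<le> g t"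
    and g: "integrable M g"
  shows "((\<lambda>x. \<integral>t. f x t \<partial>M) has_field_derivative (\<integral>t. f' x0 t \<partial>M)) (at x0)"
proof -
  have "((\<lambda>x. \<integral>t. f x t \<partial>M) has_derivative (\<lambda>h. \<integral>t. f' x0 t * h \<partial>M)) (at x0)"
  proof (rule has_derivative_lebesgue_integral[OF U(1,3) int _ _ _ _ g])
    show "((\<lambda>x. f x t) has_derivative (\<lambda>h. f' x0 t * h)) (at x0)" if "t \<in> space M" for t
      using deriv[OF U(3) that] by (simp add: has_field_derivative_def)
    show "norm (f x t - f x0 t) \<le> g t * norm (x - x0)" if "x \<in> U" "t \<in> space M" for x t
      by (rule field_differentiable_bound[OF U(2), where f'="\<lambda>x. f' x t"])
        (use that U deriv bound has_field_derivative_at_within in blast)+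
    show "norm (f' x0 t * h) \<le> g t * norm h" if "t \<in> space M" for h t
      using bound[OF U(3) that] by (simp add: norm_mult mult_right_mono)
  qed (use meas in auto)
  then show ?thesis by (simp add: has_field_derivative_def mult_commute_abs)
qed

section \<open>Sums over the integers and incomplete gamma integrals\<close>

definition ee :: "real \<Rightarrow> complex" where "ee x = cis (2 * pi * x)"

lemma norm_ee [simp]: "norm (ee x) = 1"
  by (simp add: ee_def)

lemma ee_add: "ee (x + y) = ee x * ee y"
  by (simp add: ee_def cis_mult ring_distribs)

lemma ee_minus: "ee (- x) = inverse (ee x)"
  by (simp add: ee_def)

lemma ee_diff: "ee (x - y) = ee x / ee y"
  using ee_add[of x "-y"] by (simp add: ee_minus divide_inverse)

lemma ee_nonzero [simp]: "ee x \<noteq> 0"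
  by (simp add: ee_def)

lemma ee_0 [simp]: "ee 0 = 1"
  by (simp add: ee_def)

lemma ee_of_int [simp]: "ee (of_int n) = 1"
  using cis_multiple_2pi[of "of_int n"] by (simp add: ee_def)

lemma ee_mult_int: "ee (of_int n * x) = ee x powi n"
  by (simp add: ee_def cis_power_int mult_ac)

lemma ee_eq_1_iff: "ee x = 1 \<longleftrightarrow> x \<in> \<int>"
proof
  assume "ee x = 1"
  then have "cos (2 * pi * x) = 1" by (simp add: ee_def complex_eq_iff)
  then obtain n :: int where "2 * pi * x = of_int n * 2 * pi" using cos_one_2pi_int by blast
  then have "x = of_int n" by simp
  then show "x \<in> \<int>" by simp
next
  assume "x \<in> \<int>" then show "ee x = 1" by (auto elim!: Ints_cases)
qed

lemma exp_eq_ee: "exp (\<i> * of_real (2 * pi * x)) = ee x"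
  by (simp add: ee_def cis_conv_exp)

lemma has_vector_derivative_exp_comp:
  fixes g :: "real \<Rightarrow> complex"
  assumes "(g has_vector_derivative g') (at x within S)"
  shows "((\<lambda>x. exp (g x)) has_vector_derivative g' * exp (g x)) (at x within S)"
  using field_vector_diff_chain_within[OF assms, of exp "exp (g x)"]
  by (simp add: o_def DERIV_exp has_field_derivative_at_within)

lemma ee_has_vector_derivative [derivative_intros]:
  assumes "(f has_real_derivative f') (at x within S)"
  shows "((\<lambda>x. ee (f x)) has_vector_derivative (2 * pi * \<i> * f' * ee (f x))) (at x within S)"
proof -
  have "((\<lambda>x. \<i> * of_real (2 * pi * f x)) has_vector_derivative \<i> * of_real (2 * pi * f')) (at x within S)"
    by (intro has_vector_derivative_mult_right has_vector_derivative_of_real DERIV_cmult assms)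
  from has_vector_derivative_exp_comp[OF this] show ?thesis
    unfolding exp_eq_ee by (simp add: mult_ac)
qed

lemma continuous_on_ee [continuous_intros]: "continuous_on S f \<Longrightarrow> continuous_on S (\<lambda>x. ee (f x))"
  unfolding ee_def by (intro continuous_intros)

section \<open>Series over the integers as integrals for counting measure\<close>

abbreviation isummable :: "(int \<Rightarrow> 'a::{banach,second_countable_topology}) \<Rightarrow> bool" where
  "isummable f \<equiv> integrable (count_space UNIV) f"

abbreviation isum :: "(int \<Rightarrow> 'a::{banach,second_countable_topology}) \<Rightarrow> 'a" where
  "isum f \<equiv> integral\<^sup>L (count_space UNIV) f"

text \<open>One majorant for all series: every summand below decays like a Gaussian, hence is at
  most a constant times this.\<close>

abbreviation int_decay :: "int \<Rightarrow> real" where "int_decay n \<equiv> exp (- \<bar>of_int n\<bar>)"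

lemma isummable_exp: "isummable int_decay"
proof -
  let ?f = "\<lambda>n::int. int_decay n"
  have s: "summable (\<lambda>n. norm (exp (- real n)))"
    using summable_geometric[of "exp (-1::real)"] by (simp add: exp_of_nat_mult[symmetric])
  have "Infinite_Set_Sum.abs_summable_on (\<lambda>n. ?f (int n)) UNIV"
    using s by (simp add: abs_summable_on_nat_iff')
  then have 1: "Infinite_Set_Sum.abs_summable_on ?f (range int)"
    by (subst abs_summable_on_reindex_iff[symmetric]) auto
  have "Infinite_Set_Sum.abs_summable_on (\<lambda>n. ?f (- int n)) UNIV"
    using s by (simp add: abs_summable_on_nat_iff')
  then have 2: "Infinite_Set_Sum.abs_summable_on ?f (range (\<lambda>n. - int n))"
    by (subst abs_summable_on_reindex_iff[symmetric]) (auto intro: injI)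
  have "UNIV = range int \<union> range (\<lambda>n. - int n)"
    by (auto simp: image_iff) (metis int_cases2)
  with abs_summable_on_union[OF 1 2] show ?thesis
    by (simp add: Infinite_Set_Sum.abs_summable_on_def)
qed

lemma isummable_bound:
  fixes f :: "int \<Rightarrow> 'a::{banach,second_countable_topology}"
  assumes "\<And>n. norm (f n) \<le> C * int_decay n"
  shows "isummable f"
proof (rule Bochner_Integration.integrable_bound)
  show "isummable (\<lambda>n. C * int_decay n)" using isummable_exp by simp
  show "AE n in count_space UNIV. norm (f n) \<le> norm (C * int_decay n)"
    using assms by (auto intro!: AE_I2 order_trans[OF assms] simp: abs_mult)
qed auto

lemma isum_norm_le:
  fixes f :: "int \<Rightarrow> 'a::{banach,second_countable_topology}"
  assumes "\<And>n. norm (f n) \<le> g n" "isummable g"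
  shows "norm (isum f) \<le> isum g"
proof -
  have "norm (isum f) \<le> isum (\<lambda>n. norm (f n))" by (rule integral_norm_bound)
  also have "\<dots> \<le> isum g"
  proof (rule integral_mono)
    show "isummable (\<lambda>n. norm (f n))"
      by (rule Bochner_Integration.integrable_bound[OF assms(2)])
        (auto intro!: AE_I2 order_trans[OF assms(1)])
  qed (use assms in auto)
  finally show ?thesis .
qed

lemma isum_indicator:
  fixes f :: "int \<Rightarrow> 'a::{banach,second_countable_topology}"
  assumes "finite A"
  shows "isum (\<lambda>n. indicat_real A n *\<^sub>R f n) = (\<Sum>n\<in>A. f n)"
proof -
  have "isum (\<lambda>n. indicat_real A n *\<^sub>R f n) = (\<Sum>n | n \<in> UNIV \<and> indicat_real A n *\<^sub>R f n \<noteq> 0. indicat_real A n *\<^sub>R f n)"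
    by (rule lebesgue_integral_count_space_finite_support)
      (rule finite_subset[OF _ assms], auto simp: indicator_def split: if_splits)
  also have "\<dots> = (\<Sum>n\<in>A. f n)"
    using assms by (intro sum.mono_neutral_cong_left) (auto simp: indicator_def split: if_splits)
  finally show ?thesis .
qed

text \<open>Dominated convergence for the truncated summands; the symmetric ranges are those in
  which the L-series are defined to converge.\<close>

lemma isum_partial_sums:
  fixes f :: "int \<Rightarrow> 'a::{banach,second_countable_topology}"
  assumes "isummable f"
  shows "(\<lambda>N. \<Sum>n\<in>{- int N..int N}. f n) \<longlonglongrightarrow> isum f"
proof -
  have "(\<lambda>N. isum (\<lambda>n. indicat_real {- int N..int N} n *\<^sub>R f n)) \<longlonglongrightarrow> isum f"
  proof (rule integral_dominated_convergence[where w="\<lambda>n. norm (f n)"])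
    show "AE n in count_space UNIV. (\<lambda>N. indicat_real {- int N..int N} n *\<^sub>R f n) \<longlonglongrightarrow> f n"
    proof (rule AE_I2)
      fix n :: int
      have "\<forall>\<^sub>F N in sequentially. indicat_real {- int N..int N} n *\<^sub>R f n = f n"
        using eventually_ge_at_top[of "nat \<bar>n\<bar>"] by eventually_elim (auto simp: indicator_def)
      then show "(\<lambda>N. indicat_real {- int N..int N} n *\<^sub>R f n) \<longlonglongrightarrow> f n"
        by (rule tendsto_eventually)
    qed
  qed (use assms in \<open>auto simp: indicator_def\<close>)
  then show ?thesis by (simp add: isum_indicator)
qed

lemma isum_reindex_shift:
  fixes f :: "int \<Rightarrow> 'a::{banach,second_countable_topology}"
  shows "isum (\<lambda>n. f (n + k)) = isum f"
  by (rule integral_bij_count_space) (rule bij_betwI[where g="\<lambda>n. n - k"], auto)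

lemma isum_reindex_reflect:
  fixes f :: "int \<Rightarrow> 'a::{banach,second_countable_topology}"
  shows "isum (\<lambda>n. f (k - n)) = isum f"
  by (rule integral_bij_count_space) (rule bij_betwI[where g="\<lambda>n. k - n"], auto)

text \<open>With y = |n + c|, one factor \<open>exp y\<close> pays for the power of y and one factor
  exp (- y) is kept as decay; completing the square gives 2 y - t y^2 <= 1 / t. The power 2 occurs
  because derivatives produce second moments.\<close>

lemma gauss_bound:
  fixes c t :: real
  assumes "t > 0" "\<bar>c\<bar> \<le> B" "j \<le> (2::nat)"
  shows "\<bar>of_int n + c\<bar> ^ j * exp (- (t * (of_int n + c)\<^sup>2)) \<le> 2 * exp (1 / t + B) * int_decay n"
proof -
  define y where "y = \<bar>of_int n + c\<bar>"
  have y: "0 \<le> y" "y \<ge> \<bar>of_int n\<bar> - B" using assms(2) unfolding y_def by linarith+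
  have "1 + y + y\<^sup>2 / 2 \<le> exp y" by (rule exp_lower_Taylor_quadratic[OF y(1)])
  moreover have "y ^ j \<le> 2 * (1 + y + y\<^sup>2 / 2)"
    using assms(3) y(1) by (auto simp: numeral_2_eq_2 le_Suc_eq power2_eq_square)
  ultimately have 1: "y ^ j \<le> 2 * exp y" by (smt (verit))
  have "0 \<le> (t * y - 1)\<^sup>2 / t" using assms by simp
  also have "\<dots> = t * y\<^sup>2 - 2 * y + 1 / t" using assms by (simp add: power2_eq_square field_simps)
  finally have 2: "y - t * y\<^sup>2 \<le> 1 / t + B - \<bar>of_int n\<bar>" using y by linarith
  have "y ^ j * exp (- (t * y\<^sup>2)) \<le> 2 * exp y * exp (- (t * y\<^sup>2))"
    using 1 by (intro mult_right_mono) auto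
  also have "\<dots> = 2 * exp (y - t * y\<^sup>2)" by (simp add: exp_diff exp_minus field_simps)
  also have "\<dots> \<le> 2 * exp (1 / t + B - \<bar>of_int n\<bar>)" using 2 by simp
  finally show ?thesis by (simp add: y_def exp_diff exp_minus exp_add field_simps)
qed

lemma norm_integral_le:
  fixes f :: "'b \<Rightarrow> 'a::{banach,second_countable_topology}"
  assumes "integrable M f" "integrable M g" "\<And>x. x \<in> space M \<Longrightarrow> norm (f x) \<le> g x"
  shows "norm (integral\<^sup>L M f) \<le> integral\<^sup>L M g"
  using integral_norm_bound[of M f] integral_mono[OF integrable_norm[OF assms(1)] assms(2,3)]
  by (rule order_trans)

section \<open>Upper incomplete gamma integrals in a logarithmic variable\<close>

abbreviation posm :: "real measure" where "posm \<equiv> restrict_space lborel {0<..}"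

lemma exp_minus_posm: "integrable posm (\<lambda>u. exp (- u))" "integral\<^sup>L posm (\<lambda>u. exp (- u)) = 1"
proof -
  have "(\<integral>\<^sup>+u. ennreal (exp (- u)) \<partial>posm) = (\<integral>\<^sup>+u. ennreal (exp (- u)) * indicator {0<..} u \<partial>lborel)"
    by (rule nn_integral_restrict_space) simp
  also have "\<dots> = (\<integral>\<^sup>+u. ennreal (u ^ 0 * exp (- u)) * indicator {0..} u \<partial>lborel)"
    using AE_lborel_singleton[of "0::real"] by (intro nn_integral_cong_AE) (auto simp: indicator_def)
  also have "\<dots> = ennreal 1" by (subst nn_intergal_power_times_exp_Ici) simp
  finally have "(\<integral>\<^sup>+u. ennreal (exp (- u)) \<partial>posm) = ennreal 1" .
  then have "has_bochner_integral posm (\<lambda>u. exp (- u)) 1"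
    by (intro has_bochner_integral_nn_integral measurable_restrict_space1) auto
  then show "integrable posm (\<lambda>u. exp (- u))" "integral\<^sup>L posm (\<lambda>u. exp (- u)) = 1"
    by (simp_all add: has_bochner_integral_iff)
qed

lemma integral_posm_FTC:
  fixes F f :: "real \<Rightarrow> complex"
  assumes F: "\<And>u. (F has_vector_derivative f u) (at u)" and f: "continuous_on UNIV f"
    and int: "integrable posm f" and lim: "(F \<longlongrightarrow> L) at_top"
  shows "integral\<^sup>L posm f = L - F 0"
proof -
  have si: "set_integrable lborel {0<..} f"
    using int by (simp add: set_integrable_def integrable_restrict_space)
  have "(LBINT u=0..\<infinity>. f u) = L - F 0"
  proof (rule interval_integral_FTC_integrable)
    show "((F \<circ> real_of_ereal) \<longlongrightarrow> F 0) (at_right 0)"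
    proof -
      have "(F \<longlongrightarrow> F 0) (at_right 0)"
        using F[of 0] has_vector_derivative_continuous continuous_at_imp_continuous_at_within
        unfolding continuous_within by blast
      then show ?thesis by (simp add: zero_ereal_def ereal_tendsto_simps)
    qed
    show "((F \<circ> real_of_ereal) \<longlongrightarrow> L) (at_left \<infinity>)"
      using lim by (simp add: ereal_tendsto_simps)
    show "set_integrable lborel (einterval 0 \<infinity>) f"
      using si by (simp add: zero_ereal_def)
    show "isCont f u" for u using f by (simp add: continuous_on_eq_continuous_at)
  qed (use F in auto)
  then have "(LBINT u:{0<..}. f u) = L - F 0"
    by (simp add: interval_lebesgue_integral_0_infty)
  then show ?thesis
    by (simp add: integral_restrict_space set_lebesgue_integral_def)
qed

text \<open>The substitution t = exp u turns the integral of exp (- x t) t powr (v - 1) over t > 1, that is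
  x powr (- v) times the upper incomplete gamma function, into this one.\<close>

definition uGamma :: "complex \<Rightarrow> real \<Rightarrow> complex" where
  "uGamma v x = (\<integral>u. exp (v * of_real u - of_real (x * exp u)) \<partial>posm)"

text \<open>Half of x exp u is estimated by exp u >= 1 and yields exp (- x / 2); the other half is
  estimated by exp u >= u^2 / 2 and beats the linear term (\<open>\<sigma>\<close> + 1) u by
  completing the square, whence (\<open>\<sigma>\<close> + 1)^2 / \<open>\<delta>\<close>. The extra
  1 leaves the integrable exp (- u).\<close>

lemma uGamma_kernel_bound:
  assumes "0 < \<delta>" "\<delta> \<le> x" "\<bar>Re v\<bar> \<le> \<sigma>" "0 \<le> u"
  shows "norm (exp (v * of_real u - of_real (x * exp u))) \<le> exp ((\<sigma> + 1)\<^sup>2 / \<delta>) * exp (- x / 2) * exp (- u)"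
proof -
  have e: "exp u \<ge> 1" "exp u \<ge> u\<^sup>2 / 2" using exp_lower_Taylor_quadratic[OF assms(4)] assms(4) by auto
  have "x / 2 * 1 \<le> x / 2 * exp u" using e assms by (intro mult_left_mono) auto
  moreover have "\<delta> / 2 * (u\<^sup>2 / 2) \<le> x / 2 * exp u" using e assms by (intro mult_mono) auto
  ultimately have 1: "x * exp u \<ge> x / 2 + \<delta> * u\<^sup>2 / 4" by simp
  have 2: "Re v * u \<le> \<sigma> * u" using assms by (intro mult_right_mono) auto
  have "0 \<le> ((\<sigma> + 1) - \<delta> * u / 2)\<^sup>2 / \<delta>" using assms by simp
  also have "\<dots> = (\<sigma> + 1)\<^sup>2 / \<delta> + \<delta> * u\<^sup>2 / 4 - (\<sigma> + 1) * u"
    using assms by (simp add: power2_eq_square field_simps)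
  finally have "Re v * u - x * exp u \<le> (\<sigma> + 1)\<^sup>2 / \<delta> + - x / 2 + - u"
    using 1 2 by (simp add: algebra_simps)
  then have "exp (Re v * u - x * exp u) \<le> exp ((\<sigma> + 1)\<^sup>2 / \<delta> + - x / 2 + - u)" by simp
  then show ?thesis by (simp only: exp_add) simp
qed

lemma uGamma_kernel_measurable [measurable]:
  "(\<lambda>u. exp (v * of_real u - of_real (x * exp u)) :: complex) \<in> borel_measurable posm"
  by (intro measurable_restrict_space1) measurable

lemma space_posm [simp]: "space posm = {0<..}"
  by (simp add: space_restrict_space)

lemma uGamma_integrable:
  assumes "x > 0"
  shows "integrable posm (\<lambda>u. exp (v * of_real u - of_real (x * exp u)) :: complex)"
proof (rule Bochner_Integration.integrable_bound)
  show "integrable posm (\<lambda>u. exp ((\<bar>Re v\<bar> + 1)\<^sup>2 / x) * exp (- x / 2) * exp (- u))"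
    using exp_minus_posm by simp
  show "AE u in posm. norm (exp (v * of_real u - of_real (x * exp u)) :: complex) \<le> norm (exp ((\<bar>Re v\<bar> + 1)\<^sup>2 / x) * exp (- x / 2) * exp (- u))"
    using uGamma_kernel_bound[of x x v "\<bar>Re v\<bar>"] assms by (intro AE_I2) (auto simp: abs_mult)
qed measurable

lemma uGamma_bound:
  assumes "0 < \<delta>" "\<delta> \<le> x" "\<bar>Re v\<bar> \<le> \<sigma>"
  shows "norm (uGamma v x) \<le> exp ((\<sigma> + 1)\<^sup>2 / \<delta>) * exp (- x / 2)"
proof -
  have "norm (uGamma v x) \<le> (\<integral>u. exp ((\<sigma> + 1)\<^sup>2 / \<delta>) * exp (- x / 2) * exp (- u) \<partial>posm)"
    unfolding uGamma_def
    by (rule norm_integral_le[OF uGamma_integrable])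
      (use uGamma_kernel_bound[OF assms] assms exp_minus_posm in auto)
  also have "\<dots> = exp ((\<sigma> + 1)\<^sup>2 / \<delta>) * exp (- x / 2)" using exp_minus_posm by simp
  finally show ?thesis .
qed

text \<open>Differentiation brings down a factor u <= exp u, which shifts v by 1 and turns the
  constant \<open>\<sigma>\<close> + 1 into \<open>\<sigma>\<close> + 2; inside the proof the unit
  ball around v costs one more. The explicit bound on the derivative is what later allows
  differentiating the series termwise.\<close>

lemma uGamma_holomorphic_aux:
  assumes "0 < \<delta>" "\<delta> \<le> x" "\<bar>Re v\<bar> \<le> \<sigma>"
  shows "\<exists>d. ((\<lambda>v. uGamma v x) has_field_derivative d) (at v) \<and> norm d \<le> exp ((\<sigma> + 2)\<^sup>2 / \<delta>) * exp (- x / 2)"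
proof -
  have x: "x > 0" using assms by simp
  have shift: "norm (of_real u * exp (w * of_real u - of_real (x * exp u))) \<le> norm (exp ((w + 1) * of_real u - of_real (x * exp u)))"
    if "u \<ge> 0" for u :: real and w :: complex
  proof -
    have "u \<le> exp u" using exp_ge_add_one_self[of u] by linarith
    then have "u * exp (Re w * u - x * exp u) \<le> exp u * exp (Re w * u - x * exp u)"
      by (intro mult_right_mono) auto
    then show ?thesis using that by (simp add: norm_mult exp_add[symmetric] algebra_simps)
  qed
  have M: "(\<lambda>u. of_real u * exp (w * of_real u - of_real (x * exp u)) :: complex) \<in> borel_measurable posm" for w
    by (intro measurable_restrict_space1) measurable
  let ?d = "\<integral>u. of_real u * exp (v * of_real u - of_real (x * exp u)) \<partial>posm"
  have 1: "((\<lambda>v. uGamma v x) has_field_derivative ?d) (at v)"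
    unfolding uGamma_def
  proof (rule has_field_derivative_lebesgue_integral[of "ball v 1"])
    show "((\<lambda>w. exp (w * of_real u - of_real (x * exp u))) has_field_derivative of_real u * exp (w * of_real u - of_real (x * exp u))) (at w)"
      for w :: complex and u by (auto intro!: derivative_eq_intros)
    show "integrable posm (\<lambda>u. exp ((\<sigma> + 3)\<^sup>2 / \<delta>) * exp (- x / 2) * exp (- u))"
      using exp_minus_posm by simp
    show "norm (of_real u * exp (w * of_real u - of_real (x * exp u))) \<le> exp ((\<sigma> + 3)\<^sup>2 / \<delta>) * exp (- x / 2) * exp (- u)"
      if "w \<in> ball v 1" "u \<in> space posm" for w u
    proof -
      have "\<bar>Re (v - w)\<bar> < 1" using that abs_Re_le_cmod[of "v - w"] by (auto simp: dist_norm intro: le_less_trans)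
      then have "\<bar>Re (w + 1)\<bar> \<le> \<sigma> + 2" using assms(3) by simp
      from order_trans[OF shift uGamma_kernel_bound[OF assms(1,2) this]] that show ?thesis
        by (simp add: add.commute)
    qed
  qed (use M uGamma_integrable[OF x] in auto)
  have "norm ?d \<le> (\<integral>u. exp ((\<sigma> + 2)\<^sup>2 / \<delta>) * exp (- x / 2) * exp (- u) \<partial>posm)"
  proof -
    have "\<bar>Re (v + 1)\<bar> \<le> \<sigma> + 1" using assms(3) by simp
    from order_trans[OF shift uGamma_kernel_bound[OF assms(1,2) this]]
    have b: "norm (of_real u * exp (v * of_real u - of_real (x * exp u))) \<le> exp ((\<sigma> + 2)\<^sup>2 / \<delta>) * exp (- x / 2) * exp (- u)"
      if "u > 0" for u using that by (simp add: add.commute)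
    have i: "integrable posm (\<lambda>u. exp ((\<sigma> + 2)\<^sup>2 / \<delta>) * exp (- x / 2) * exp (- u))"
      using exp_minus_posm by simp
    have "integrable posm (\<lambda>u. of_real u * exp (v * of_real u - of_real (x * exp u)) :: complex)"
      by (rule Bochner_Integration.integrable_bound[OF i M]) (use b in \<open>auto intro!: AE_I2 simp: abs_mult\<close>)
    then show ?thesis by (rule norm_integral_le[OF _ i]) (use b in auto)
  qed
  also have "\<dots> = exp ((\<sigma> + 2)\<^sup>2 / \<delta>) * exp (- x / 2)" using exp_minus_posm by simp
  finally show ?thesis using 1 by blast
qed

lemma uGamma_deriv_x:
  assumes "x > 0"
  shows "((\<lambda>x. uGamma v x) has_vector_derivative - uGamma (v + 1) x) (at x)"
proof -
  have "((\<lambda>x. uGamma v x) has_vector_derivative (\<integral>u. - exp ((v + 1) * of_real u - of_real (x * exp u)) \<partial>posm)) (at x)"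
    unfolding uGamma_def
  \<comment> \<open>The constant of the kernel bound degenerates at 0; staying above x/2 makes it
    uniform.\<close>
  proof (rule has_vector_derivative_lebesgue_integral[of "{x/2<..}"])
    show "((\<lambda>x. exp (v * of_real u - of_real (x * exp u))) has_vector_derivative - exp ((v + 1) * of_real u - of_real (x * exp u))) (at x)"
      for x u :: real
    proof -
      have "((\<lambda>x. exp (v * of_real u - of_real (x * exp u))) has_vector_derivative - of_real (exp u) * exp (v * of_real u - of_real (x * exp u))) (at x)"
        by (rule has_vector_derivative_exp_comp) (auto intro!: derivative_eq_intros simp: has_vector_derivative_of_real)
      then show ?thesis by (simp add: exp_of_real[symmetric] exp_add[symmetric] algebra_simps)
    qed
    show "integrable posm (\<lambda>u. exp ((\<bar>Re (v + 1)\<bar> + 1)\<^sup>2 / (x / 2)) * exp (- (x / 2) / 2) * exp (- u))"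
      using exp_minus_posm by simp
    show "norm (- exp ((v + 1) * of_real u - of_real (y * exp u))) \<le> exp ((\<bar>Re (v + 1)\<bar> + 1)\<^sup>2 / (x / 2)) * exp (- (x / 2) / 2) * exp (- u)"
      if "y \<in> {x/2<..}" "u \<in> space posm" for y u
    proof -
      have "norm (- exp ((v + 1) * of_real u - of_real (y * exp u))) \<le> exp ((\<bar>Re (v + 1)\<bar> + 1)\<^sup>2 / (x / 2)) * exp (- y / 2) * exp (- u)"
        using uGamma_kernel_bound[of "x/2" y "v + 1" "\<bar>Re (v + 1)\<bar>" u] assms that by simp
      also have "\<dots> \<le> exp ((\<bar>Re (v + 1)\<bar> + 1)\<^sup>2 / (x / 2)) * exp (- (x / 2) / 2) * exp (- u)"
        using that by (intro mult_right_mono mult_left_mono) auto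
      finally show ?thesis .
    qed
  qed (use assms uGamma_integrable in auto)
  then show ?thesis by (simp add: uGamma_def)
qed

text \<open>Integration by parts. The term exp (- x) is the boundary value at u = 0, that is at the
  splitting point t = 1, and is the source of all Gaussian sums below.\<close>

lemma uGamma_recurrence:
  assumes "x > 0"
  shows "of_real x * uGamma (v + 1) x = exp (- of_real x) + v * uGamma v x"
proof -
  let ?k = "\<lambda>v u. exp (v * of_real u - of_real (x * exp u)) :: complex"
  have "(\<integral>u. v * ?k v u - of_real x * ?k (v + 1) u \<partial>posm) = 0 - ?k v 0"
  proof (rule integral_posm_FTC)
    show "(?k v has_vector_derivative v * ?k v u - of_real x * ?k (v + 1) u) (at u)" for u
    proof -
      have "((\<lambda>u. of_real u) has_vector_derivative (1::complex)) (at u)"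
        "((\<lambda>u. of_real (x * exp u)) has_vector_derivative (of_real (x * exp u) :: complex)) (at u)"
        using has_vector_derivative_of_real[of "\<lambda>u. u" 1] has_vector_derivative_of_real[of "\<lambda>u. x * exp u" "x * exp u"]
        by (auto intro!: derivative_eq_intros)
      then have "((\<lambda>u. v * of_real u - of_real (x * exp u)) has_vector_derivative v * 1 - of_real (x * exp u)) (at u)"
        by (intro has_vector_derivative_diff has_vector_derivative_mult_right)
      from has_vector_derivative_exp_comp[OF this] show ?thesis
        by (simp add: algebra_simps exp_add exp_diff exp_of_real diff_divide_distrib)
    qed
    show "continuous_on UNIV (\<lambda>u. v * ?k v u - of_real x * ?k (v + 1) u)"
      by (intro continuous_intros)
    show "integrable posm (\<lambda>u. v * ?k v u - of_real x * ?k (v + 1) u)"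
      using uGamma_integrable[OF assms] by auto
    have "((\<lambda>u::real. exp (- u)) \<longlongrightarrow> 0) at_top" by real_asymp
    from tendsto_mult_right_zero[OF this]
    have l: "((\<lambda>u. exp ((\<bar>Re v\<bar> + 1)\<^sup>2 / x) * exp (- x / 2) * exp (- u)) \<longlongrightarrow> 0) at_top" .
    show "(?k v \<longlongrightarrow> 0) at_top"
    proof (rule Lim_null_comparison[OF _ l])
      show "\<forall>\<^sub>F u in at_top. norm (?k v u) \<le> exp ((\<bar>Re v\<bar> + 1)\<^sup>2 / x) * exp (- x / 2) * exp (- u)"
        using eventually_ge_at_top[of 0] by eventually_elim (use uGamma_kernel_bound assms in auto)
    qed
  qed
  then have "v * uGamma v x - of_real x * uGamma (v + 1) x = - exp (- of_real x)"
    using uGamma_integrable[OF assms] by (simp add: uGamma_def exp_minus)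
  then show ?thesis by (simp add: algebra_simps)
qed

section \<open>Poisson summation\<close>

text \<open>Only the even part of D enters: it is a continuous function of cos (2 pi x), hence uniformly
  approximable by polynomials in cos (2 pi x), to which D is orthogonal by assumption.\<close>

lemma even_trig_completeness:
  fixes D :: "real \<Rightarrow> complex"
  assumes cont: "continuous_on UNIV D" and per: "\<And>x. D (x + 1) = D x"
    and coef: "\<And>k::int. integral {0..1} (\<lambda>x. D x * ee (of_int k * x)) = 0"
  shows "Re (D 0) = 0"
proof -
  have [continuous_intros]: "continuous_on S (\<lambda>x. D (g x))" if "continuous_on S g" for g :: "real \<Rightarrow> real" and S
    using continuous_on_compose2[OF cont that] by simp
  have cos_ee: "of_real (cos (2 * pi * x)) = (ee x + ee (- x)) / 2" for x
    by (simp add: ee_def complex_eq_iff)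
  \<comment> \<open>Multiplying by the cosine averages the frequencies k + 1 and k - 1, so
    orthogonality to all characters passes to each further power of the cosine.\<close>
  have A: "integral {0..1} (\<lambda>x. D x * of_real (cos (2 * pi * x)) ^ m * ee (of_int k * x)) = 0" for m and k :: int
  proof (induction m arbitrary: k)
    case 0
    then show ?case using coef by simp
  next
    case (Suc m)
    let ?h = "\<lambda>k x. D x * of_real (cos (2 * pi * x)) ^ m * ee (of_int k * x)"
    have "(\<lambda>x. D x * of_real (cos (2 * pi * x)) ^ Suc m * ee (of_int k * x)) = (\<lambda>x. (?h (k + 1) x + ?h (k - 1) x) / 2)"
      unfolding cos_ee power_Suc
      by (intro ext) (simp add: ring_distribs ee_add ee_diff ee_minus field_simps)
    moreover
    have "?h k integrable_on {0..1}" for k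
      by (intro integrable_continuous_real continuous_intros)
    then have "integral {0..1} (\<lambda>x. ?h (k + 1) x + ?h (k - 1) x) = integral {0..1} (?h (k + 1)) + integral {0..1} (?h (k - 1))"
      by (intro Henstock_Kurzweil_Integration.integral_add)
    ultimately have "integral {0..1} (\<lambda>x. D x * of_real (cos (2 * pi * x)) ^ Suc m * ee (of_int k * x)) =
        (integral {0..1} (?h (k + 1)) + integral {0..1} (?h (k - 1))) / 2"
      by (simp only: Henstock_Kurzweil_Integration.integral_divide)
    then show ?case by (simp only: Suc.IH) simp
  qed
  \<comment> \<open>Twice the real part of the even part of D; its value at 0 is 2 Re (D 0).\<close>
  define r where "r = (\<lambda>x. Re (D x + D (- x)))"
  have contr [continuous_intros]: "continuous_on S r" for S
    unfolding r_def by (intro continuous_intros)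
  have Dm: "D (x - 1) = D x" for x using per[of "x - 1"] by simp
  have r1: "r (1 - x) = r x" for x
  proof -
    have "D (1 - x) = D (- x)" using per[of "- x"] by simp
    moreover have "D (- (1 - x)) = D x" using Dm[of x] by simp
    ultimately show ?thesis by (simp add: r_def)
  qed
  \<comment> \<open>\<open>arccos\<close> inverts the cosine only for x in [0, 1/2]; the other half
    of the period is covered by the symmetry \<open>r1\<close>.\<close>
  define \<phi> where "\<phi> = (\<lambda>y. r (arccos y / (2 * pi)))"
  have cont\<phi>: "continuous_on {-1..1} \<phi>"
    unfolding \<phi>_def
    by (rule continuous_on_compose2[OF contr[of UNIV]]) (auto intro!: continuous_intros continuous_on_arccos')
  have r\<phi>: "r x = \<phi> (cos (2 * pi * x))" if "x \<in> {0..1}" for x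
  proof (cases "x \<le> 1/2")
    case True
    then have "arccos (cos (2 * pi * x)) = 2 * pi * x" using that by (intro arccos_cos) auto
    then show ?thesis by (simp add: \<phi>_def)
  next
    case False
    then have "arccos (cos (2 * pi * (1 - x))) = 2 * pi * (1 - x)" using that by (intro arccos_cos) (auto simp: field_simps)
    moreover have "cos (2 * pi * (1 - x)) = cos (2 * pi * x)"
      by (simp add: right_diff_distrib cos_diff)
    ultimately have "\<phi> (cos (2 * pi * x)) = r (1 - x)" by (simp add: \<phi>_def)
    then show ?thesis by (simp add: r1)
  qed
  have "bounded (D ` {0..1})"
    by (intro compact_imp_bounded compact_continuous_image continuous_intros) auto
  then obtain B where B: "B > 0" "\<And>x. x \<in> {0..1} \<Longrightarrow> norm (D x) \<le> B"
    unfolding bounded_pos by auto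
  have I0: "integral {0..1} (\<lambda>x. D x * of_real (r x)) = 0" (is "?I = 0")
  proof -
    have "norm ?I \<le> e * B" if "e > 0" for e
    proof -
      obtain g where g: "real_polynomial_function g" "\<And>y. y \<in> {-1..1} \<Longrightarrow> \<bar>\<phi> y - g y\<bar> < e"
        using Stone_Weierstrass_real_polynomial_function[OF _ cont\<phi> \<open>e > 0\<close>] by auto
      then obtain a n where an: "g = (\<lambda>y. \<Sum>i\<le>n. a i * y ^ i)"
        unfolding real_polynomial_function_iff_sum by blast
      have "integral {0..1} (\<lambda>x. D x * of_real (g (cos (2 * pi * x)))) =
          integral {0..1} (\<lambda>x. \<Sum>i\<le>n. of_real (a i) * (D x * of_real (cos (2 * pi * x)) ^ i))"
        by (simp add: an sum_distrib_left mult_ac)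
      also have "\<dots> = (\<Sum>i\<le>n. of_real (a i) * integral {0..1} (\<lambda>x. D x * of_real (cos (2 * pi * x)) ^ i))"
        by (subst Henstock_Kurzweil_Integration.integral_sum)
          (auto intro!: integrable_continuous_real continuous_intros)
      also have "\<dots> = 0" using A[of _ 0] by simp
      finally have g0: "integral {0..1} (\<lambda>x. D x * of_real (g (cos (2 * pi * x)))) = 0" .
      have contg: "continuous_on {0..1} (\<lambda>x. D x * of_real (g (cos (2 * pi * x))))"
        unfolding an by (intro continuous_intros)
      have contr': "continuous_on {0..1} (\<lambda>x. D x * of_real (r x))" by (intro continuous_intros)
      have "?I = integral {0..1} (\<lambda>x. D x * of_real (r x) - D x * of_real (g (cos (2 * pi * x))))"
        using g0 contg contr'
        by (simp add: Henstock_Kurzweil_Integration.integral_diff integrable_continuous_real)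
      also have "norm \<dots> \<le> e * B * (1 - 0)"
      proof (rule integral_bound)
        fix x :: real assume x: "x \<in> {0..1}"
        have "norm (D x * of_real (r x) - D x * of_real (g (cos (2 * pi * x)))) = norm (D x) * \<bar>\<phi> (cos (2 * pi * x)) - g (cos (2 * pi * x))\<bar>"
        proof -
          have "D x * of_real (r x) - D x * of_real (g (cos (2 * pi * x))) = D x * of_real (\<phi> (cos (2 * pi * x)) - g (cos (2 * pi * x)))"
            unfolding r\<phi>[OF x] by (simp only: right_diff_distrib of_real_diff)
          then show ?thesis by (simp only: norm_mult norm_of_real)
        qed
        also have "\<dots> \<le> B * e"
          using B(2)[OF x] g(2)[of "cos (2 * pi * x)"] B(1) by (intro mult_mono) auto
        finally show "norm (D x * of_real (r x) - D x * of_real (g (cos (2 * pi * x)))) \<le> e * B"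
          by (simp add: mult.commute)
      qed (auto intro!: continuous_on_diff contg contr')
      finally show ?thesis by simp
    qed
    have "norm ?I \<le> e" if "e > 0" for e
      using that[THEN divide_pos_pos, OF B(1)] B(1) \<open>\<And>e. e > 0 \<Longrightarrow> norm ?I \<le> e * B\<close>[of "e / B"] by simp
    then have "norm ?I \<le> 0" by (rule field_le_epsilon) auto
    then show ?thesis by simp
  qed
  let ?d = "\<lambda>x. Re (D x)"
  have I1: "integral {0..1} (\<lambda>x. ?d x * r x) = 0"
  proof -
    have "integral {0..1} (Re \<circ> (\<lambda>x. D x * of_real (r x))) = Re (integral {0..1} (\<lambda>x. D x * of_real (r x)))"
      by (rule integral_linear[OF _ bounded_linear_Re]) (intro integrable_continuous_real continuous_intros)
    then show ?thesis using I0 by (simp add: o_def)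
  qed
  \<comment> \<open>Reflecting x to 1 - x preserves the interval and \<open>r\<close>, so D (- x) is
    orthogonal to \<open>r\<close> as well. Adding both relations gives the integral of the square
    of \<open>r\<close>.\<close>
  have "integral {0..1} (\<lambda>x. ?d (- x) * r x) = integral {0..1} (\<lambda>x. ?d (1 - x) * r (1 - x))"
  proof (intro Henstock_Kurzweil_Integration.integral_cong)
    fix x :: real
    show "?d (- x) * r x = ?d (1 - x) * r (1 - x)"
      unfolding r1 using per[of "- x"] by simp
  qed
  also have "\<dots> = integral {-1..-0} (\<lambda>x. ?d (1 - (- x)) * r (1 - (- x)))"
    by (rule Henstock_Kurzweil_Integration.integral_reflect_real[symmetric])
  also have "\<dots> = integral {0..1} (\<lambda>x. ?d x * r x)"
    using integral_shift_real_ivl[of 0 1 1 "\<lambda>x. ?d x * r x"] by (simp add: add.commute)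
  finally have I2: "integral {0..1} (\<lambda>x. ?d (- x) * r x) = 0" using I1 by simp
  have "integral {0..1} (\<lambda>x. r x * r x) = integral {0..1} (\<lambda>x. ?d x * r x + ?d (- x) * r x)"
    by (simp add: r_def algebra_simps)
  also have "\<dots> = 0"
    using I1 I2 by (subst Henstock_Kurzweil_Integration.integral_add)
      (auto intro!: integrable_continuous_real continuous_intros)
  finally have "integral {0..1} (\<lambda>x. r x * r x) = 0" .
  then have "\<forall>x\<in>{0..1}. r x * r x = 0"
    by (subst (asm) integral_eq_0_iff) (auto intro!: continuous_intros)
  then have "r 0 = 0" by auto
  then show ?thesis by (simp add: r_def)
qed

text \<open>Applying the previous result to D and to i D yields both parts of D 0; Poisson summation
  evaluates only at this point.\<close>

lemma fourier_coefficients_zero: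
  fixes D :: "real \<Rightarrow> complex"
  assumes cont: "continuous_on UNIV D" and per: "\<And>x. D (x + 1) = D x"
    and coef: "\<And>k::int. integral {0..1} (\<lambda>x. D x * ee (of_int k * x)) = 0"
  shows "D 0 = 0"
proof -
  have "Re (D 0) = 0" by (rule even_trig_completeness[OF assms])
  moreover have "Re (\<i> * D 0) = 0"
  proof (rule even_trig_completeness)
    show "integral {0..1} (\<lambda>x. \<i> * D x * ee (of_int k * x)) = 0" for k :: int
      using coef[of k] by (simp add: mult.assoc)
  qed (use per in \<open>auto intro!: continuous_intros cont\<close>)
  ultimately show ?thesis by (simp add: complex_eq_iff)
qed

text \<open>Both sides are the limit of the same integrals of symmetric partial sums. Dominating the
  partial sums instead of the series of norms fits the case of disjoint supports in the Poisson
  argument.\<close>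

lemma isum_integral_swap:
  fixes f :: "int \<Rightarrow> 'b \<Rightarrow> complex"
  assumes int: "\<And>n. integrable M (f n)"
    and summ: "\<And>t. t \<in> space M \<Longrightarrow> isummable (\<lambda>n. f n t)"
    and bound: "\<And>N t. t \<in> space M \<Longrightarrow> norm (\<Sum>n\<in>{- int N..int N}. f n t) \<le> g t"
    and g: "integrable M g" and sumint: "isummable (\<lambda>n. \<integral>t. f n t \<partial>M)"
  shows "(\<integral>t. isum (\<lambda>n. f n t) \<partial>M) = isum (\<lambda>n. \<integral>t. f n t \<partial>M)"
    and "integrable M (\<lambda>t. isum (\<lambda>n. f n t))"
proof -
  have meas: "(\<lambda>t. isum (\<lambda>n. f n t)) \<in> borel_measurable M"
    by (rule borel_measurable_LIMSEQ_metric[where f="\<lambda>N t. \<Sum>n\<in>{- int N..int N}. f n t"])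
      (use int isum_partial_sums[OF summ] in auto)
  have lim: "(\<lambda>N. \<integral>t. (\<Sum>n\<in>{- int N..int N}. f n t) \<partial>M) \<longlonglongrightarrow> (\<integral>t. isum (\<lambda>n. f n t) \<partial>M)"
    by (rule integral_dominated_convergence[where w=g])
      (use meas int g bound isum_partial_sums[OF summ] in auto)
  show "integrable M (\<lambda>t. isum (\<lambda>n. f n t))"
    by (rule integrable_dominated_convergence[where w=g and s="\<lambda>N t. \<Sum>n\<in>{- int N..int N}. f n t"])
      (use meas int g bound isum_partial_sums[OF summ] in auto)
  have "(\<lambda>N. \<integral>t. (\<Sum>n\<in>{- int N..int N}. f n t) \<partial>M) \<longlonglongrightarrow> isum (\<lambda>n. \<integral>t. f n t \<partial>M)"
    using isum_partial_sums[OF sumint] int by simp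
  with lim show "(\<integral>t. isum (\<lambda>n. f n t) \<partial>M) = isum (\<lambda>n. \<integral>t. f n t \<partial>M)"
    by (rule LIMSEQ_unique)
qed

lemma sum_le_isum:
  fixes g :: "int \<Rightarrow> real"
  assumes "isummable g" "\<And>n. g n \<ge> 0" "finite A"
  shows "sum g A \<le> isum g"
proof -
  have "sum g A = isum (\<lambda>n. indicat_real A n *\<^sub>R g n)" by (rule isum_indicator[OF assms(3), symmetric])
  also have "\<dots> \<le> isum g"
    using assms by (intro integral_mono Bochner_Integration.integrable_bound[OF assms(1)]) (auto simp: indicator_def)
  finally show ?thesis .
qed

lemma norm_sum_le_isum_exp:
  fixes f :: "int \<Rightarrow> 'a::{banach,second_countable_topology}"
  assumes "\<And>n. norm (f n) \<le> C * int_decay n" "finite A"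
  shows "norm (\<Sum>n\<in>A. f n) \<le> C * isum int_decay"
proof -
  have "norm (\<Sum>n\<in>A. f n) \<le> (\<Sum>n\<in>A. norm (f n))" by (rule norm_sum)
  also have "\<dots> \<le> isum (\<lambda>n. norm (f n))"
    by (rule sum_le_isum) (use assms isummable_bound[of f C] in auto)
  also have "\<dots> \<le> isum (\<lambda>n. C * int_decay n)"
    by (rule integral_mono) (use assms isummable_bound[of f C] isummable_exp in auto)
  finally show ?thesis by simp
qed

lemma continuous_on_isum:
  fixes f :: "int \<Rightarrow> real \<Rightarrow> complex"
  assumes cont: "\<And>n. continuous_on UNIV (f n)"
    and bound: "\<And>R. \<exists>C. \<forall>n x. \<bar>x\<bar> \<le> R \<longrightarrow> norm (f n x) \<le> C * int_decay n"
  shows "continuous_on UNIV (\<lambda>x. isum (\<lambda>n. f n x))"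
  unfolding continuous_on_sequentially comp_def
proof (intro ballI allI impI, elim conjE)
  fix X :: "nat \<Rightarrow> real" and x assume X: "X \<longlonglongrightarrow> x"
  then obtain R where R: "\<And>m. \<bar>X m\<bar> \<le> R"
    using convergent_imp_Bseq[of X] by (auto simp: convergent_def Bseq_def)
  obtain C where C: "\<And>n x. \<bar>x\<bar> \<le> R \<Longrightarrow> norm (f n x) \<le> C * int_decay n" using bound[of R] by blast
  show "(\<lambda>m. isum (\<lambda>n. f n (X m))) \<longlonglongrightarrow> isum (\<lambda>n. f n x)"
  proof (rule integral_dominated_convergence[where w="\<lambda>n. C * int_decay n"])
    show "AE n in count_space UNIV. (\<lambda>m. f n (X m)) \<longlonglongrightarrow> f n x"
      using cont X by (auto simp: continuous_on_sequentially comp_def)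
  qed (use C R isummable_exp in auto)
qed

lemma exp_neg_abs_shift: "exp (- \<bar>of_int n + x\<bar>) \<le> exp \<bar>x\<bar> * int_decay n"
  by (simp flip: exp_add)

lemma integrable_exp_neg_abs: "integrable lborel (\<lambda>x::real. exp (- \<bar>x\<bar>))"
proof -
  have "set_integrable lborel {0<..} (\<lambda>x::real. exp (- x))"
    using exp_minus_posm(1) by (simp add: set_integrable_def integrable_restrict_space)
  then have p: "integrable lborel (\<lambda>x::real. indicator {0<..} x *\<^sub>R exp (- x))"
    by (simp add: set_integrable_def)
  then have "integrable lborel (\<lambda>x::real. indicator {0<..} (- x) *\<^sub>R exp (- (- x)))"
    using lborel_integrable_real_affine[OF p, of "-1" 0] by simp
  then have i: "integrable lborel (\<lambda>x::real. indicator {0<..} x *\<^sub>R exp (- x) + indicator {0<..} (- x) *\<^sub>R exp (- (- x)))"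
    using p by (intro Bochner_Integration.integrable_add)
  have ae: "AE x in lborel. indicator {0<..} x *\<^sub>R exp (- x) + indicator {0<..} (- x) *\<^sub>R exp (- (- x)) = exp (- \<bar>x::real\<bar>)"
    using AE_lborel_singleton[of "0::real"] by eventually_elim (auto simp: indicator_def)
  show ?thesis
    by (subst integrable_cong_AE[OF _ _ ae, symmetric]) (use i in auto)
qed

text \<open>The periodisation \<open>G\<close> of f and the Fourier series \<open>H\<close> built
  from the transform are continuous, 1-periodic and have the same Fourier coefficients, so they
  agree at 0. Exponential decay on both sides makes both series converge absolutely and locally
  uniformly.\<close>

theorem poisson_summation:
  fixes f :: "real \<Rightarrow> complex"
  assumes cont: "continuous_on UNIV f"
    and decay: "\<And>x. norm (f x) \<le> C * exp (- \<bar>x\<bar>)"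
    and decay': "\<And>k. norm (\<integral>x. f x * ee (- (of_int k * x)) \<partial>lborel) \<le> C' * int_decay k"
  shows "isum (\<lambda>n. f (of_int n)) = isum (\<lambda>k. \<integral>x. f x * ee (- (of_int k * x)) \<partial>lborel)"
proof -
  define F where "F = (\<lambda>k::int. \<integral>x. f x * ee (- (of_int k * x)) \<partial>lborel)"
  define G where "G = (\<lambda>x. isum (\<lambda>n. f (of_int n + x)))"
  define H where "H = (\<lambda>x. isum (\<lambda>n. F n * ee (of_int n * x)))"
  have [continuous_intros]: "continuous_on S (\<lambda>x. f (g x))" if "continuous_on S g" for g :: "real \<Rightarrow> real" and S
    using continuous_on_compose2[OF cont that] by simp
  have [measurable]: "f \<in> borel_measurable borel" by (rule borel_measurable_continuous_onI[OF cont])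
  have eem[measurable]: "ee \<in> borel_measurable borel"
    by (rule borel_measurable_continuous_onI) (intro continuous_intros)
  have C0: "C \<ge> 0" using norm_ge_zero[of "f 0"] decay[of 0] by (simp del: norm_ge_zero)
  have C0': "C' \<ge> 0" using norm_ge_zero[of "F 0"] decay'[of 0] unfolding F_def by (simp del: norm_ge_zero)
  have Fb: "norm (F n) \<le> C' * int_decay n" for n using decay' by (simp add: F_def)
  have fb: "norm (f (of_int n + x)) \<le> C * exp \<bar>x\<bar> * int_decay n" for n x
    using order_trans[OF decay mult_left_mono[OF exp_neg_abs_shift C0]] by (simp add: mult.assoc)
  have contG: "continuous_on UNIV G"
    unfolding G_def
  proof (rule continuous_on_isum)
    show "\<exists>K. \<forall>n x. \<bar>x\<bar> \<le> R \<longrightarrow> norm (f (of_int n + x)) \<le> K * int_decay n" for R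
    proof (intro exI allI impI)
      fix n :: int and x :: real assume "\<bar>x\<bar> \<le> R"
      then have "C * exp \<bar>x\<bar> * int_decay n \<le> C * exp R * int_decay n"
        using C0 by (intro mult_right_mono mult_left_mono) auto
      then show "norm (f (of_int n + x)) \<le> C * exp R * int_decay n" using fb[of n x] by simp
    qed
  qed (intro continuous_intros)
  have contH: "continuous_on UNIV H"
    unfolding H_def by (rule continuous_on_isum) (use Fb in \<open>auto intro!: continuous_intros simp: norm_mult\<close>)
  \<comment> \<open>Unfolding: the integral of the periodisation over one period is cut into the
    translates [n, n + 1), which tile the line without overlap.\<close>
  have Gint: "integral {0..1} (\<lambda>x. G x * ee (of_int k * x)) = F (- k)" for k
  proof -
    let ?h = "\<lambda>x. f x * ee (of_int k * x)"
    let ?I = "\<lambda>n::int. indicat_real {of_int n..<of_int n + 1}"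
    let ?U = "{0..<1::real}"
    have hint: "integrable lborel ?h"
      by (rule Bochner_Integration.integrable_bound[where f="\<lambda>x. C * exp (- \<bar>x\<bar>)"])
        (use integrable_exp_neg_abs decay C0 in \<open>auto simp: norm_mult intro!: AE_I2\<close>)
    let ?V = "\<lambda>n x. indicat_real ?U x *\<^sub>R ?h (of_int n + x)"
    \<comment> \<open>Seen as a function of n the indicator selects the single integer floor x, so
      the sum over n has one term and its partial sums are bounded by
      \<open>norm (?h x)\<close>.\<close>
    have ind: "?I n x = indicat_real {\<lfloor>x\<rfloor>} n" for n x
      using floor_eq_iff[of x n] by (auto simp: indicator_def)
    have per: "?h (of_int n + x) = f (of_int n + x) * ee (of_int k * x)" for n x
      using ee_of_int[of "k * n"] by (simp add: distrib_left ee_add del: ee_of_int)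
    have "integral {0..1} (\<lambda>x. G x * ee (of_int k * x)) = integral ?U (\<lambda>x. G x * ee (of_int k * x))"
      by (rule integral_spike_set) (rule negligible_subset[of "{1}"], auto)+
    also have "\<dots> = (LINT x:?U|lborel. G x * ee (of_int k * x))"
    proof (rule set_borel_integral_eq_integral(2)[symmetric])
      have "set_integrable lborel {0..1} (\<lambda>x. G x * ee (of_int k * x))"
        by (intro borel_integrable_atLeastAtMost' continuous_intros continuous_on_subset[OF contG]) auto
      then show "set_integrable lborel ?U (\<lambda>x. G x * ee (of_int k * x))"
        by (rule set_integrable_subset) auto
    qed
    also have "\<dots> = (\<integral>x. isum (\<lambda>n. ?V n x) \<partial>lborel)"
      unfolding set_lebesgue_integral_def G_def per
      by (intro Bochner_Integration.integral_cong) (auto simp: indicator_def)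
    also have "\<dots> = isum (\<lambda>n. \<integral>x. ?V n x \<partial>lborel)"
    proof (rule isum_integral_swap(1))
      have b: "norm (?V n x) \<le> (indicat_real ?U x * (C * exp 1)) * int_decay n" for n x
      proof (cases "x \<in> ?U")
        case True
        then have "C * exp \<bar>x\<bar> * int_decay n \<le> C * exp 1 * int_decay n"
          using C0 by (intro mult_right_mono mult_left_mono) auto
        with True fb[of n x] show ?thesis by (simp add: norm_mult)
      qed auto
      show "isummable (\<lambda>n. ?V n x)" for x
        by (rule isummable_bound[OF b])
      show "norm (\<Sum>n\<in>{- int N..int N}. ?V n x) \<le> (indicat_real ?U x * (C * exp 1)) * isum int_decay" for N x
        by (rule norm_sum_le_isum_exp[OF b]) simp
      show "integrable lborel (\<lambda>x. indicat_real ?U x * (C * exp 1) * isum int_decay)"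
        by simp
      have i: "integrable lborel (\<lambda>x. ?h (of_int n + x))" for n
        using lborel_integrable_real_affine[OF hint, of 1 "of_int n"] by simp
      then show ii: "integrable lborel (\<lambda>x. ?V n x)" for n
        by (intro integrable_mult_indicator) auto
      show "isummable (\<lambda>n. \<integral>x. ?V n x \<partial>lborel)"
      proof (rule isummable_bound)
        fix n
        have "norm (\<integral>x. ?V n x \<partial>lborel) \<le> (\<integral>x. (indicat_real ?U x * (C * exp 1)) * int_decay n \<partial>lborel)"
          by (rule norm_integral_le[OF ii _ b]) simp
        then show "norm (\<integral>x. ?V n x \<partial>lborel) \<le> C * exp 1 * int_decay n"
          by simp
      qed
    qed
    also have "\<dots> = isum (\<lambda>n. \<integral>x. ?I n x *\<^sub>R ?h x \<partial>lborel)"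
    proof (rule Bochner_Integration.integral_cong[OF refl])
      fix n :: int
      have "(\<integral>x. ?I n x *\<^sub>R ?h x \<partial>lborel) =
          (\<integral>x. indicat_real {of_int n..<of_int n + 1} (of_int n + x) *\<^sub>R ?h (of_int n + x) \<partial>lborel)"
        by (subst lborel_integral_real_affine[of 1 _ "of_int n"]) auto
      also have "\<dots> = (\<integral>x. ?V n x \<partial>lborel)"
        by (intro Bochner_Integration.integral_cong) (auto simp: indicator_def)
      finally show "(\<integral>x. ?V n x \<partial>lborel) = (\<integral>x. ?I n x *\<^sub>R ?h x \<partial>lborel)" ..
    qed
    also have "\<dots> = (\<integral>x. isum (\<lambda>n. ?I n x *\<^sub>R ?h x) \<partial>lborel)"
    proof (rule isum_integral_swap(1)[symmetric])
      have i1: "?I n x \<le> exp 1 * exp \<bar>x\<bar> * int_decay n" for n x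
        by (auto simp: indicator_def simp flip: exp_add)
      show "isummable (\<lambda>n. ?I n x *\<^sub>R ?h x)" for x
      proof (rule isummable_bound)
        fix n show "norm (?I n x *\<^sub>R ?h x) \<le> (exp 1 * exp \<bar>x\<bar> * norm (f x)) * int_decay n"
          using mult_right_mono[OF i1[of n x], of "norm (f x)"] by (simp add: norm_mult mult_ac)
      qed
      show "norm (\<Sum>n\<in>{- int N..int N}. ?I n x *\<^sub>R ?h x) \<le> norm (?h x)" for N x
      proof -
        have "(\<Sum>n\<in>{- int N..int N}. indicat_real {\<lfloor>x\<rfloor>} n *\<^sub>R ?h x) = (\<Sum>n\<in>{- int N..int N}. if n = \<lfloor>x\<rfloor> then ?h x else 0)"
          by (intro sum.cong) (auto simp: indicator_def)
        then show ?thesis unfolding ind by (simp add: sum.delta)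
      qed
      show "integrable lborel (\<lambda>x. norm (?h x))" using hint by (rule integrable_norm)
      show ii: "integrable lborel (\<lambda>x. ?I n x *\<^sub>R ?h x)" for n :: int
        using hint by (intro integrable_mult_indicator) auto
      show "isummable (\<lambda>n. \<integral>x. ?I n x *\<^sub>R ?h x \<partial>lborel)"
      proof (rule isummable_bound)
        fix n :: int
        have b: "norm (?I n x *\<^sub>R ?h x) \<le> ?I n x * (C * exp 1 * int_decay n)" for x
        proof (cases "x \<in> {of_int n..<of_int n + 1}")
          case True
          then have "C * exp (- \<bar>x\<bar>) \<le> C * (exp 1 * int_decay n)"
            using C0 by (intro mult_left_mono) (auto simp flip: exp_add)
          with decay[of x] True show ?thesis by (simp add: norm_mult mult.assoc)
        qed auto
        have "norm (\<integral>x. ?I n x *\<^sub>R ?h x \<partial>lborel) \<le> (\<integral>x. indicat_real {of_int n..<of_int n + 1} (x::real) * (C * exp 1 * int_decay n) \<partial>lborel)"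
          by (rule norm_integral_le[OF ii _ b]) simp
        then show "norm (\<integral>x. ?I n x *\<^sub>R ?h x \<partial>lborel) \<le> C * exp 1 * int_decay n"
          by simp
      qed
    qed
    also have "\<dots> = (\<integral>x. ?h x \<partial>lborel)"
    proof (rule Bochner_Integration.integral_cong[OF refl])
      fix x
      have "isum (\<lambda>n. ?I n x *\<^sub>R ?h x) = isum (\<lambda>n. indicat_real {\<lfloor>x\<rfloor>} n *\<^sub>R ?h x)"
        unfolding ind ..
      also have "\<dots> = ?h x" by (subst isum_indicator) auto
      finally show "isum (\<lambda>n. ?I n x *\<^sub>R ?h x) = ?h x" .
    qed
    finally show ?thesis by (simp add: F_def)
  qed
  have Hint: "integral {0..1} (\<lambda>x. H x * ee (of_int k * x)) = F (- k)" for k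
  proof -
    have ee_int: "integral {0..1} (\<lambda>x. ee (of_int m * x)) = (if m = 0 then 1 else 0)" for m
    proof (cases "m = 0")
      case False
      have "((\<lambda>x. ee (of_int m * x)) has_integral ee (of_int m * 1) / (2 * pi * \<i> * m) - ee (of_int m * 0) / (2 * pi * \<i> * m)) {0..1}"
        using False
        by (intro fundamental_theorem_of_calculus)
          (auto intro!: derivative_eq_intros has_vector_derivative_divide[THEN has_vector_derivative_eq_rhs])
      then show ?thesis using False by (simp add: has_integral_iff)
    qed auto
    let ?M = "restrict_space lborel {0..1::real}"
    have conv: "integral {0..1} g = (\<integral>x. g x \<partial>?M)" if "continuous_on UNIV g" for g :: "real \<Rightarrow> complex"
    proof -
      have "set_integrable lborel {0..1} g"
        by (intro borel_integrable_atLeastAtMost' continuous_on_subset[OF that]) auto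
      from set_borel_integral_eq_integral(2)[OF this] show ?thesis
        by (simp add: integral_restrict_space set_lebesgue_integral_def)
    qed
    have integ: "integrable ?M g" if "continuous_on UNIV g" for g :: "real \<Rightarrow> complex"
      using borel_integrable_atLeastAtMost'[of 0 1 g] continuous_on_subset[OF that, of "{0..1}"]
      by (simp add: integrable_restrict_space set_integrable_def)
    have "integral {0..1} (\<lambda>x. H x * ee (of_int k * x)) = (\<integral>x. H x * ee (of_int k * x) \<partial>?M)"
      by (rule conv) (intro continuous_intros contH)
    also have "\<dots> = (\<integral>x. isum (\<lambda>n. F n * ee (of_int n * x) * ee (of_int k * x)) \<partial>?M)"
      by (simp add: H_def)
    also have "\<dots> = isum (\<lambda>n. \<integral>x. F n * ee (of_int n * x) * ee (of_int k * x) \<partial>?M)"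
    proof (rule isum_integral_swap(1))
      have b: "norm (F n * ee (of_int n * x) * ee (of_int k * x)) \<le> C' * int_decay n" for n x
        using Fb by (simp add: norm_mult)
      show "isummable (\<lambda>n. F n * ee (of_int n * x) * ee (of_int k * x))" for x
        by (rule isummable_bound[OF b])
      show "norm (\<Sum>n\<in>{- int N..int N}. F n * ee (of_int n * x) * ee (of_int k * x)) \<le> C' * isum int_decay" for N x
        by (rule norm_sum_le_isum_exp[OF b]) simp
      show "integrable ?M (\<lambda>x. C' * isum int_decay)"
        by (simp add: integrable_restrict_space)
      show ii: "integrable ?M (\<lambda>x. F n * ee (of_int n * x) * ee (of_int k * x))" for n
        by (intro integ continuous_intros)
      show "isummable (\<lambda>n. \<integral>x. F n * ee (of_int n * x) * ee (of_int k * x) \<partial>?M)"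
      proof (rule isummable_bound)
        fix n
        have "norm (\<integral>x. F n * ee (of_int n * x) * ee (of_int k * x) \<partial>?M) \<le> (\<integral>x. C' * int_decay n \<partial>?M)"
          by (rule norm_integral_le[OF ii _ b]) (simp add: integrable_restrict_space)
        also have "\<dots> = C' * int_decay n"
          by (simp add: measure_restrict_space)
        finally show "norm (\<integral>x. F n * ee (of_int n * x) * ee (of_int k * x) \<partial>?M) \<le> C' * int_decay n" .
      qed
    qed
    also have "\<dots> = isum (\<lambda>n. indicat_real {- k} n *\<^sub>R F n)"
    proof (rule Bochner_Integration.integral_cong[OF refl])
      fix n
      have "(\<integral>x. F n * ee (of_int n * x) * ee (of_int k * x) \<partial>?M) = F n * integral {0..1} (\<lambda>x. ee (of_int (n + k) * x))"
        by (subst conv) (auto intro!: continuous_intros simp: ring_distribs ee_add mult.assoc)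
      then show "(\<integral>x. F n * ee (of_int n * x) * ee (of_int k * x) \<partial>?M) = indicat_real {- k} n *\<^sub>R F n"
        unfolding ee_int by (auto simp: indicator_def)
    qed
    also have "\<dots> = F (- k)" by (subst isum_indicator) auto
    finally show ?thesis .
  qed
  have "G 0 - H 0 = 0"
  proof (rule fourier_coefficients_zero)
    show "continuous_on UNIV (\<lambda>x. G x - H x)" by (intro continuous_intros contG contH)
    have "G (x + 1) = G x" for x
      using isum_reindex_shift[of "\<lambda>n. f (of_int n + x)" 1] by (simp add: G_def add_ac)
    moreover have "H (x + 1) = H x" for x
      by (simp add: H_def distrib_left ee_add)
    ultimately show "G (x + 1) - H (x + 1) = G x - H x" for x by simp
    show "integral {0..1} (\<lambda>x. (G x - H x) * ee (of_int k * x)) = 0" for k :: int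
    proof -
      have "integral {0..1} (\<lambda>x. (G x - H x) * ee (of_int k * x)) =
          integral {0..1} (\<lambda>x. G x * ee (of_int k * x)) - integral {0..1} (\<lambda>x. H x * ee (of_int k * x))"
        unfolding left_diff_distrib
        by (rule Henstock_Kurzweil_Integration.integral_diff)
          (intro integrable_continuous_real continuous_intros continuous_on_subset[OF contG] continuous_on_subset[OF contH]; simp)+
      then show ?thesis using Gint Hint by simp
    qed
  qed
  then show ?thesis by (simp add: G_def H_def F_def)
qed

section \<open>Theta inversion\<close>

text \<open>This is the characteristic function of the standard normal law under y = b (x + c): b^2
  = 2 pi t matches the two Gaussians, and \<open>\<xi>\<close> = 2 pi (a - k) / b is the frequency
  in the new variable.\<close>

lemma gaussian_fourier_transform:
  fixes t a c :: real
  assumes t: "t > 0"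
  shows "(\<integral>x. ee ((x + c) * a) * exp (- (pi * t * (x + c)\<^sup>2)) * ee (- (of_int k * x)) \<partial>lborel)
       = ee (of_int k * c) * (1 / sqrt t) * exp (- (pi * (a - of_int k)\<^sup>2 / t))"
proof -
  define b where "b = sqrt (2 * pi * t)"
  have b: "b > 0" "b\<^sup>2 = 2 * pi * t" using t by (simp_all add: b_def)
  define \<xi> where "\<xi> = 2 * pi * (a - of_int k) / b"
  have "complex_of_real (exp (- \<xi>\<^sup>2 / 2)) = char std_normal_distribution \<xi>"
    by (simp add: char_std_normal_distribution)
  also have "\<dots> = (\<integral>x. std_normal_density x *\<^sub>R iexp (\<xi> * x) \<partial>lborel)"
    unfolding char_def by (subst integral_density) auto
  also have "\<dots> = \<bar>b\<bar> *\<^sub>R (\<integral>x. std_normal_density (b * c + b * x) *\<^sub>R iexp (\<xi> * (b * c + b * x)) \<partial>lborel)"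
    by (rule lborel_integral_real_affine) (use b in auto)
  also have "(\<lambda>x. std_normal_density (b * c + b * x) *\<^sub>R iexp (\<xi> * (b * c + b * x))) =
      (\<lambda>x. (ee (- (of_int k * c)) / sqrt (2 * pi)) * (ee ((x + c) * a) * exp (- (pi * t * (x + c)\<^sup>2)) * ee (- (of_int k * x))))"
  proof
    fix x
    have "(b * c + b * x)\<^sup>2 = b\<^sup>2 * (x + c)\<^sup>2" by (simp add: power2_eq_square algebra_simps)
    then have 1: "std_normal_density (b * c + b * x) = exp (- (pi * t * (x + c)\<^sup>2)) / sqrt (2 * pi)"
      by (simp add: std_normal_density_def b)
    have "\<xi> * (b * c + b * x) = 2 * pi * ((x + c) * a + - (of_int k * x) + - (of_int k * c))"
      using b by (simp add: \<xi>_def field_simps)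
    then have "iexp (\<xi> * (b * c + b * x)) = ee ((x + c) * a + - (of_int k * x) + - (of_int k * c))"
      by (simp only: exp_eq_ee)
    also have "\<dots> = ee ((x + c) * a) * ee (- (of_int k * x)) * ee (- (of_int k * c))"
      by (simp only: ee_add)
    finally show "std_normal_density (b * c + b * x) *\<^sub>R iexp (\<xi> * (b * c + b * x)) =
      (ee (- (of_int k * c)) / sqrt (2 * pi)) * (ee ((x + c) * a) * exp (- (pi * t * (x + c)\<^sup>2)) * ee (- (of_int k * x)))"
      by (simp add: 1 scaleR_conv_of_real)
  qed
  finally have "complex_of_real (exp (- \<xi>\<^sup>2 / 2)) = b / sqrt (2 * pi) * ee (- (of_int k * c)) *
      (\<integral>x. ee ((x + c) * a) * exp (- (pi * t * (x + c)\<^sup>2)) * ee (- (of_int k * x)) \<partial>lborel)"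
    using b by (simp add: scaleR_conv_of_real)
  moreover have "b / sqrt (2 * pi) = sqrt t" by (simp add: b_def real_sqrt_mult)
  moreover have "- \<xi>\<^sup>2 / 2 = - (pi * (a - of_int k)\<^sup>2 / t)"
    using b t unfolding \<xi>_def by (simp add: power_divide power_mult_distrib) (simp add: power2_eq_square field_simps)
  ultimately have "complex_of_real (exp (- (pi * (a - of_int k)\<^sup>2 / t))) = of_real (sqrt t) * inverse (ee (of_int k * c)) *
      (\<integral>x. ee ((x + c) * a) * exp (- (pi * t * (x + c)\<^sup>2)) * ee (- (of_int k * x)) \<partial>lborel)"
    by (simp add: ee_minus)
  then show ?thesis using t by (simp add: field_simps)
qed

text \<open>The phase contains n + c, not n as in the L-series. Hence d/da multiplies a term by
  exactly 2 pi i (n + c) and \<open>theta 1\<close> is, up to 2 pi i, the a-derivative of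
  \<open>theta 0\<close>; the price is a factor \<open>ee (a * c)\<close> when comparing with
  L.\<close>

definition theta :: "nat \<Rightarrow> real \<Rightarrow> real \<Rightarrow> real \<Rightarrow> complex" where
  "theta k t a c = isum (\<lambda>n. ee ((of_int n + c) * a) * of_real (of_int n + c) ^ k * of_real (exp (- (pi * t * (of_int n + c)\<^sup>2))))"

lemma theta_term_bound:
  assumes "t > 0" "\<bar>c\<bar> \<le> B" "k \<le> 2"
  shows "norm (ee x * of_real (of_int n + c) ^ k * of_real (exp (- (pi * t * (of_int n + c)\<^sup>2))))
    \<le> 2 * exp (1 / (pi * t) + B) * int_decay n"
  using gauss_bound[of "pi * t" c B k n] assms by (simp add: norm_mult norm_power del: of_real_add)

lemma theta_zero_inversion:
  assumes t: "t > 0"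
  shows "theta 0 t a c = 1 / sqrt t * isum (\<lambda>n. ee (- (of_int n * c)) * exp (- (pi * (of_int n + a)\<^sup>2 / t)))"
proof -
  let ?f = "\<lambda>x. ee ((x + c) * a) * of_real (exp (- (pi * t * (x + c)\<^sup>2)))"
  \<comment> \<open>The lattice bound at the integer floor x with shift frac x + c extends to real
    x.\<close>
  have g: "exp (- (pi * t * (x + c)\<^sup>2)) \<le> 2 * exp (1 / (pi * t) + (\<bar>c\<bar> + 1)) * exp 1 * exp (- \<bar>x\<bar>)" for x
  proof -
    have "\<bar>frac x + c\<bar> \<le> \<bar>c\<bar> + 1" using frac_lt_1[of x] frac_ge_0[of x] by linarith
    from gauss_bound[OF _ this, of "pi * t" 0 "\<lfloor>x\<rfloor>"] t
    have "exp (- (pi * t * (x + c)\<^sup>2)) \<le> 2 * exp (1 / (pi * t) + (\<bar>c\<bar> + 1)) * exp (- \<bar>of_int \<lfloor>x\<rfloor>\<bar>)"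
      by (simp add: frac_def)
    also have "exp (- \<bar>of_int \<lfloor>x\<rfloor>\<bar>) \<le> exp 1 * exp (- \<bar>x\<bar>)"
      unfolding exp_add[symmetric] exp_le_cancel_iff by linarith
    finally show ?thesis by (simp add: mult.assoc)
  qed
  have F: "(\<integral>x. ?f x * ee (- (of_int k * x)) \<partial>lborel) = ee (of_int k * c) * (1 / sqrt t) * exp (- (pi * (a - of_int k)\<^sup>2 / t))" for k
    using gaussian_fourier_transform[OF t] by simp
  have "isum (\<lambda>n. ?f (of_int n)) = isum (\<lambda>k. \<integral>x. ?f x * ee (- (of_int k * x)) \<partial>lborel)"
  proof (rule poisson_summation)
    show "continuous_on UNIV ?f" by (intro continuous_intros)
    show "norm (?f x) \<le> 2 * exp (1 / (pi * t) + (\<bar>c\<bar> + 1)) * exp 1 * exp (- \<bar>x\<bar>)" for x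
      using g by (simp add: norm_mult)
    show "norm (\<integral>x. ?f x * ee (- (of_int k * x)) \<partial>lborel) \<le> (1 / sqrt t * 2 * exp (1 / (pi / t) + \<bar>a\<bar>)) * int_decay k" for k
    proof -
      have "exp (- (pi * (a - of_int k)\<^sup>2 / t)) \<le> 2 * exp (1 / (pi / t) + \<bar>a\<bar>) * int_decay k"
        using gauss_bound[of "pi / t" "-a" "\<bar>a\<bar>" 0 k] t by (simp add: power2_commute)
      from mult_left_mono[OF this, of "1 / sqrt t"] show ?thesis
        unfolding F using t by (simp add: norm_mult norm_divide mult_ac)
    qed
  qed
  also have "\<dots> = isum (\<lambda>k. 1 / sqrt t * (ee (of_int k * c) * exp (- (pi * (a - of_int k)\<^sup>2 / t))))"
    unfolding F by (simp add: mult_ac)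
  also have "\<dots> = 1 / sqrt t * isum (\<lambda>k. ee (of_int k * c) * exp (- (pi * (a - of_int k)\<^sup>2 / t)))"
    by (subst integral_mult_right_zero) simp
  \<comment> \<open>The change of sign of k turns a - k into a + k, so the dual series again runs
    over the shifted lattice.\<close>
  also have "isum (\<lambda>k. ee (of_int k * c) * exp (- (pi * (a - of_int k)\<^sup>2 / t))) =
      isum (\<lambda>k. ee (of_int (0 - k) * c) * exp (- (pi * (a - of_int (0 - k))\<^sup>2 / t)))"
    by (rule isum_reindex_reflect[symmetric])
  finally show ?thesis by (simp add: theta_def add.commute)
qed

lemma isum_has_vector_derivative:
  fixes f :: "real \<Rightarrow> int \<Rightarrow> complex"
  assumes "open U" "convex U" "x0 \<in> U"
    and "\<And>x. x \<in> U \<Longrightarrow> isummable (f x)"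
    and "\<And>x n. x \<in> U \<Longrightarrow> ((\<lambda>x. f x n) has_vector_derivative f' x n) (at x)"
    and "\<And>x n. x \<in> U \<Longrightarrow> norm (f' x n) \<le> C * int_decay n"
  shows "((\<lambda>x. isum (f x)) has_vector_derivative isum (f' x0)) (at x0)"
  by (rule has_vector_derivative_lebesgue_integral[OF assms(1-3), where g="\<lambda>n. C * int_decay n"])
    (use assms isummable_exp in auto)

text \<open>Differentiates \<open>theta_zero_inversion\<close> in \<open>a\<close>: on the left the
  phase produces n + c, on the right the Gaussian produces n + a together with the extra 1 /
  t.\<close>

lemma theta_one_inversion:
  assumes t: "t > 0"
  shows "theta 1 t a c = \<i> / (t * sqrt t) * isum (\<lambda>n. ee (- (of_int n * c)) * of_real (of_int n + a) * exp (- (pi * (of_int n + a)\<^sup>2 / t)))"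
proof -
  define K where "K = 2 * exp (1 / (pi * t) + \<bar>c\<bar>)"
  have tb: "norm (ee x * of_real (of_int n + c) ^ k * of_real (exp (- (pi * t * (of_int n + c)\<^sup>2)))) \<le> K * int_decay n"
    if "k \<le> 2" for k x n
    unfolding K_def by (rule theta_term_bound) (use t that in auto)
  have L: "((\<lambda>a. theta 0 t a c) has_vector_derivative
     isum (\<lambda>n. 2 * pi * \<i> * (ee ((of_int n + c) * a) * of_real (of_int n + c) ^ 1 * of_real (exp (- (pi * t * (of_int n + c)\<^sup>2)))))) (at a)"
    unfolding theta_def
  proof (rule isum_has_vector_derivative[of UNIV])
    show "isummable (\<lambda>n. ee ((of_int n + c) * x) * of_real (of_int n + c) ^ 0 * of_real (exp (- (pi * t * (of_int n + c)\<^sup>2))))" for x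
      by (rule isummable_bound[OF tb]) simp
    show "((\<lambda>a. ee ((of_int n + c) * a) * of_real (of_int n + c) ^ 0 * of_real (exp (- (pi * t * (of_int n + c)\<^sup>2)))) has_vector_derivative
        2 * pi * \<i> * (ee ((of_int n + c) * x) * of_real (of_int n + c) ^ 1 * of_real (exp (- (pi * t * (of_int n + c)\<^sup>2))))) (at x)" for n x
    proof -
      have "((\<lambda>a. ee ((of_int n + c) * a)) has_vector_derivative 2 * pi * \<i> * (of_int n + c) * ee ((of_int n + c) * x)) (at x)"
        using ee_has_vector_derivative[of "\<lambda>a. (of_int n + c) * a" "of_int n + c" x UNIV] by (auto intro!: derivative_eq_intros)
      from has_vector_derivative_mult_left[OF this, of "of_real (exp (- (pi * t * (of_int n + c)\<^sup>2)))"] show ?thesis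
        by (simp only: power_0 power_one_right mult_1_right mult_1_left mult_ac)
    qed
    show "norm (2 * pi * \<i> * (ee ((of_int n + c) * x) * of_real (of_int n + c) ^ 1 * of_real (exp (- (pi * t * (of_int n + c)\<^sup>2)))))
       \<le> (2 * pi * K) * int_decay n" for n x
      using mult_left_mono[OF tb[of 1 "(of_int n + c) * x" n], of "2 * pi"] by (simp add: norm_mult mult.assoc)
  qed auto
  \<comment> \<open>On the left \<open>a\<close> occurs only in phases, so the bounds hold on the
    whole line; on the right it shifts the Gaussian and a bounded neighbourhood is needed.\<close>
  define U where "U = ball a 1"
  let ?h = "\<lambda>a n. ee (- (of_int n * c)) * of_real (exp (- (pi * (of_int n + a)\<^sup>2 / t)))"
  define B where "B = \<bar>a\<bar> + 1"
  define K' where "K' = 2 * exp (1 / (pi / t) + B)"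
  have gb: "\<bar>of_int n + y\<bar> ^ k * exp (- (pi * (of_int n + y)\<^sup>2 / t)) \<le> K' * int_decay n"
    if "y \<in> U" "k \<le> 2" for y n k
    using gauss_bound[of "pi / t" y B k n] that t by (auto simp: K'_def B_def U_def dist_real_def)
  have R: "((\<lambda>a. isum (?h a)) has_vector_derivative
     isum (\<lambda>n. - (2 * pi / t) * (ee (- (of_int n * c)) * of_real (of_int n + a) * exp (- (pi * (of_int n + a)\<^sup>2 / t))))) (at a)"
  proof (rule isum_has_vector_derivative[of U])
    show "isummable (?h x)" if "x \<in> U" for x
      by (rule isummable_bound[of _ K']) (use gb[OF that, of 0] in \<open>simp add: norm_mult\<close>)
    show "((\<lambda>x. ?h x n) has_vector_derivative
       - (2 * pi / t) * (ee (- (of_int n * c)) * of_real (of_int n + x) * exp (- (pi * (of_int n + x)\<^sup>2 / t)))) (at x)" for x n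
    proof -
      have "((\<lambda>x. exp (- (pi * (of_int n + x)\<^sup>2 / t))) has_real_derivative (- (2 * pi / t)) * ((of_int n + x) * exp (- (pi * (of_int n + x)\<^sup>2 / t)))) (at x)"
        using t by (auto intro!: derivative_eq_intros simp: field_simps)
      from has_vector_derivative_mult_right[OF has_vector_derivative_of_real[OF this], of "ee (- (of_int n * c))"] show ?thesis
        by (simp add: mult_ac)
    qed
    show "norm (- (2 * pi / t) * (ee (- (of_int n * c)) * of_real (of_int n + x) * exp (- (pi * (of_int n + x)\<^sup>2 / t)))) \<le> (2 * pi / t * K') * int_decay n"
      if "x \<in> U" for x n
      using mult_left_mono[OF gb[OF that, of 1 n], of "2 * pi / t"] t
      by (simp add: norm_mult norm_divide mult.assoc del: of_real_add of_int_add)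
  qed (auto simp: U_def)
  have "((\<lambda>a. theta 0 t a c) has_vector_derivative
     1 / sqrt t * isum (\<lambda>n. - (2 * pi / t) * (ee (- (of_int n * c)) * of_real (of_int n + a) * exp (- (pi * (of_int n + a)\<^sup>2 / t))))) (at a)"
    unfolding theta_zero_inversion[OF t] using has_vector_derivative_mult_right[OF R] .
  from vector_derivative_unique_at[OF L this]
  have "2 * pi * \<i> * theta 1 t a c = 1 / sqrt t * (- (2 * pi / t) * isum (\<lambda>n. ee (- (of_int n * c)) * of_real (of_int n + a) * exp (- (pi * (of_int n + a)\<^sup>2 / t))))"
    unfolding theta_def by simp
  moreover have "theta 1 t a c = (- \<i> / (2 * pi)) * (2 * pi * \<i> * theta 1 t a c)" by simp
  ultimately have "theta 1 t a c = (- \<i> / (2 * pi)) * (1 / sqrt t * (- (2 * pi / t) * isum (\<lambda>n. ee (- (of_int n * c)) * of_real (of_int n + a) * exp (- (pi * (of_int n + a)\<^sup>2 / t)))))"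
    by (simp only:)
  then show ?thesis by simp
qed

lemma theta_inversion:
  assumes "t > 0" "k \<le> 1"
  shows "theta k t a c = \<i> ^ k / (t ^ k * sqrt t) *
     isum (\<lambda>n. ee (- (of_int n * c)) * of_real (of_int n + a) ^ k * exp (- (pi / t * (of_int n + a)\<^sup>2)))"
proof (cases "k = 0")
  case True
  then show ?thesis using theta_zero_inversion[OF assms(1)] by simp
next
  case False
  then have "k = 1" using assms by simp
  then show ?thesis using theta_one_inversion[OF assms(1)] by simp
qed

section \<open>Twisted Gaussian sums and the Mellin integral\<close>

text \<open>The sum is positive, hence its own norm. Theta inversion moves c into phases, and for t
  <= 1 the dual terms are at most their values at t = 1, which makes the bound uniform in c.\<close>

lemma gauss_lattice_sum_le:
  assumes "0 < t" "t \<le> 1"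
  shows "isum (\<lambda>n. exp (- (pi * t * (of_int n + c)\<^sup>2))) \<le> isum (\<lambda>n. exp (- (pi * (of_int n)\<^sup>2))) / sqrt t"
proof -
  let ?g = "\<lambda>n. exp (- (pi * t * (of_int n + c)\<^sup>2))"
  have s: "isummable (\<lambda>n. exp (- (s * (of_int n + c)\<^sup>2)))" if "s > 0" for s c :: real
    by (rule isummable_bound[of _ "2 * exp (1 / s + \<bar>c\<bar>)"]) (use gauss_bound[OF that, of c "\<bar>c\<bar>" 0] in auto)
  have "complex_of_real (isum ?g) = theta 0 t 0 c"
    by (simp add: theta_def flip: integral_complex_of_real)
  also have "\<dots> = 1 / sqrt t * isum (\<lambda>n. ee (- (of_int n * c)) * exp (- (pi * (of_int n + 0)\<^sup>2 / t)))"
    by (rule theta_zero_inversion[OF assms(1)])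
  finally have "norm (complex_of_real (isum ?g)) = 1 / sqrt t * norm (isum (\<lambda>n. ee (- (of_int n * c)) * complex_of_real (exp (- (pi * (of_int n + 0)\<^sup>2 / t)))))"
    using assms by (simp add: norm_mult norm_divide)
  also have "norm (isum (\<lambda>n. ee (- (of_int n * c)) * complex_of_real (exp (- (pi * (of_int n + 0)\<^sup>2 / t))))) \<le> isum (\<lambda>n. exp (- (pi * (of_int n)\<^sup>2)))"
  proof (rule isum_norm_le)
    show "norm (ee (- (of_int n * c)) * complex_of_real (exp (- (pi * (of_int n + 0)\<^sup>2 / t)))) \<le> exp (- (pi * (of_int n)\<^sup>2))" for n
      using assms mult_left_mono[of t 1 "pi * (of_int n)\<^sup>2"] by (simp add: norm_mult field_simps)
    show "isummable (\<lambda>n. exp (- (pi * (of_int n)\<^sup>2)))" using s[of pi 0] by simp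
  qed
  finally show ?thesis using assms by (simp add: divide_right_mono mult.commute)
qed

text \<open>In the derivative bound the polynomial factor is paid for with half of the Gaussian, by
  1 + pi x^2 / 2 <= exp (pi x^2 / 2); what remains is still a Gaussian, so increments along the
  lattice can be summed.\<close>

lemma gauss_profile_bounds:
  assumes "k \<le> (1::nat)"
  defines "\<phi> \<equiv> \<lambda>x::real. x ^ k * exp (- (pi * x\<^sup>2))"
  shows "\<bar>\<phi> x\<bar> \<le> 1"
    and "\<exists>d. (\<phi> has_real_derivative d) (at x) \<and> \<bar>d\<bar> \<le> 2 * pi * exp (- (pi * x\<^sup>2 / 2))"
proof -
  have k: "k = 0 \<or> k = 1" using assms by auto
  have p: "pi > 3" using pi_gt3 .
  have e: "1 + pi * x\<^sup>2 / 2 \<le> exp (pi * x\<^sup>2 / 2)" using exp_ge_add_one_self by blast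
  have "2 * \<bar>x\<bar> \<le> 1 + x\<^sup>2" using sum_squares_bound[of 1 "\<bar>x\<bar>"] by simp
  moreover have px: "3 * x\<^sup>2 \<le> pi * x\<^sup>2" using p by (intro mult_right_mono) auto
  ultimately have x1: "\<bar>x\<bar> \<le> 1 + pi * x\<^sup>2 / 2" "\<bar>x\<bar> \<le> 1 + pi * x\<^sup>2" using zero_le_power2[of x] by linarith+
  have e2: "1 + pi * x\<^sup>2 \<le> exp (pi * x\<^sup>2)" using exp_ge_add_one_self by blast
  show "\<bar>\<phi> x\<bar> \<le> 1"
    using k order_trans[OF x1(2) e2] by (auto simp: \<phi>_def exp_minus abs_mult field_simps)
  have "\<bar>1 - 2 * pi * x\<^sup>2\<bar> \<le> 4 * (1 + pi * x\<^sup>2 / 2)" using px by (simp add: abs_if)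
  also have "\<dots> \<le> (2 * pi) * exp (pi * x\<^sup>2 / 2)" using p e by (intro mult_mono) auto
  finally have d1: "\<bar>1 - 2 * pi * x\<^sup>2\<bar> \<le> 2 * pi * exp (pi * x\<^sup>2 / 2)" .
  have d0: "\<bar>- (2 * pi * x)\<bar> \<le> 2 * pi * exp (pi * x\<^sup>2 / 2)"
    using order_trans[OF x1(1) e] by (simp add: abs_mult)
  have half: "exp (- (pi * x\<^sup>2)) = exp (- (pi * x\<^sup>2 / 2)) * exp (- (pi * x\<^sup>2 / 2))"
    by (simp flip: exp_add)
  have red: "\<bar>y * exp (- (pi * x\<^sup>2))\<bar> \<le> 2 * pi * exp (- (pi * x\<^sup>2 / 2))" if "\<bar>y\<bar> \<le> 2 * pi * exp (pi * x\<^sup>2 / 2)" for y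
  proof -
    have "\<bar>y\<bar> * exp (- (pi * x\<^sup>2 / 2)) \<le> 2 * pi" using that by (simp add: exp_minus field_simps)
    from mult_right_mono[OF this, of "exp (- (pi * x\<^sup>2 / 2))"] show ?thesis
      unfolding half abs_mult by (simp add: mult.assoc)
  qed
  show "\<exists>d. (\<phi> has_real_derivative d) (at x) \<and> \<bar>d\<bar> \<le> 2 * pi * exp (- (pi * x\<^sup>2 / 2))"
    using k
  proof
    assume "k = 0"
    then have "(\<phi> has_real_derivative (- (2 * pi * x) * exp (- (pi * x\<^sup>2)))) (at x)"
      unfolding \<phi>_def by (auto intro!: derivative_eq_intros)
    then show ?thesis using red[OF d0] by blast
  next
    assume "k = 1"
    then have "(\<phi> has_real_derivative ((1 - 2 * pi * x\<^sup>2) * exp (- (pi * x\<^sup>2)))) (at x)"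
      unfolding \<phi>_def by (auto intro!: derivative_eq_intros simp: algebra_simps power2_eq_square)
    then show ?thesis using red[OF d1] by blast
  qed
qed

text \<open>Mean value theorem. The intermediate point lies within 1 of y, so y^2 <= 2
  \<open>\<xi>\<close>^2 + 2; replacing it by y halves the exponent pi / 2 once more, to pi / 4, and
  costs at most the factor exp pi because q <= 1.\<close>

lemma gauss_profile_increment:
  assumes "k \<le> (1::nat)" "0 < q" "q \<le> 1"
  defines "\<phi> \<equiv> \<lambda>x::real. x ^ k * exp (- (pi * x\<^sup>2))"
  shows "\<bar>\<phi> (q * (y + 1)) - \<phi> (q * y)\<bar> \<le> q * (2 * pi * exp pi) * exp (- (pi * (q\<^sup>2 / 4) * y\<^sup>2))"
proof -
  note B = gauss_profile_bounds(2)[OF assms(1), folded \<phi>_def]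
  define d where "d = (\<lambda>x. SOME d. (\<phi> has_real_derivative d) (at x) \<and> \<bar>d\<bar> \<le> 2 * pi * exp (- (pi * x\<^sup>2 / 2)))"
  have d: "(\<phi> has_real_derivative d x) (at x)" "\<bar>d x\<bar> \<le> 2 * pi * exp (- (pi * x\<^sup>2 / 2))" for x
    using someI_ex[OF B[of x]] unfolding d_def by auto
  have "((\<lambda>x. \<phi> (q * x)) has_real_derivative d (q * x) * q) (at x)" for x
    by (rule DERIV_chain2[OF d(1)]) (auto intro!: derivative_eq_intros)
  then obtain \<xi> where \<xi>: "y < \<xi>" "\<xi> < y + 1" "\<phi> (q * (y + 1)) - \<phi> (q * y) = (y + 1 - y) * (d (q * \<xi>) * q)"
    using MVT2[of y "y + 1" "\<lambda>x. \<phi> (q * x)" "\<lambda>x. d (q * x) * q"] by auto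
  have "\<bar>\<phi> (q * (y + 1)) - \<phi> (q * y)\<bar> = q * \<bar>d (q * \<xi>)\<bar>" using \<xi>(3) assms by (simp add: abs_mult)
  also have "\<dots> \<le> q * (2 * pi * exp (- (pi * (q * \<xi>)\<^sup>2 / 2)))"
    using d(2) assms by (intro mult_left_mono) auto
  also have "exp (- (pi * (q * \<xi>)\<^sup>2 / 2)) \<le> exp pi * exp (- (pi * (q\<^sup>2 / 4) * y\<^sup>2))"
  proof -
    have "0 \<le> (y - 2 * (y - \<xi>))\<^sup>2" "\<bar>y - \<xi>\<bar> \<le> 1" using \<xi> by auto
    then have "y\<^sup>2 \<le> 2 * \<xi>\<^sup>2 + 2 * (y - \<xi>)\<^sup>2" by (simp add: power2_eq_square algebra_simps)
    moreover have "(y - \<xi>)\<^sup>2 \<le> 1" using \<open>\<bar>y - \<xi>\<bar> \<le> 1\<close> abs_square_le_1 by blast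
    ultimately have "q\<^sup>2 * (y\<^sup>2 / 2 - 1) \<le> q\<^sup>2 * \<xi>\<^sup>2" by (intro mult_left_mono) auto
    moreover have "q\<^sup>2 \<le> 1" using assms by (simp add: power_le_one)
    ultimately have "- (q * \<xi>)\<^sup>2 / 2 \<le> 1 - q\<^sup>2 / 4 * y\<^sup>2"
      by (simp add: power_mult_distrib algebra_simps)
    from mult_left_mono[OF this, of pi] have "- (pi * (q * \<xi>)\<^sup>2 / 2) \<le> pi + - (pi * (q\<^sup>2 / 4) * y\<^sup>2)"
      by (simp add: algebra_simps)
    then show ?thesis by (simp flip: exp_add)
  qed
  finally show ?thesis using assms by (simp add: mult_left_mono mult.assoc)
qed

lemma sum_int_telescope:
  fixes F :: "int \<Rightarrow> 'a::ab_group_add"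
  shows "(\<Sum>n\<in>{- int N..int N}. F (n + 1) - F n) = F (int N + 1) - F (- int N)"
proof (induction N)
  case (Suc N)
  have "{- int (Suc N)..int (Suc N)} = insert (int N + 1) (insert (- int N - 1) {- int N..int N})" by auto
  moreover have "- 1 - int N = - int N - 1" by simp
  then have "F (- 1 - int N) = F (- int N - 1)" by (rule arg_cong)
  ultimately show ?case using Suc by (simp add: algebra_simps)
qed simp

text \<open>Abel summation: the only input beyond a not being an integer is that the total variation of the
  Gaussian profile along the lattice is bounded uniformly in t.\<close>

lemma twisted_gauss_sum_bound:
  assumes a: "a \<notin> \<int>" and k: "k \<le> 1"
  shows "\<exists>C. \<forall>N t. 0 < t \<longrightarrow> t \<le> 1 \<longrightarrow>
    norm (\<Sum>n\<in>{- int N..int N}. ee (of_int n * a) * of_real (of_int n + c) ^ k * of_real (exp (- (pi * t * (of_int n + c)\<^sup>2)))) \<le> C / sqrt t ^ k"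
proof -
  define A where "A = isum (\<lambda>n. exp (- (pi * (of_int n)\<^sup>2)))"
  define \<phi> where "\<phi> = (\<lambda>x::real. x ^ k * exp (- (pi * x\<^sup>2)))"
  \<comment> \<open>The 2 bounds the boundary terms of the summation by parts. In the variation term
    the step q = sqrt t cancels the 1 / sqrt t of the lattice sum, leaving 4 pi exp(pi) A
    independently of t and N.\<close>
  define C where "C = (2 + 4 * pi * exp pi * A) / norm (ee a - 1)"
  have ea: "ee a - 1 \<noteq> 0" using a by (simp add: ee_eq_1_iff)
  have "norm (\<Sum>n\<in>{- int N..int N}. ee (of_int n * a) * of_real (of_int n + c) ^ k * of_real (exp (- (pi * t * (of_int n + c)\<^sup>2)))) \<le> C / sqrt t ^ k"
    if t: "0 < t" "t \<le> 1" for N t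
  proof -
    define q where "q = sqrt t"
    have q: "0 < q" "q \<le> 1" "q\<^sup>2 = t" using t by (auto simp: q_def)
    let ?A = "{- int N..int N}"
    let ?S = "\<Sum>n\<in>?A. ee (of_int n * a) * of_real (of_int n + c) ^ k * of_real (exp (- (pi * t * (of_int n + c)\<^sup>2)))"
    define e where "e = (\<lambda>n::int. ee (of_int n * a))"
    define h where "h = (\<lambda>n::int. complex_of_real (\<phi> (q * (of_int n + c))))"
    have S: "of_real (q ^ k) * ?S = (\<Sum>n\<in>?A. e n * h n)"
      unfolding sum_distrib_left
    proof (intro sum.cong refl)
      fix n :: int
      have "h n = of_real (q ^ k * (of_int n + c) ^ k * exp (- (pi * t * (of_int n + c)\<^sup>2)))"
        by (simp add: h_def \<phi>_def power_mult_distrib q(3) mult_ac)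
      then show "of_real (q ^ k) * (ee (of_int n * a) * of_real (of_int n + c) ^ k * of_real (exp (- (pi * t * (of_int n + c)\<^sup>2)))) = e n * h n"
        by (simp add: e_def mult_ac)
    qed
    \<comment> \<open>The character is its own forward difference up to \<open>ee a - 1\<close>,
      which is nonzero exactly because \<open>a\<close> is not an integer.\<close>
    have e1: "(ee a - 1) * e n = e (n + 1) - e n" for n
      by (simp add: e_def algebra_simps ee_add)
    have ne: "norm (e n) = 1" for n by (simp add: e_def)
    have hb: "norm (h n) \<le> 1" for n
      unfolding h_def \<phi>_def norm_of_real by (rule gauss_profile_bounds(1)[OF k])
    have hd: "norm (h (n + 1) - h n) \<le> q * (2 * pi * exp pi) * exp (- (pi * (t / 4) * (of_int n + c)\<^sup>2))" for n
    proof -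
      have "of_int (n + 1) + c = (of_int n + c) + 1" by simp
      then show ?thesis
        using gauss_profile_increment[OF k q(1,2), of "of_int n + c"] unfolding q(3)
        by (simp only: h_def \<phi>_def of_real_diff[symmetric] norm_of_real)
    qed
    have "(ee a - 1) * (\<Sum>n\<in>?A. e n * h n) = (\<Sum>n\<in>?A. (e (n + 1) * h (n + 1) - e n * h n) - e (n + 1) * (h (n + 1) - h n))"
      unfolding sum_distrib_left
      by (intro sum.cong refl) (simp add: mult.assoc[symmetric] e1, simp add: algebra_simps)
    also have "\<dots> = e (int N + 1) * h (int N + 1) - e (- int N) * h (- int N) - (\<Sum>n\<in>?A. e (n + 1) * (h (n + 1) - h n))"
      unfolding sum_subtractf sum_int_telescope[of "\<lambda>n. e n * h n", unfolded sum_subtractf] ..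
    also have "norm \<dots> \<le> (1 + 1) + (\<Sum>n\<in>?A. norm (e (n + 1) * (h (n + 1) - h n)))"
      by (intro order_trans[OF norm_triangle_ineq4] add_mono norm_sum) (use hb in \<open>auto simp: norm_mult ne\<close>)
    also have "(\<Sum>n\<in>?A. norm (e (n + 1) * (h (n + 1) - h n))) \<le> (\<Sum>n\<in>?A. q * (2 * pi * exp pi) * exp (- (pi * (t / 4) * (of_int n + c)\<^sup>2)))"
      by (rule sum_mono) (use hd in \<open>simp add: norm_mult ne\<close>)
    also have "\<dots> = q * (2 * pi * exp pi) * (\<Sum>n\<in>?A. exp (- (pi * (t / 4) * (of_int n + c)\<^sup>2)))"
      by (simp add: sum_distrib_left)
    also have "(\<Sum>n\<in>?A. exp (- (pi * (t / 4) * (of_int n + c)\<^sup>2))) \<le> isum (\<lambda>n. exp (- (pi * (t / 4) * (of_int n + c)\<^sup>2)))"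
    proof (rule sum_le_isum)
      show "isummable (\<lambda>n. exp (- (pi * (t / 4) * (of_int n + c)\<^sup>2)))"
        by (rule isummable_bound[of _ "2 * exp (1 / (pi * (t / 4)) + \<bar>c\<bar>)"]) (use gauss_bound[of "pi * (t / 4)" c "\<bar>c\<bar>" 0] t in auto)
    qed auto
    also have "\<dots> \<le> A / sqrt (t / 4)"
      unfolding A_def by (rule gauss_lattice_sum_le) (use t in auto)
    also have "sqrt (t / 4) = q / 2" by (simp add: q_def real_sqrt_divide)
    finally have "norm ((ee a - 1) * (\<Sum>n\<in>?A. e n * h n)) \<le> 1 + 1 + q * (2 * pi * exp pi) * (A / (q / 2))"
      using q by (simp add: mult_left_mono)
    also have "\<dots> = 2 + 4 * pi * exp pi * A" using q by simp
    finally have "norm (\<Sum>n\<in>?A. e n * h n) \<le> C"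
      unfolding norm_mult using ea by (simp add: C_def pos_le_divide_eq mult.commute)
    then have "q ^ k * norm ?S \<le> C" unfolding S[symmetric] using q by (simp add: norm_mult norm_power)
    then show ?thesis using q by (simp add: q_def[symmetric] field_simps)
  qed
  then show ?thesis by blast
qed

text \<open>Substituting t = x exp u in Euler's integral gives Gamma v times x powr (- v) as an
  integral over all real u. It is split at u = 0, and the negative half is reflected to u >
  0.\<close>

lemma Gamma_split_uGamma:
  assumes x: "x > 0" and v: "Re v > 0"
  shows "Gamma v * exp (- (v * of_real (ln x))) = uGamma v x + (\<integral>u. exp (- (v * of_real u) - of_real (x * exp (- u))) \<partial>posm)"
    and "integrable posm (\<lambda>u. exp (- (v * of_real u) - of_real (x * exp (- u))))"
proof -
  define f where "f = (\<lambda>t. of_real t powr (v - 1) / of_real (exp t) :: complex)"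
  define h where "h = (\<lambda>u. exp (v * of_real u - of_real (x * exp u)) :: complex)"
  define X where "X = exp (v * of_real (ln x))"
  have hm [measurable]: "h \<in> borel_measurable borel" unfolding h_def by measurable
  have img: "(\<lambda>u. x * exp u) ` UNIV = {0<..}"
  proof (intro equalityI subsetI)
    fix y :: real assume "y \<in> {0<..}"
    then have "y = x * exp (ln (y / x))" using x by simp
    then show "y \<in> (\<lambda>u. x * exp u) ` UNIV" by blast
  qed (use x in auto)
  have fh: "\<bar>x * exp u\<bar> *\<^sub>R f (x * exp u) = X * h u" for u
  proof -
    have "of_real (x * exp u) powr (v - 1) = exp ((v - 1) * of_real (ln x + u))"
      using x by (simp add: powr_def Ln_of_real ln_mult flip: of_real_mult)
    moreover have xe: "x * exp u = exp (ln x + u)"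
      using x by (simp add: exp_add)
    moreover have "of_real (x * exp u) = exp (complex_of_real (ln x + u))"
      unfolding xe by (simp only: exp_of_real)
    ultimately have "\<bar>x * exp u\<bar> *\<^sub>R f (x * exp u) = exp (complex_of_real (ln x + u)) * exp ((v - 1) * of_real (ln x + u)) / exp (of_real (x * exp u))"
      by (simp only: f_def scaleR_conv_of_real exp_of_real abs_of_pos exp_gt_zero times_divide_eq_right)
    also have "\<dots> = X * h u"
      by (simp add: X_def h_def exp_add[symmetric] exp_diff[symmetric] algebra_simps)
    finally show ?thesis .
  qed
  have G: "f absolutely_integrable_on {0<..}" "integral {0<..} f = Gamma v"
    using absolutely_integrable_Gamma_integral'[OF v] Gamma_integral_complex'[OF v]
    by (auto simp: f_def has_integral_iff)
  have "(\<lambda>u. \<bar>x * exp u\<bar> *\<^sub>R f (x * exp u)) absolutely_integrable_on UNIV \<and>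
      integral UNIV (\<lambda>u. \<bar>x * exp u\<bar> *\<^sub>R f (x * exp u)) = Gamma v"
    using G unfolding img[symmetric]
    by (subst has_absolute_integral_change_of_variables_real)
      (use x in \<open>auto intro!: derivative_eq_intros inj_onI\<close>)
  then have "(\<lambda>u. X * h u) absolutely_integrable_on UNIV" "integral UNIV (\<lambda>u. X * h u) = Gamma v"
    unfolding fh by auto
  then have l: "integrable lebesgue (\<lambda>u. X * h u)" "integral\<^sup>L lebesgue (\<lambda>u. X * h u) = Gamma v"
    using set_lebesgue_integral_eq_integral(2)[of UNIV "\<lambda>u. X * h u"]
    by (auto simp: set_integrable_def set_lebesgue_integral_def)
  have l': "integrable lborel (\<lambda>u. X * h u)" "integral\<^sup>L lborel (\<lambda>u. X * h u) = Gamma v"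
    using l by (simp_all add: integrable_completion integral_completion)
  have X0: "X \<noteq> 0" by (simp add: X_def)
  have hI: "X * integral\<^sup>L lborel h = Gamma v" using l'(2) by simp
  have hi: "integrable lborel h"
    using integrable_mult_right[OF l'(1), of "inverse X"] X0 by (simp add: mult.assoc[symmetric])
  have r0: "(\<lambda>u. indicat_real {0<..} u *\<^sub>R h (- u)) = (\<lambda>u. indicat_real {..<0} (0 + (-1) * u) *\<^sub>R h (0 + (-1) * u))"
    by (auto simp: indicator_def fun_eq_iff)
  have neg: "integrable lborel (\<lambda>u. indicat_real {..<0} u *\<^sub>R h u)" "integrable lborel (\<lambda>u. indicat_real {0<..} u *\<^sub>R h u)"
    by (intro integrable_mult_indicator hi; simp)+
  have "integrable lborel (\<lambda>u. indicat_real {0<..} u *\<^sub>R h (- u))"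
    unfolding r0 by (rule lborel_integrable_real_affine[OF neg(1)]) simp
  then show "integrable posm (\<lambda>u. exp (- (v * of_real u) - of_real (x * exp (- u))))"
    by (simp add: integrable_restrict_space h_def)
  have "integral\<^sup>L lborel h = (\<integral>u. indicat_real {0<..} u *\<^sub>R h u + indicat_real {..<0} u *\<^sub>R h u \<partial>lborel)"
    by (rule integral_cong_AE) (use AE_lborel_singleton[of "0::real"] in \<open>auto simp: indicator_def elim!: eventually_mono\<close>)
  also have "\<dots> = uGamma v x + (\<integral>u. indicat_real {..<0} u *\<^sub>R h u \<partial>lborel)"
    using neg by (simp add: uGamma_def h_def integral_restrict_space)
  also have "(\<integral>u. indicat_real {..<0} u *\<^sub>R h u \<partial>lborel) = (\<integral>u. indicat_real {0<..} u *\<^sub>R h (- u) \<partial>lborel)"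
    unfolding r0 by (subst lborel_integral_real_affine[of "-1" _ 0]) auto
  also have "\<dots> = (\<integral>u. exp (- (v * of_real u) - of_real (x * exp (- u))) \<partial>posm)"
    by (simp add: h_def integral_restrict_space)
  finally show "Gamma v * exp (- (v * of_real (ln x))) = uGamma v x + (\<integral>u. exp (- (v * of_real u) - of_real (x * exp (- u))) \<partial>posm)"
    using hI X0 by (simp add: X_def exp_minus field_simps)
qed

section \<open>The completed Lerch functions\<close>

text \<open>One half of Riemann's formula: the terms integrated over t > 1 against t powr (v - 1).
  The phase is that of the L-series, so it differs from the phase in \<open>theta\<close> by
  \<open>ee (a * c)\<close>.\<close>

definition latG :: "nat \<Rightarrow> complex \<Rightarrow> real \<Rightarrow> real \<Rightarrow> complex" where
  "latG k v a c = isum (\<lambda>n. ee (of_int n * a) * of_real (of_int n + c) ^ k * uGamma v (pi * (of_int n + c)\<^sup>2))"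

text \<open>The theta series at the splitting point t = 1, with the phase of \<open>latG\<close>; it
  collects the boundary terms of \<open>uGamma_recurrence\<close>.\<close>

definition gauss_sum :: "real \<Rightarrow> real \<Rightarrow> complex" where
  "gauss_sum a c = isum (\<lambda>n. ee (of_int n * a) * of_real (exp (- (pi * (of_int n + c)\<^sup>2))))"

lemma of_int_add_nonzero:
  fixes c :: "'a::ring_1"
  assumes "c \<notin> \<int>"
  shows "of_int n + c \<noteq> 0"
proof
  assume "of_int n + c = 0"
  then have "c = of_int (- n)" by (simp add: eq_neg_iff_add_eq_0 add.commute)
  then show False using assms Ints_of_int by metis
qed

text \<open>Keeps the arguments of \<open>uGamma\<close> away from 0, locally uniformly in the
  shift. Half the distance to the nearest integer serves both as radius of the ball and as the gap
  that remains on it.\<close>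

lemma dist_Ints_pos:
  fixes c :: real
  assumes "c \<notin> \<int>"
  shows "\<exists>d>0. \<forall>y\<in>ball c d. \<forall>n::int. d \<le> \<bar>of_int n + y\<bar>"
proof -
  define d where "d = min (frac c) (1 - frac c) / 2"
  have f: "0 < frac c" "frac c < 1" using assms frac_lt_1[of c] by simp_all
  have "d \<le> \<bar>of_int n + y\<bar>" if "y \<in> ball c d" for y n
  proof -
    have y: "\<bar>c - y\<bar> < d" using that by (simp add: dist_real_def)
    have c: "c = of_int \<lfloor>c\<rfloor> + frac c" by (simp add: frac_def)
    have d: "2 * d \<le> frac c" "2 * d \<le> 1 - frac c" by (simp_all add: d_def)
    show ?thesis
    proof (cases "0 \<le> n + \<lfloor>c\<rfloor>")
      case True
      then have "0 \<le> real_of_int (n + \<lfloor>c\<rfloor>)" by (simp only: of_int_0_le_iff)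
      then show ?thesis using y c f d unfolding of_int_add by linarith
    next
      case False
      then have "n + \<lfloor>c\<rfloor> \<le> -1" by simp
      then have "real_of_int (n + \<lfloor>c\<rfloor>) \<le> of_int (-1)" by (simp only: of_int_le_iff)
      then show ?thesis using y c f d unfolding of_int_add by (simp only: of_int_minus of_int_1)
    qed
  qed
  moreover have "d > 0" using f by (simp add: d_def)
  ultimately show ?thesis by blast
qed

text \<open>\<open>uGamma_bound\<close> retains half of the Gaussian exponent, which absorbs up to
  two powers of n + c and still leaves exponential decay.\<close>

lemma latG_term_bound:
  assumes "d > 0" "d \<le> \<bar>of_int n + c\<bar>" "\<bar>c\<bar> \<le> B" "j \<le> 2" "\<bar>Re v\<bar> \<le> \<sigma>"
  shows "norm (ee x * of_real (of_int n + c) ^ j * uGamma v (pi * (of_int n + c)\<^sup>2))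
     \<le> (exp ((\<sigma> + 1)\<^sup>2 / (pi * d\<^sup>2)) * (2 * exp (1 / (pi / 2) + B))) * int_decay n"
proof -
  define y where "y = of_int n + c"
  have dy: "pi * d\<^sup>2 \<le> pi * y\<^sup>2"
    using assms(1,2) abs_le_square_iff[of d y] unfolding y_def by simp
  have "norm (ee x * of_real y ^ j * uGamma v (pi * y\<^sup>2)) = \<bar>y\<bar> ^ j * norm (uGamma v (pi * y\<^sup>2))"
    by (simp add: norm_mult norm_power)
  also have "\<dots> \<le> \<bar>y\<bar> ^ j * (exp ((\<sigma> + 1)\<^sup>2 / (pi * d\<^sup>2)) * exp (- (pi * y\<^sup>2) / 2))"
    using assms(1) by (intro mult_left_mono uGamma_bound dy assms(5)) auto
  also have "\<dots> = exp ((\<sigma> + 1)\<^sup>2 / (pi * d\<^sup>2)) * (\<bar>y\<bar> ^ j * exp (- (pi / 2 * y\<^sup>2)))"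
    by simp
  also have "\<dots> \<le> exp ((\<sigma> + 1)\<^sup>2 / (pi * d\<^sup>2)) * (2 * exp (1 / (pi / 2) + B) * int_decay n)"
    unfolding y_def by (intro mult_left_mono gauss_bound assms) auto
  finally show ?thesis by (simp add: y_def mult.assoc)
qed

lemma latG_summable:
  assumes "c \<notin> \<int>" "j \<le> 2"
  shows "isummable (\<lambda>n. ee (x n) * of_real (of_int n + c) ^ j * uGamma v (pi * (of_int n + c)\<^sup>2))"
proof -
  obtain d where d: "d > 0" "\<And>n::int. d \<le> \<bar>of_int n + c\<bar>" using dist_Ints_pos[OF assms(1)] by auto
  show ?thesis
    by (rule isummable_bound[OF latG_term_bound[OF d order_refl assms(2) order_refl]])
qed

lemma latG_holomorphic:
  assumes "c \<notin> \<int>" "j \<le> 2"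
  shows "(\<lambda>v. latG j v a c) holomorphic_on UNIV"
proof -
  obtain d where d: "d > 0" "\<And>n::int. d \<le> \<bar>of_int n + c\<bar>" using dist_Ints_pos[OF assms(1)] by auto
  define X where "X = (\<lambda>n::int. pi * (of_int n + c)\<^sup>2)"
  have X: "0 < pi * d\<^sup>2" "pi * d\<^sup>2 \<le> X n" for n
    using d(1) d(2)[of n] abs_le_square_iff[of d "of_int n + c"] unfolding X_def by auto
  define D where "D = (\<lambda>v n. deriv (\<lambda>v. uGamma v (X n)) v)"
  have D: "((\<lambda>v. uGamma v (X n)) has_field_derivative D v n) (at v)"
    "norm (D v n) \<le> exp ((\<sigma> + 2)\<^sup>2 / (pi * d\<^sup>2)) * exp (- X n / 2)" if "\<bar>Re v\<bar> \<le> \<sigma>" for v n \<sigma>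
    using uGamma_holomorphic_aux[OF X that] DERIV_imp_deriv unfolding D_def by metis+
  have "\<exists>f'. ((\<lambda>v. latG j v a c) has_field_derivative f') (at v)" for v
  proof -
    define \<sigma> where "\<sigma> = \<bar>Re v\<bar> + 1"
    have \<sigma>: "\<bar>Re w\<bar> \<le> \<sigma>" if "w \<in> ball v 1" for w
      using that abs_Re_le_cmod[of "v - w"] by (auto simp: \<sigma>_def dist_norm)
    have "((\<lambda>v. latG j v a c) has_field_derivative isum (\<lambda>n. ee (of_int n * a) * of_real (of_int n + c) ^ j * D v n)) (at v)"
      unfolding latG_def
    proof (rule has_field_derivative_lebesgue_integral[of "ball v 1"])
      show "isummable (\<lambda>n. ee (of_int n * a) * of_real (of_int n + c) ^ j * uGamma w (pi * (of_int n + c)\<^sup>2))" for w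
        by (rule latG_summable[OF assms])
      show "((\<lambda>x. ee (of_int n * a) * of_real (of_int n + c) ^ j * uGamma x (pi * (of_int n + c)\<^sup>2)) has_field_derivative
          ee (of_int n * a) * of_real (of_int n + c) ^ j * D w n) (at w)" for w n
        using DERIV_cmult[OF D(1)[OF order_refl]] by (simp add: X_def)
      show "norm (ee (of_int n * a) * of_real (of_int n + c) ^ j * D w n) \<le>
        (exp ((\<sigma> + 2)\<^sup>2 / (pi * d\<^sup>2)) * (2 * exp (1 / (pi / 2) + \<bar>c\<bar>))) * int_decay n"
        if "w \<in> ball v 1" for w n
      proof -
        have "norm (ee (of_int n * a) * of_real (of_int n + c) ^ j * D w n) = \<bar>of_int n + c\<bar> ^ j * norm (D w n)"
          by (simp add: norm_mult norm_power del: of_real_add)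
        also have "\<dots> \<le> \<bar>of_int n + c\<bar> ^ j * (exp ((\<sigma> + 2)\<^sup>2 / (pi * d\<^sup>2)) * exp (- X n / 2))"
          using D(2)[OF \<sigma>[OF that]] by (intro mult_left_mono) auto
        also have "\<dots> = exp ((\<sigma> + 2)\<^sup>2 / (pi * d\<^sup>2)) * (\<bar>of_int n + c\<bar> ^ j * exp (- (pi / 2 * (of_int n + c)\<^sup>2)))"
          by (simp add: X_def)
        also have "\<dots> \<le> exp ((\<sigma> + 2)\<^sup>2 / (pi * d\<^sup>2)) * (2 * exp (1 / (pi / 2) + \<bar>c\<bar>) * int_decay n)"
          by (intro mult_left_mono gauss_bound assms) auto
        finally show ?thesis by (simp add: mult.assoc)
      qed
    qed (use isummable_exp in auto)
    then show ?thesis by blast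
  qed
  then show ?thesis
    by (auto simp: holomorphic_on_def field_differentiable_def)
qed

section \<open>Symmetries and derivatives of the single sums\<close>

lemma latG_periodic: "latG k v (a + of_int m) c = latG k v a c"
proof -
  have "ee (of_int n * (a + of_int m)) = ee (of_int n * a)" for n
    using ee_of_int[of "n * m"] by (simp add: distrib_left ee_add del: ee_of_int)
  then show ?thesis by (simp add: latG_def)
qed

text \<open>The substitution n -> -1 - n sends n + (1 - c) to - (n + c); the power k gives the sign
  and the phase leaves \<open>ee a\<close>.\<close>

lemma latG_reflect: "latG k v (1 - a) (1 - c) = (-1) ^ k * ee a * latG k v a c"
proof -
  let ?f = "\<lambda>n. ee (of_int n * (1 - a)) * of_real (of_int n + (1 - c)) ^ k * uGamma v (pi * (of_int n + (1 - c))\<^sup>2)"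
  have "?f (-1 - n) = (-1) ^ k * ee a * (ee (of_int n * a) * of_real (of_int n + c) ^ k * uGamma v (pi * (of_int n + c)\<^sup>2))" for n
  proof -
    have 1: "of_int (-1 - n) + (1 - c) = - (of_int n + c)" by simp
    have "ee (of_int (-1 - n) * (1 - a)) = ee (of_int (-1 - n) + (a + of_int n * a))"
      by (simp add: algebra_simps)
    also have "\<dots> = ee a * ee (of_int n * a)" by (simp only: ee_add ee_of_int mult_1_left)
    finally show ?thesis
      unfolding 1 by (simp only: power2_minus of_real_minus power_minus[of "of_real (of_int n + c)"] mult_ac)
  qed
  then have "isum (\<lambda>n. ?f (-1 - n)) = (-1) ^ k * ee a * latG k v a c"
    unfolding latG_def by simp
  moreover have "latG k v (1 - a) (1 - c) = isum (\<lambda>n. ?f (-1 - n))"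
    unfolding latG_def by (rule isum_reindex_reflect[symmetric])
  ultimately show ?thesis by simp
qed

text \<open>Theta inversion at its fixed point t = 1. It is what cancels the boundary terms in
  \<open>Lambda_one_deriv\<close>.\<close>

lemma gauss_sum_inversion: "gauss_sum a c = ee (- (a * c)) * gauss_sum (- c) a"
proof -
  have "theta 0 1 a c = isum (\<lambda>n. ee (c * a) * (ee (of_int n * a) * of_real (exp (- (pi * (of_int n + c)\<^sup>2)))))"
    unfolding theta_def distrib_right ee_add by (intro Bochner_Integration.integral_cong) (simp_all add: mult_ac)
  then have "theta 0 1 a c = ee (c * a) * gauss_sum a c"
    unfolding gauss_sum_def by (simp only: integral_mult_right_zero)
  moreover have "theta 0 1 a c = gauss_sum (- c) a"
    using theta_zero_inversion[of 1 a c] by (simp add: gauss_sum_def)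
  ultimately show ?thesis by (simp add: ee_minus mult_ac)
qed

text \<open>Up to pi the square (n + c)^2 is the argument of \<open>uGamma\<close>, so the
  recurrence removes a second moment termwise and leaves the boundary terms as a Gaussian
  sum.\<close>

lemma latG_two:
  assumes "c \<notin> \<int>"
  shows "pi * latG 2 (v + 1) a c = gauss_sum a c + v * latG 0 v a c"
proof -
  have "of_real pi * latG 2 (v + 1) a c = isum (\<lambda>n. of_real pi * (ee (of_int n * a) * of_real (of_int n + c) ^ 2 * uGamma (v + 1) (pi * (of_int n + c)\<^sup>2)))"
    by (simp add: latG_def)
  also have "\<dots> = isum (\<lambda>n. ee (of_int n * a) * of_real (exp (- (pi * (of_int n + c)\<^sup>2))) +
      v * (ee (of_int n * a) * of_real (of_int n + c) ^ 0 * uGamma v (pi * (of_int n + c)\<^sup>2)))"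
  proof (rule Bochner_Integration.integral_cong[OF refl])
    fix n
    have "of_real pi * (ee (of_int n * a) * of_real (of_int n + c) ^ 2 * uGamma (v + 1) (pi * (of_int n + c)\<^sup>2)) =
      ee (of_int n * a) * (of_real (pi * (of_int n + c)\<^sup>2) * uGamma (v + 1) (pi * (of_int n + c)\<^sup>2))"
      by (simp only: of_real_mult of_real_power mult_ac)
    also have "\<dots> = ee (of_int n * a) * (exp (- of_real (pi * (of_int n + c)\<^sup>2)) + v * uGamma v (pi * (of_int n + c)\<^sup>2))"
      using of_int_add_nonzero[OF assms, of n] by (subst uGamma_recurrence) auto
    finally show "of_real pi * (ee (of_int n * a) * of_real (of_int n + c) ^ 2 * uGamma (v + 1) (pi * (of_int n + c)\<^sup>2)) =
      ee (of_int n * a) * of_real (exp (- (pi * (of_int n + c)\<^sup>2))) + v * (ee (of_int n * a) * of_real (of_int n + c) ^ 0 * uGamma v (pi * (of_int n + c)\<^sup>2))"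
      by (simp only: of_real_minus[symmetric] exp_of_real distrib_left power_0 mult_1_right mult_1_left mult_ac)
  qed
  also have "\<dots> = gauss_sum a c + v * latG 0 v a c"
  proof (subst Bochner_Integration.integral_add)
    show "isummable (\<lambda>n. ee (of_int n * a) * complex_of_real (exp (- (pi * (of_int n + c)\<^sup>2))))"
      by (rule isummable_bound[of _ "2 * exp (1 / pi + \<bar>c\<bar>)"])
        (use gauss_bound[of pi c "\<bar>c\<bar>" 0] in \<open>simp add: norm_mult\<close>)
    show "isummable (\<lambda>n. v * (ee (of_int n * a) * of_real (of_int n + c) ^ 0 * uGamma v (pi * (of_int n + c)\<^sup>2)))"
      by (intro integrable_mult_right latG_summable assms) simp
  qed (simp add: gauss_sum_def latG_def)
  finally show ?thesis .
qed

text \<open>The phase brings down n, which is written as (n + c) - c to stay within the moments of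
  the shifted lattice.\<close>

lemma latG_deriv_fst:
  assumes "c \<notin> \<int>" "k \<le> 1"
  shows "((\<lambda>a. latG k v a c) has_vector_derivative 2 * pi * \<i> * (latG (Suc k) v a c - c * latG k v a c)) (at a)"
proof -
  obtain d where d: "d > 0" "\<And>n::int. d \<le> \<bar>of_int n + c\<bar>" using dist_Ints_pos[OF assms(1)] by auto
  let ?t = "\<lambda>j a n. ee (of_int n * a) * of_real (of_int n + c) ^ j * uGamma v (pi * (of_int n + c)\<^sup>2)"
  define K where "K = exp ((\<bar>Re v\<bar> + 1)\<^sup>2 / (pi * d\<^sup>2)) * (2 * exp (1 / (pi / 2) + \<bar>c\<bar>))"
  have b: "norm (?t j a n) \<le> K * int_decay n" if "j \<le> 2" for j a n
    unfolding K_def by (rule latG_term_bound[OF d order_refl that order_refl])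
  have "((\<lambda>a. isum (?t k a)) has_vector_derivative isum (\<lambda>n. 2 * pi * \<i> * (?t (Suc k) a n - c * ?t k a n))) (at a)"
  proof (rule isum_has_vector_derivative[of UNIV])
    show "isummable (?t k x)" for x by (rule latG_summable) (use assms in auto)
    show "((\<lambda>a. ?t k a n) has_vector_derivative 2 * pi * \<i> * (?t (Suc k) x n - c * ?t k x n)) (at x)" for x n
    proof -
      have "((\<lambda>a. ee (of_int n * a)) has_vector_derivative 2 * pi * \<i> * of_int n * ee (of_int n * x)) (at x)"
        using ee_has_vector_derivative[of "\<lambda>a. of_int n * a" "of_int n" x UNIV] by (auto intro!: derivative_eq_intros)
      from has_vector_derivative_mult_left[OF this, of "of_real (of_int n + c) ^ k * uGamma v (pi * (of_int n + c)\<^sup>2)"]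
      show ?thesis by (simp add: algebra_simps)
    qed
    show "norm (2 * pi * \<i> * (?t (Suc k) x n - c * ?t k x n)) \<le> (2 * pi * (K + \<bar>c\<bar> * K)) * int_decay n" for x n
    proof -
      have "norm (?t (Suc k) x n - c * ?t k x n) \<le> norm (?t (Suc k) x n) + \<bar>c\<bar> * norm (?t k x n)"
        using norm_triangle_ineq4[of "?t (Suc k) x n" "c * ?t k x n"] by (simp only: norm_mult norm_of_real)
      also have "\<dots> \<le> K * int_decay n + \<bar>c\<bar> * (K * int_decay n)"
        using assms(2) by (intro add_mono mult_left_mono b) auto
      finally have "norm (?t (Suc k) x n - c * ?t k x n) \<le> (K + \<bar>c\<bar> * K) * int_decay n"
        by (simp add: distrib_right)
      from mult_left_mono[OF this, of "2 * pi"] show ?thesis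
        by (simp only: norm_mult norm_of_real norm_ii mult_1_right mult.assoc) simp
    qed
  qed auto
  moreover have "isum (\<lambda>n. 2 * pi * \<i> * (?t (Suc k) a n - c * ?t k a n)) = 2 * pi * \<i> * (latG (Suc k) v a c - c * latG k v a c)"
    unfolding latG_def using latG_summable[OF assms(1), of k "\<lambda>n. of_int n * a" v] latG_summable[OF assms(1), of "Suc k" "\<lambda>n. of_int n * a" v] assms(2)
    by (subst integral_mult_right_zero, subst Bochner_Integration.integral_diff) auto
  ultimately show ?thesis unfolding latG_def by simp
qed

lemma uGamma_square_deriv:
  assumes "m + c \<noteq> 0"
  shows "((\<lambda>c. uGamma v (pi * (m + c)\<^sup>2)) has_vector_derivative - (2 * pi * of_real (m + c) * uGamma (v + 1) (pi * (m + c)\<^sup>2))) (at c)"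
proof -
  have p: "pi * (m + c)\<^sup>2 > 0" using assms by simp
  have "((\<lambda>c. pi * (m + c)\<^sup>2) has_vector_derivative 2 * pi * (m + c)) (at c)"
    by (auto intro!: derivative_eq_intros simp: has_real_derivative_iff_has_vector_derivative[symmetric])
  from vector_diff_chain_at[OF this uGamma_deriv_x[OF p, of v]] show ?thesis
    by (simp add: o_def scaleR_conv_of_real mult_ac)
qed

lemma latG_zero_deriv_snd:
  assumes "c \<notin> \<int>"
  shows "((\<lambda>c. latG 0 v a c) has_vector_derivative - (2 * pi * latG 1 (v + 1) a c)) (at c)"
proof -
  obtain d where d: "d > 0" "\<And>n y. y \<in> ball c d \<Longrightarrow> d \<le> \<bar>of_int n + y\<bar>" using dist_Ints_pos[OF assms] by blast
  have nz: "of_int n + y \<noteq> 0" if "y \<in> ball c d" for n y using d(1) d(2)[OF that, of n] by auto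
  have nI: "y \<notin> \<int>" if "y \<in> ball c d" for y
    using nz[OF that, of "- \<lfloor>y\<rfloor>"] by (auto elim!: Ints_cases)
  let ?t = "\<lambda>v j c n. ee (of_int n * a) * of_real (of_int n + c) ^ j * uGamma v (pi * (of_int n + c)\<^sup>2)"
  define K where "K = exp ((\<bar>Re (v + 1)\<bar> + 1)\<^sup>2 / (pi * d\<^sup>2)) * (2 * exp (1 / (pi / 2) + (\<bar>c\<bar> + d)))"
  have b: "norm (?t (v + 1) j y n) \<le> K * int_decay n" if "j \<le> 2" "y \<in> ball c d" for j y n
    unfolding K_def by (rule latG_term_bound[OF d(1) d(2)[OF that(2)] _ that(1)]) (use that(2) in \<open>auto simp: dist_real_def\<close>)
  have "((\<lambda>c. isum (?t v 0 c)) has_vector_derivative isum (\<lambda>n. - (2 * pi) * ?t (v + 1) 1 c n)) (at c)"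
  proof (rule isum_has_vector_derivative[of "ball c d"])
    show "isummable (?t v 0 x)" if "x \<in> ball c d" for x by (rule latG_summable) (use nI[OF that] in auto)
    show "((\<lambda>c. ?t v 0 c n) has_vector_derivative - (2 * pi) * ?t (v + 1) 1 x n) (at x)" if "x \<in> ball c d" for x n
      unfolding power_0 mult_1_right
      by (rule has_vector_derivative_eq_rhs[OF has_vector_derivative_mult_right[OF uGamma_square_deriv[OF nz[OF that]]]]) simp
    show "norm (- (2 * pi) * ?t (v + 1) 1 x n) \<le> (2 * pi * K) * int_decay n" if "x \<in> ball c d" for x n
      using mult_left_mono[OF b[OF _ that, of 1 n], of "2 * pi"] by (simp add: norm_mult mult.assoc)
  qed (use d in auto)
  then show ?thesis by (simp add: latG_def)
qed

text \<open>The product rule produces a second moment, which \<open>latG_two\<close> trades for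
  \<open>latG 0\<close> and a Gaussian sum. That sum disappears only after adding the dual
  half.\<close>

lemma latG_one_deriv_snd:
  assumes "c \<notin> \<int>"
  shows "((\<lambda>c. latG 1 v a c) has_vector_derivative (1 - 2 * v) * latG 0 v a c - 2 * gauss_sum a c) (at c)"
proof -
  obtain d where d: "d > 0" "\<And>n y. y \<in> ball c d \<Longrightarrow> d \<le> \<bar>of_int n + y\<bar>" using dist_Ints_pos[OF assms] by blast
  have nz: "of_int n + y \<noteq> 0" if "y \<in> ball c d" for n y using d(1) d(2)[OF that, of n] by auto
  have nI: "y \<notin> \<int>" if "y \<in> ball c d" for y
    using nz[OF that, of "- \<lfloor>y\<rfloor>"] by (auto elim!: Ints_cases)
  let ?t = "\<lambda>v j c n. ee (of_int n * a) * of_real (of_int n + c) ^ j * uGamma v (pi * (of_int n + c)\<^sup>2)"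
  define K where "K = (\<lambda>v. exp ((\<bar>Re v\<bar> + 1)\<^sup>2 / (pi * d\<^sup>2)) * (2 * exp (1 / (pi / 2) + (\<bar>c\<bar> + d))))"
  have b: "norm (?t w j y n) \<le> K w * int_decay n" if "j \<le> 2" "y \<in> ball c d" for j y n w
    unfolding K_def by (rule latG_term_bound[OF d(1) d(2)[OF that(2)] _ that(1)]) (use that(2) in \<open>auto simp: dist_real_def\<close>)
  have "((\<lambda>c. isum (?t v 1 c)) has_vector_derivative isum (\<lambda>n. ?t v 0 c n - 2 * pi * ?t (v + 1) 2 c n)) (at c)"
  proof (rule isum_has_vector_derivative[of "ball c d"])
    show "isummable (?t v 1 x)" if "x \<in> ball c d" for x by (rule latG_summable) (use nI[OF that] in auto)
    show "((\<lambda>c. ?t v 1 c n) has_vector_derivative ?t v 0 x n - 2 * pi * ?t (v + 1) 2 x n) (at x)" if "x \<in> ball c d" for x n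
    proof -
      have "((\<lambda>c. complex_of_real (of_int n + c)) has_vector_derivative of_real 1) (at x)"
        by (rule has_vector_derivative_of_real) (auto intro!: derivative_eq_intros)
      from has_vector_derivative_mult_right[OF has_vector_derivative_mult[OF this uGamma_square_deriv[OF nz[OF that, of n], of v]], of "ee (of_int n * a)"]
      show ?thesis by (simp add: algebra_simps power2_eq_square)
    qed
    show "norm (?t v 0 x n - 2 * pi * ?t (v + 1) 2 x n) \<le> (K v + 2 * pi * K (v + 1)) * int_decay n" if "x \<in> ball c d" for x n
    proof -
      have "norm (?t v 0 x n - 2 * pi * ?t (v + 1) 2 x n) \<le> norm (?t v 0 x n) + 2 * pi * norm (?t (v + 1) 2 x n)"
        using norm_triangle_ineq4[of "?t v 0 x n" "2 * pi * ?t (v + 1) 2 x n"] by (simp add: norm_mult)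
      also have "\<dots> \<le> K v * int_decay n + 2 * pi * (K (v + 1) * int_decay n)"
        by (intro add_mono mult_left_mono b that) auto
      finally show ?thesis by (simp add: algebra_simps)
    qed
  qed (use d in auto)
  moreover have "isum (\<lambda>n. ?t v 0 c n - 2 * pi * ?t (v + 1) 2 c n) = latG 0 v a c - 2 * (pi * latG 2 (v + 1) a c)"
  proof -
    have i0: "isummable (?t v 0 c)" by (rule latG_summable[OF assms]) simp
    have i2: "isummable (\<lambda>n. 2 * pi * ?t (v + 1) 2 c n)" by (intro integrable_mult_right latG_summable[OF assms]) simp
    show ?thesis unfolding latG_def Bochner_Integration.integral_diff[OF i0 i2] by simp
  qed
  then have "isum (\<lambda>n. ?t v 0 c n - 2 * pi * ?t (v + 1) 2 c n) = (1 - 2 * v) * latG 0 v a c - 2 * gauss_sum a c"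
    unfolding latG_two[OF assms] by (simp only:) (simp add: algebra_simps)
  ultimately show ?thesis unfolding latG_def[of 1] by (simp only:)
qed

text \<open>For k = 0 this is Gamma_R(s) L^+(s, a, c) and for k = 1 it is Gamma_R(s + 1) L^-(s, a, c),
  for a and c outside the integers; at integers the value is junk.\<close>

definition Lambda :: "nat \<Rightarrow> complex \<Rightarrow> real \<Rightarrow> real \<Rightarrow> complex" where
  "Lambda k s a c = latG k ((s + of_nat k) / 2) a c + \<i> ^ k * ee (- (a * c)) * latG k ((1 - s + of_nat k) / 2) (- c) a"

section \<open>Symmetries and derivatives of the completed functions\<close>

lemma Lambda_holomorphic:
  assumes "a \<notin> \<int>" "c \<notin> \<int>" "k \<le> 1"
  shows "(\<lambda>s. Lambda k s a c) holomorphic_on UNIV"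
proof -
  have h1: "(\<lambda>s. (s + of_nat k) / 2) holomorphic_on UNIV"
    by (intro holomorphic_on_divide holomorphic_on_add holomorphic_on_ident holomorphic_on_const) simp
  have h2: "(\<lambda>s. (1 - s + of_nat k) / 2) holomorphic_on UNIV"
    by (intro holomorphic_on_divide holomorphic_on_add holomorphic_on_diff holomorphic_on_ident holomorphic_on_const) simp
  have "(\<lambda>s. latG k ((s + of_nat k) / 2) a c) holomorphic_on UNIV"
    using holomorphic_on_compose_gen[OF h1 latG_holomorphic[of c k a]] assms by (simp add: o_def)
  moreover have "(\<lambda>s. latG k ((1 - s + of_nat k) / 2) (- c) a) holomorphic_on UNIV"
    using holomorphic_on_compose_gen[OF h2 latG_holomorphic[of a k "- c"]] assms by (simp add: o_def)
  ultimately show ?thesis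
    unfolding Lambda_def by (intro holomorphic_on_add holomorphic_on_mult holomorphic_on_const)
qed

lemma latG_reflect': "latG k v (1 + a) (1 - c) = (-1) ^ k * ee (- a) * latG k v (- a) c"
  using latG_reflect[of k v "- a" c] by simp

lemma latG_periodic_1: "latG k v (1 + a) c = latG k v a c" "latG k v (a - 1) c = latG k v a c"
  using latG_periodic[of k v a 1 c] latG_periodic[of k v a "-1" c] by (simp_all add: add.commute)

text \<open>Periodicity replaces 1 - c by - c in the first sum, reflection brings the second back to
  (a, c), and the phases cancel. Taking out the common factor uses (- i)^k i^k = 1.\<close>

lemma Lambda_fourier_symmetry: "ee (- (a * c)) * Lambda k s (1 - c) a = (- \<i>) ^ k * Lambda k (1 - s) a c"
proof -
  have 1: "latG k v (1 - c) a = latG k v (- c) a" for v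
    using latG_periodic_1(1)[of k v "- c"] by simp
  have 2: "latG k v (- a) (1 - c) = (-1) ^ k * ee a * latG k v a c" for v
    using latG_reflect[of k v a c] latG_periodic_1(1)[of k v "- a"] by simp
  have 3: "ee (- (a * c)) * (ee (- ((1 - c) * a)) * ee a) = 1"
    by (simp flip: ee_add add: algebra_simps)
  have 4: "(- \<i>) ^ k * \<i> ^ k = (1::complex)" by (simp flip: power_mult_distrib)
  have 5: "\<i> ^ k * (-1) ^ k = (- \<i>) ^ k" by (simp flip: power_mult_distrib)
  have "ee (- (a * c)) * Lambda k s (1 - c) a = ee (- (a * c)) * latG k ((s + of_nat k) / 2) (- c) a +
    (\<i> ^ k * (-1) ^ k) * (ee (- (a * c)) * (ee (- ((1 - c) * a)) * ee a)) * latG k ((1 - s + of_nat k) / 2) a c"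
    unfolding Lambda_def 1 2 by (simp only: distrib_left mult_ac)
  also have "\<dots> = ((- \<i>) ^ k * \<i> ^ k) * ee (- (a * c)) * latG k ((s + of_nat k) / 2) (- c) a + (- \<i>) ^ k * latG k ((1 - s + of_nat k) / 2) a c"
    by (simp only: 3 4 5 mult_1_right mult_1_left)
  also have "\<dots> = (- \<i>) ^ k * Lambda k (1 - s) a c"
    by (simp add: Lambda_def algebra_simps)
  finally show ?thesis .
qed

lemma Lambda_reflect: "ee (- a) * Lambda k s (1 - a) (1 - c) = (-1) ^ k * Lambda k s a c"
proof -
  have 1: "latG k v (- (1 - c)) (1 - a) = (-1) ^ k * ee (- c) * latG k v (- c) a" for v
    using latG_reflect'[of k v c a] latG_periodic_1[of k v c "1 - a"] by simp
  have 2: "ee (- a) * ee a = 1" by (simp flip: ee_add)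
  \<comment> \<open>The exponents match only up to the integer 1, which \<open>ee\<close> does not
    see.\<close>
  have "- a + (- ((1 - a) * (1 - c)) + - c) = - (a * c) - of_int 1" by (simp add: algebra_simps)
  then have "ee (- a) * (ee (- ((1 - a) * (1 - c))) * ee (- c)) = ee (- (a * c) - of_int 1)"
    by (simp only: ee_add[symmetric])
  also have "\<dots> = ee (- (a * c))" unfolding ee_diff ee_of_int by simp
  finally have 3: "ee (- a) * (ee (- ((1 - a) * (1 - c))) * ee (- c)) = ee (- (a * c))" .
  have "ee (- a) * Lambda k s (1 - a) (1 - c) = (-1) ^ k * ((ee (- a) * ee a) * latG k ((s + of_nat k) / 2) a c +
     \<i> ^ k * (ee (- a) * (ee (- ((1 - a) * (1 - c))) * ee (- c))) * latG k ((1 - s + of_nat k) / 2) (- c) a)"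
    unfolding Lambda_def latG_reflect 1 by (simp only: distrib_left mult_ac)
  then show ?thesis by (simp only: 2 3 mult_1_left Lambda_def)
qed

text \<open>Differentiating the prefactor cancels the term in \<open>a\<close> coming from n = (n +
  a) - a, so that d/dc merely raises the moment of the dual sum by one.\<close>

lemma ee_lat_gamma_deriv:
  assumes "a \<notin> \<int>" "k \<le> 1"
  shows "((\<lambda>c. ee (- (a * c)) * latG k v (- c) a) has_vector_derivative - (2 * pi * \<i>) * (ee (- (a * c)) * latG (Suc k) v (- c) a)) (at c)"
proof -
  have 1: "((\<lambda>c. ee (- (a * c))) has_vector_derivative (2 * pi * \<i> * - a * ee (- (a * c)))) (at c)"
    using ee_has_vector_derivative[of "\<lambda>c. - (a * c)" "- a" c UNIV] by (auto intro!: derivative_eq_intros)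
  have "((\<lambda>c. - c) has_vector_derivative - 1) (at c)"
    by (auto intro!: derivative_eq_intros)
  from vector_diff_chain_at[OF this latG_deriv_fst[OF assms]]
  have 2: "((\<lambda>c. latG k v (- c) a) has_vector_derivative - (2 * pi * \<i> * (latG (Suc k) v (- c) a - a * latG k v (- c) a))) (at c)"
    by (simp add: o_def)
  show ?thesis
    by (rule has_vector_derivative_eq_rhs[OF has_vector_derivative_mult[OF 1 2]]) (simp add: algebra_simps)
qed

lemma Lambda_zero_deriv:
  assumes "a \<notin> \<int>" "c \<notin> \<int>"
  shows "((\<lambda>c. Lambda 0 s a c) has_vector_derivative - (2 * pi) * Lambda 1 (s + 1) a c) (at c)"
proof -
  \<comment> \<open>Raising s and k together by 1 shifts the first gamma parameter by 1 and fixes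
    the second, exactly the effect of d/dc on the two sums.\<close>
  have e: "(s + 1 + of_nat 1) / 2 = s / 2 + 1" "(1 - (s + 1) + of_nat 1) / 2 = (1 - s) / 2"
    by (simp_all add: add_divide_distrib diff_divide_distrib)
  have f: "Lambda 0 s a c = latG 0 (s / 2) a c + ee (- (a * c)) * latG 0 ((1 - s) / 2) (- c) a" for c
    by (simp add: Lambda_def)
  note d = has_vector_derivative_add[OF latG_zero_deriv_snd[OF assms(2), of "s / 2" a] ee_lat_gamma_deriv[OF assms(1), of 0 "(1 - s) / 2" c]]
  show ?thesis
    unfolding f Lambda_def[of 1] e
    by (rule has_vector_derivative_eq_rhs[OF d]) (simp_all add: algebra_simps)
qed

text \<open>The derivative of the first sum and the second moment of the dual sum each leave twice a
  Gaussian sum; \<open>gauss_sum_inversion\<close> shows that these are equal, and they enter with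
  opposite signs.\<close>

lemma Lambda_one_deriv:
  assumes "a \<notin> \<int>" "c \<notin> \<int>"
  shows "((\<lambda>c. Lambda 1 s a c) has_vector_derivative - s * Lambda 0 (s + 1) a c) (at c)"
proof -
  have "((\<lambda>c. latG 1 ((s + 1) / 2) a c + \<i> * (ee (- (a * c)) * latG 1 ((1 - s + 1) / 2) (- c) a)) has_vector_derivative
     ((1 - 2 * ((s + 1) / 2)) * latG 0 ((s + 1) / 2) a c - 2 * gauss_sum a c) +
     \<i> * (- (2 * pi * \<i>) * (ee (- (a * c)) * latG (Suc 1) ((1 - s + 1) / 2) (- c) a))) (at c)"
    by (intro has_vector_derivative_add has_vector_derivative_mult_right latG_one_deriv_snd ee_lat_gamma_deriv assms) simp
  moreover have "((1 - 2 * ((s + 1) / 2)) * latG 0 ((s + 1) / 2) a c - 2 * gauss_sum a c) +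
     \<i> * (- (2 * pi * \<i>) * (ee (- (a * c)) * latG (Suc 1) ((1 - s + 1) / 2) (- c) a)) = - s * Lambda 0 (s + 1) a c"
  proof -
    have e: "(1 - s + 1) / 2 = - s / 2 + 1" by (simp add: field_simps)
    have "pi * latG (Suc 1) ((1 - s + 1) / 2) (- c) a = gauss_sum (- c) a + (- s / 2) * latG 0 (- s / 2) (- c) a"
      unfolding e using latG_two[OF assms(1), of "- s / 2" "- c"] by (simp add: numeral_2_eq_2)
    then have "2 * ee (- (a * c)) * (pi * latG (Suc 1) ((1 - s + 1) / 2) (- c) a) =
        2 * ee (- (a * c)) * (gauss_sum (- c) a + (- s / 2) * latG 0 (- s / 2) (- c) a)"
      by (simp only:)
    also have "\<dots> = 2 * (ee (- (a * c)) * gauss_sum (- c) a) - s * (ee (- (a * c)) * latG 0 (- s / 2) (- c) a)"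
      by (simp add: algebra_simps)
    also have "ee (- (a * c)) * gauss_sum (- c) a = gauss_sum a c" by (rule gauss_sum_inversion[symmetric])
    finally have "2 * ee (- (a * c)) * (pi * latG (Suc 1) ((1 - s + 1) / 2) (- c) a) =
        2 * gauss_sum a c - s * (ee (- (a * c)) * latG 0 (- s / 2) (- c) a)" .
    moreover have "\<i> * (- (2 * pi * \<i>) * (ee (- (a * c)) * latG (Suc 1) ((1 - s + 1) / 2) (- c) a)) =
       2 * ee (- (a * c)) * (pi * latG (Suc 1) ((1 - s + 1) / 2) (- c) a)"
      by (simp add: algebra_simps)
    moreover have "1 - 2 * ((s + 1) / 2) = - s" by (simp add: field_simps)
    moreover have "(1 - (s + 1) + of_nat 0) / 2 = - s / 2" "(s + 1 + of_nat 0) / 2 = (s + 1) / 2" by simp_all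
    ultimately show ?thesis unfolding Lambda_def by (simp add: algebra_simps)
  qed
  ultimately show ?thesis unfolding Lambda_def by (simp only: of_nat_1 power_one_right mult.assoc)
qed

section \<open>The completed functions as limits of symmetric partial sums\<close>

lemma integrable_restrict_space_posm:
  fixes f :: "real \<Rightarrow> 'a::{banach,second_countable_topology}"
  shows "integrable posm f \<longleftrightarrow> integrable lborel (\<lambda>u. indicat_real {0<..} u *\<^sub>R f u)"
  by (rule integrable_restrict_space) simp

lemma exp_minus_posm_scaled:
  assumes "r > 0"
  shows "integrable posm (\<lambda>u. exp (- (r * u)))"
proof -
  define f where "f = (\<lambda>u::real. indicat_real {0<..} u *\<^sub>R exp (- u))"
  have "integrable lborel f"
    using exp_minus_posm(1) unfolding f_def integrable_restrict_space_posm .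
  then have "integrable lborel (\<lambda>u. f (0 + r * u))"
    by (rule lborel_integrable_real_affine) (use assms in simp)
  moreover have "(\<lambda>u. f (0 + r * u)) = (\<lambda>u. indicat_real {0<..} u *\<^sub>R exp (- (r * u)))"
    using assms by (auto simp: f_def indicator_def fun_eq_iff zero_less_mult_iff)
  ultimately show ?thesis by (simp only: integrable_restrict_space_posm)
qed

text \<open>Puts the sum inside the Mellin integral, the form in which the dual half arises from
  theta inversion on t < 1.\<close>

lemma latG_eq_integral:
  assumes a: "a \<notin> \<int>" and k: "k \<le> 1"
  shows "latG k w c a = (\<integral>u. isum (\<lambda>n. ee (of_int n * c) * of_real (of_int n + a) ^ k * exp (w * of_real u - of_real (pi * (of_int n + a)\<^sup>2 * exp u))) \<partial>posm)"
proof -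
  obtain d where d: "d > 0" "\<And>n::int. d \<le> \<bar>of_int n + a\<bar>" using dist_Ints_pos[OF a] by auto
  define X where "X = (\<lambda>n::int. pi * (of_int n + a)\<^sup>2)"
  have X: "0 < pi * d\<^sup>2" "pi * d\<^sup>2 \<le> X n" for n
    using d(1) d(2)[of n] abs_le_square_iff[of d "of_int n + a"] unfolding X_def by auto
  have X0: "X n > 0" for n using X(1) X(2)[of n] by linarith
  let ?f = "\<lambda>n u. ee (of_int n * c) * of_real (of_int n + a) ^ k * exp (w * of_real u - of_real (X n * exp u))"
  define K where "K = exp ((\<bar>Re w\<bar> + 1)\<^sup>2 / (pi * d\<^sup>2)) * (2 * exp (1 / (pi / 2) + \<bar>a\<bar>))"
  have b: "norm (?f n u) \<le> (K * exp (- u)) * int_decay n" if "u > 0" for n u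
  proof -
    have "norm (?f n u) = \<bar>of_int n + a\<bar> ^ k * norm (exp (w * of_real u - of_real (X n * exp u)))"
      by (simp only: norm_mult norm_power norm_of_real norm_ee mult_1_left)
    also have "\<dots> \<le> \<bar>of_int n + a\<bar> ^ k * (exp ((\<bar>Re w\<bar> + 1)\<^sup>2 / (pi * d\<^sup>2)) * exp (- X n / 2) * exp (- u))"
      using that by (intro mult_left_mono uGamma_kernel_bound X) auto
    also have "\<dots> = exp ((\<bar>Re w\<bar> + 1)\<^sup>2 / (pi * d\<^sup>2)) * exp (- u) * (\<bar>of_int n + a\<bar> ^ k * exp (- (pi / 2 * (of_int n + a)\<^sup>2)))"
      by (simp add: X_def)
    also have "\<dots> \<le> exp ((\<bar>Re w\<bar> + 1)\<^sup>2 / (pi * d\<^sup>2)) * exp (- u) * (2 * exp (1 / (pi / 2) + \<bar>a\<bar>) * int_decay n)"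
      using k by (intro mult_left_mono gauss_bound) auto
    finally show ?thesis by (simp add: K_def mult_ac)
  qed
  have "(\<integral>u. isum (\<lambda>n. ?f n u) \<partial>posm) = isum (\<lambda>n. \<integral>u. ?f n u \<partial>posm)"
  proof (rule isum_integral_swap(1))
    show "integrable posm (?f n)" for n
      by (intro integrable_mult_right uGamma_integrable X0)
    show "isummable (\<lambda>n. ?f n u)" if "u \<in> space posm" for u
      by (rule isummable_bound[OF b]) (use that in simp)
    show "norm (\<Sum>n\<in>{- int N..int N}. ?f n u) \<le> K * exp (- u) * isum int_decay" if "u \<in> space posm" for N u
      by (rule norm_sum_le_isum_exp[OF b]) (use that in auto)
    show "integrable posm (\<lambda>u. K * exp (- u) * isum int_decay)"
      using exp_minus_posm by simp
    have "isummable (\<lambda>n. ee (of_int n * c) * of_real (of_int n + a) ^ k * uGamma w (pi * (of_int n + a)\<^sup>2))"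
      by (rule latG_summable[OF a]) (use k in simp)
    then show "isummable (\<lambda>n. \<integral>u. ?f n u \<partial>posm)"
      by (simp only: uGamma_def integral_mult_right_zero X_def)
  qed
  also have "\<dots> = latG k w c a"
    unfolding latG_def by (simp only: uGamma_def integral_mult_right_zero X_def)
  finally show ?thesis by (simp only: X_def)
qed

text \<open>\<open>Gamma_split_uGamma\<close> cuts every summand at t = 1. The parts over t > 1 sum
  absolutely to the first half of \<open>Lambda\<close>. The parts over t < 1 combine to the Mellin
  integral of a finite theta sum; its limit is taken by dominated convergence and rewritten by
  \<open>theta_inversion\<close>, which also covers the conditionally convergent range 0 < Re z <=
  1.\<close>

theorem Lambda_partial_sums:
  assumes a: "a \<notin> \<int>" and c: "c \<notin> \<int>" and k: "k \<le> 1" and z: "Re z > 0"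
  defines "v \<equiv> (z + of_nat k) / 2"
  shows "(\<lambda>N. Gamma v * (\<Sum>n\<in>{- int N..int N}. ee (of_int n * a) * of_real (of_int n + c) ^ k *
      exp (- (v * of_real (ln (pi * (of_int n + c)\<^sup>2)))))) \<longlonglongrightarrow> Lambda k z a c"
proof -
  have Rv: "Re v = (Re z + real k) / 2" by (simp add: v_def)
  have v: "Re v > 0" using z by (simp add: Rv)
  have X0: "pi * (of_int n + c)\<^sup>2 > 0" for n
    using of_int_add_nonzero[OF c, of n] by simp
  let ?co = "\<lambda>n. ee (of_int n * a) * of_real (of_int n + c) ^ k"
  \<comment> \<open>The finite theta sum at parameter t = exp (- u). Its bound comes from
    \<open>twisted_gauss_sum_bound\<close>, uniformly in N.\<close>
  define T where "T = (\<lambda>N t. \<Sum>n\<in>{- int N..int N}. ?co n * of_real (exp (- (pi * t * (of_int n + c)\<^sup>2))))"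
  obtain C where C: "\<And>N t. 0 < t \<Longrightarrow> t \<le> 1 \<Longrightarrow> norm (T N t) \<le> C / sqrt t ^ k"
    using twisted_gauss_sum_bound[OF a k, of c] unfolding T_def by blast
  have "Gamma v * (\<Sum>n\<in>{- int N..int N}. ?co n * exp (- (v * of_real (ln (pi * (of_int n + c)\<^sup>2))))) =
    (\<Sum>n\<in>{- int N..int N}. ?co n * uGamma v (pi * (of_int n + c)\<^sup>2)) + (\<integral>u. exp (- (v * of_real u)) * T N (exp (- u)) \<partial>posm)" for N
  proof -
    have "Gamma v * (\<Sum>n\<in>{- int N..int N}. ?co n * exp (- (v * of_real (ln (pi * (of_int n + c)\<^sup>2))))) =
      (\<Sum>n\<in>{- int N..int N}. ?co n * (Gamma v * exp (- (v * of_real (ln (pi * (of_int n + c)\<^sup>2))))))"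
      by (simp only: sum_distrib_left mult_ac)
    also have "\<dots> = (\<Sum>n\<in>{- int N..int N}. ?co n * uGamma v (pi * (of_int n + c)\<^sup>2)) +
        (\<Sum>n\<in>{- int N..int N}. (\<integral>u. ?co n * exp (- (v * of_real u) - of_real (pi * (of_int n + c)\<^sup>2 * exp (- u))) \<partial>posm))"
      by (simp only: Gamma_split_uGamma(1)[OF X0 v] distrib_left sum.distrib integral_mult_right_zero)
    also have "(\<Sum>n\<in>{- int N..int N}. (\<integral>u. ?co n * exp (- (v * of_real u) - of_real (pi * (of_int n + c)\<^sup>2 * exp (- u))) \<partial>posm)) =
       (\<integral>u. (\<Sum>n\<in>{- int N..int N}. ?co n * exp (- (v * of_real u) - of_real (pi * (of_int n + c)\<^sup>2 * exp (- u)))) \<partial>posm)"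
      by (rule Bochner_Integration.integral_sum[symmetric]) (intro integrable_mult_right Gamma_split_uGamma(2)[OF X0 v])
    also have "\<dots> = (\<integral>u. exp (- (v * of_real u)) * T N (exp (- u)) \<partial>posm)"
    proof (rule Bochner_Integration.integral_cong[OF refl])
      fix u
      have "exp (- (v * of_real u) - of_real (pi * (of_int n + c)\<^sup>2 * exp (- u))) =
         exp (- (v * of_real u)) * of_real (exp (- (pi * exp (- u) * (of_int n + c)\<^sup>2)))" for n
        unfolding exp_of_real[symmetric] exp_add[symmetric] by (rule arg_cong[of _ _ exp]) (simp add: mult_ac)
      then show "(\<Sum>n\<in>{- int N..int N}. ?co n * exp (- (v * of_real u) - of_real (pi * (of_int n + c)\<^sup>2 * exp (- u)))) = exp (- (v * of_real u)) * T N (exp (- u))"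
        by (simp only: T_def sum_distrib_left mult_ac)
    qed
    finally show ?thesis .
  qed
  moreover have "(\<lambda>N. \<Sum>n\<in>{- int N..int N}. ?co n * uGamma v (pi * (of_int n + c)\<^sup>2)) \<longlonglongrightarrow> latG k v a c"
    unfolding latG_def by (rule isum_partial_sums[OF latG_summable[OF c]]) (use k in simp)
  moreover have "(\<lambda>N. \<integral>u. exp (- (v * of_real u)) * T N (exp (- u)) \<partial>posm) \<longlonglongrightarrow>
     \<i> ^ k * ee (- (a * c)) * latG k ((1 - z + of_nat k) / 2) (- c) a"
  proof -
    define w where "w = (1 - z + of_nat k) / 2"
    let ?S = "\<lambda>u. isum (\<lambda>n. ee (of_int n * (- c)) * of_real (of_int n + a) ^ k * exp (w * of_real u - of_real (pi * (of_int n + a)\<^sup>2 * exp u)))"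
    have lim: "(\<lambda>N. exp (- (v * of_real u)) * T N (exp (- u))) \<longlonglongrightarrow> \<i> ^ k * ee (- (a * c)) * ?S u" for u
    proof -
      have b: "norm (?co n * of_real (exp (- (pi * exp (- u) * (of_int n + c)\<^sup>2)))) \<le> (2 * exp (1 / (pi * exp (- u)) + \<bar>c\<bar>)) * int_decay n" for n
        by (rule theta_term_bound) (use k in auto)
      have "(\<lambda>N. T N (exp (- u))) \<longlonglongrightarrow> isum (\<lambda>n. ?co n * of_real (exp (- (pi * exp (- u) * (of_int n + c)\<^sup>2))))"
        unfolding T_def by (rule isum_partial_sums[OF isummable_bound[OF b]])
      also have "isum (\<lambda>n. ?co n * of_real (exp (- (pi * exp (- u) * (of_int n + c)\<^sup>2)))) = ee (- (a * c)) * theta k (exp (- u)) a c"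
      proof -
        have "ee (of_int n * a) = ee (- (a * c)) * ee ((of_int n + c) * a)" for n
          by (simp flip: ee_add add: algebra_simps)
        then show ?thesis unfolding theta_def by (simp only: integral_mult_right_zero[symmetric] mult.assoc)
      qed
      also have "theta k (exp (- u)) a c = \<i> ^ k / (exp (- u) ^ k * sqrt (exp (- u))) *
          isum (\<lambda>n. ee (- (of_int n * c)) * of_real (of_int n + a) ^ k * exp (- (pi / exp (- u) * (of_int n + a)\<^sup>2)))"
        using theta_inversion[of "exp (- u)" k a c] k by simp
      finally have "(\<lambda>N. exp (- (v * of_real u)) * T N (exp (- u))) \<longlonglongrightarrow> exp (- (v * of_real u)) * (ee (- (a * c)) * (\<i> ^ k / (exp (- u) ^ k * sqrt (exp (- u))) *
          isum (\<lambda>n. ee (- (of_int n * c)) * of_real (of_int n + a) ^ k * exp (- (pi / exp (- u) * (of_int n + a)\<^sup>2)))))"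
        by (intro tendsto_mult tendsto_const)
      also have "exp (- (v * of_real u)) * (ee (- (a * c)) * (\<i> ^ k / (exp (- u) ^ k * sqrt (exp (- u))) *
          isum (\<lambda>n. ee (- (of_int n * c)) * of_real (of_int n + a) ^ k * exp (- (pi / exp (- u) * (of_int n + a)\<^sup>2))))) =
          \<i> ^ k * ee (- (a * c)) * isum (\<lambda>n. (exp (- (v * of_real u)) / (exp (- u) ^ k * sqrt (exp (- u)))) *
            (ee (- (of_int n * c)) * of_real (of_int n + a) ^ k * exp (- (pi / exp (- u) * (of_int n + a)\<^sup>2))))"
        unfolding integral_mult_right_zero by simp
      also have "(\<lambda>n. (exp (- (v * of_real u)) / (exp (- u) ^ k * sqrt (exp (- u)))) *
            (ee (- (of_int n * c)) * of_real (of_int n + a) ^ k * exp (- (pi / exp (- u) * (of_int n + a)\<^sup>2)))) =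
          (\<lambda>n. ee (of_int n * (- c)) * of_real (of_int n + a) ^ k * exp (w * of_real u - of_real (pi * (of_int n + a)\<^sup>2 * exp u)))"
      proof
        fix n
        have "sqrt (exp (- u)) = exp (- u / 2)"
          by (rule real_sqrt_unique) (simp_all flip: exp_of_nat_mult)
        then have "exp (- u) ^ k * sqrt (exp (- u)) = exp (- (of_nat k + 1 / 2) * u)"
          by (simp flip: exp_of_nat_mult exp_add add: algebra_simps)
        then have "exp (- (v * of_real u)) / complex_of_real (exp (- u) ^ k * sqrt (exp (- u))) = exp (w * of_real u)"
        proof -
          \<comment> \<open>The weight k + 1/2 of the inversion formula turns the exponent - v into
            k + 1/2 - v = w, the gamma parameter of the dual half.\<close>
          have "- (v * of_real u) - complex_of_real (- (of_nat k + 1 / 2) * u) = w * of_real u"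
            by (simp add: w_def v_def add_divide_distrib diff_divide_distrib algebra_simps)
          then show ?thesis
            unfolding \<open>exp (- u) ^ k * sqrt (exp (- u)) = _\<close> exp_of_real[symmetric] exp_diff[symmetric] by (rule arg_cong)
        qed
        moreover have "complex_of_real (exp (- (pi / exp (- u) * (of_int n + a)\<^sup>2))) = exp (- of_real (pi * (of_int n + a)\<^sup>2 * exp u))"
          unfolding exp_of_real[symmetric] by (simp add: exp_minus mult_ac field_simps)
        moreover have "exp (w * of_real u - of_real (pi * (of_int n + a)\<^sup>2 * exp u)) = exp (w * of_real u) * exp (- of_real (pi * (of_int n + a)\<^sup>2 * exp u))"
          by (simp flip: exp_add)
        ultimately show "(exp (- (v * of_real u)) / (exp (- u) ^ k * sqrt (exp (- u)))) *
            (ee (- (of_int n * c)) * of_real (of_int n + a) ^ k * exp (- (pi / exp (- u) * (of_int n + a)\<^sup>2))) =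
          ee (of_int n * (- c)) * of_real (of_int n + a) ^ k * exp (w * of_real u - of_real (pi * (of_int n + a)\<^sup>2 * exp u))"
          by (simp only: mult_minus_right mult_minus_left mult_ac)
      qed
      finally show ?thesis .
    qed
    have meas: "(\<lambda>u. exp (- (v * of_real u)) * T N (exp (- u))) \<in> borel_measurable posm" for N
      unfolding T_def by (intro measurable_restrict_space1) measurable
    have "(\<lambda>N. \<integral>u. exp (- (v * of_real u)) * T N (exp (- u)) \<partial>posm) \<longlonglongrightarrow> (\<integral>u. \<i> ^ k * ee (- (a * c)) * ?S u \<partial>posm)"
    \<comment> \<open>With t = exp (- u) the bound C / sqrt t ^ k costs exp (k u / 2), and Re v - k
      / 2 = Re z / 2 is still positive.\<close>
    proof (rule integral_dominated_convergence[where w="\<lambda>u. C * exp (- (Re z / 2 * u))"])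
      show "(\<lambda>u. \<i> ^ k * ee (- (a * c)) * ?S u) \<in> borel_measurable posm"
        by (rule borel_measurable_LIMSEQ_metric[OF meas lim])
      show "integrable posm (\<lambda>u. C * exp (- (Re z / 2 * u)))"
        using exp_minus_posm_scaled[of "Re z / 2"] z by simp
      show "AE u in posm. norm (exp (- (v * of_real u)) * T N (exp (- u))) \<le> C * exp (- (Re z / 2 * u))" for N
      proof (rule AE_I2)
        fix u assume "u \<in> space posm"
        then have u: "u > 0" by simp
        have "norm (exp (- (v * of_real u)) * T N (exp (- u))) = exp (- (Re v * u)) * norm (T N (exp (- u)))"
          by (simp add: norm_mult)
        also have "\<dots> \<le> exp (- (Re v * u)) * (C / sqrt (exp (- u)) ^ k)"
          using u by (intro mult_left_mono C) auto
        also have "sqrt (exp (- u)) = exp (- u / 2)"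
          by (rule real_sqrt_unique) (simp_all flip: exp_of_nat_mult)
        also have "exp (- (Re v * u)) * (C / exp (- u / 2) ^ k) = C * exp (- (Re z / 2 * u))"
        proof -
          have "exp (- u / 2) ^ k = exp (- (real k * u / 2))"
            by (simp flip: exp_of_nat_mult)
          moreover have "- (Re v * u) = - (Re z / 2 * u) + - (real k * u / 2)"
            by (simp add: Rv algebra_simps add_divide_distrib)
          then have "exp (- (Re v * u)) = exp (- (Re z / 2 * u)) * exp (- (real k * u / 2))"
            by (simp only: exp_add)
          ultimately show ?thesis by simp
        qed
        finally show "norm (exp (- (v * of_real u)) * T N (exp (- u))) \<le> C * exp (- (Re z / 2 * u))" .
      qed
    qed (use meas lim in auto)
    then show ?thesis
      unfolding latG_eq_integral[OF a k] w_def by simp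
  qed
  ultimately show ?thesis
    unfolding Lambda_def v_def[symmetric] by (simp only:) (intro tendsto_add)
qed

section \<open>Nonvanishing of the completed functions\<close>

lemma not_Ints_between:
  fixes c :: real
  assumes "0 < c" "c < 1"
  shows "c \<notin> \<int>"
proof
  assume "c \<in> \<int>"
  then obtain n where n: "c = of_int n" by (rule Ints_cases)
  then have "0 < n" "n < 1" using assms by simp_all
  then show False by simp
qed

text \<open>At a = 1/2 and c -> 0+ the term n = 0 of the first sum contains c^k Gamma v (pi c^2)^(-
  v), which is unbounded, while everything else in \<open>Lambda\<close> stays bounded; so
  \<open>Lambda\<close> cannot vanish identically.\<close>

lemma Lambda_nonvanishing_pos:
  assumes k: "k \<le> 1" and s: "Re s > 0"
  shows "\<exists>a c. a \<notin> \<int> \<and> c \<notin> \<int> \<and> Lambda k s a c \<noteq> 0"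
proof (rule ccontr)
  assume "\<not> ?thesis"
  then have zero: "Lambda k s a c = 0" if "a \<notin> \<int>" "c \<notin> \<int>" for a c using that by blast
  define v where "v = (s + of_nat k) / 2"
  define w where "w = (1 - s + of_nat k) / 2"
  have Rv: "Re v = (Re s + real k) / 2" by (simp add: v_def)
  have v: "Re v > 0" using s by (simp add: Rv)
  have half: "(1/2 :: real) \<notin> \<int>" by (rule not_Ints_between) simp_all
  \<comment> \<open>In the dual sum \<open>c\<close> occurs only in phases of modulus 1, so this
    bound is uniform in \<open>c\<close>.\<close>
  define M2 where "M2 = isum (\<lambda>n. norm (of_real (of_int n + 1/2) ^ k * uGamma w (pi * (of_int n + 1/2)\<^sup>2)))"
  have b2: "norm (latG k w c (1/2)) \<le> M2" for c
    unfolding latG_def M2_def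
  proof (rule isum_norm_le)
    have "isummable (\<lambda>n. ee 0 * of_real (of_int n + 1/2) ^ k * uGamma w (pi * (of_int n + 1/2)\<^sup>2))"
      by (rule latG_summable[OF half]) (use k in simp)
    from integrable_norm[OF this]
    show "isummable (\<lambda>n. norm (of_real (of_int n + 1/2) ^ k * uGamma w (pi * (of_int n + 1/2)\<^sup>2)))"
      by (simp only: ee_0 mult_1_left)
  qed (simp only: norm_mult norm_ee mult_1_left order_refl)
  \<comment> \<open>For 0 < c <= 1/2 every n other than 0 satisfies |n + c| >= 1/2; the constant is
    that of \<open>latG_term_bound\<close> with distance and shift bound 1/2.\<close>
  define K where "K = exp ((\<bar>Re v\<bar> + 1)\<^sup>2 / (pi * (1/2)\<^sup>2)) * (2 * exp (1 / (pi / 2) + 1/2))"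
  define M1 where "M1 = K * isum int_decay"
  have b1: "norm (latG k v (1/2) c - of_real c ^ k * uGamma v (pi * c\<^sup>2)) \<le> M1" if c: "0 < c" "c \<le> 1/2" for c
  proof -
    let ?t = "\<lambda>n. ee (of_int n * (1/2)) * of_real (of_int n + c) ^ k * uGamma v (pi * (of_int n + c)\<^sup>2)"
    have nc: "c \<notin> \<int>" using c by (intro not_Ints_between) auto
    have st: "isummable ?t" by (rule latG_summable[OF nc]) (use k in simp)
    have d: "1/2 \<le> \<bar>of_int n + c\<bar>" if "n \<noteq> 0" for n :: int
    proof (cases "n \<ge> 1")
      case True
      then have "real_of_int n \<ge> 1" by simp
      then show ?thesis using c by linarith
    next
      case False
      then have "n \<le> -1" using that by simp
      then have "real_of_int n \<le> of_int (-1)" by (simp only: of_int_le_iff)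
      then show ?thesis using c by simp
    qed
    have "latG k v (1/2) c - isum (\<lambda>n. indicat_real {0} n *\<^sub>R ?t n) = isum (\<lambda>n. ?t n - indicat_real {0} n *\<^sub>R ?t n)"
      unfolding latG_def
      by (rule Bochner_Integration.integral_diff[symmetric, OF st]) (rule integrable_mult_indicator[OF _ st], simp)
    moreover have "isum (\<lambda>n. indicat_real {0} n *\<^sub>R ?t n) = of_real c ^ k * uGamma v (pi * c\<^sup>2)"
      by (subst isum_indicator) auto
    moreover have "norm (isum (\<lambda>n. ?t n - indicat_real {0} n *\<^sub>R ?t n)) \<le> isum (\<lambda>n. K * int_decay n)"
    proof (rule isum_norm_le)
      show "norm (?t n - indicat_real {0} n *\<^sub>R ?t n) \<le> K * int_decay n" for n
      proof (cases "n = 0")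
        case False
        have "norm (?t n) \<le> K * int_decay n"
          unfolding K_def by (rule latG_term_bound[OF _ d[OF False]]) (use c k in auto)
        then show ?thesis using False by simp
      qed (simp add: K_def)
    qed (use isummable_exp in simp)
    ultimately show ?thesis by (simp add: M1_def)
  qed
  \<comment> \<open>Bounds the part of the gamma integral below t = 1, uniformly in x; it measures
    how far \<open>uGamma v x\<close> is from the full Gamma v x powr (- v).\<close>
  define J0 where "J0 = (\<integral>u. exp (- (Re v * u)) \<partial>posm)"
  have bJ: "norm (uGamma v x - Gamma v * exp (- (v * of_real (ln x)))) \<le> J0" if x: "x > 0" for x
  proof -
    let ?j = "\<lambda>u. exp (- (v * of_real u) - of_real (x * exp (- u)))"
    have "norm (uGamma v x - Gamma v * exp (- (v * of_real (ln x)))) = norm (\<integral>u. ?j u \<partial>posm)"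
      unfolding Gamma_split_uGamma(1)[OF x v] by simp
    also have "\<dots> \<le> J0"
      unfolding J0_def
      by (rule norm_integral_le[OF Gamma_split_uGamma(2)[OF x v] exp_minus_posm_scaled[OF v]]) (use x in simp)
    finally show ?thesis .
  qed
  have J0: "J0 \<ge> 0" unfolding J0_def by simp
  define M where "M = M1 + M2 + J0"
  have main: "norm (Gamma v) * (c ^ k * exp (- (Re v * ln (pi * c\<^sup>2)))) \<le> M" if c: "0 < c" "c \<le> 1/2" for c
  proof -
    have nc: "c \<notin> \<int>" using c by (intro not_Ints_between) auto
    have x: "pi * c\<^sup>2 > 0" using c by simp
    have "latG k v (1/2) c = - (\<i> ^ k * ee (- (1/2 * c)) * latG k w (- c) (1/2))"
      using zero[OF half nc] unfolding Lambda_def v_def w_def by (simp add: add_eq_0_iff2)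
    then have "norm (latG k v (1/2) c) \<le> M2"
      using b2[of "- c"] by (simp add: norm_mult norm_power)
    moreover have "norm (of_real c ^ k * uGamma v (pi * c\<^sup>2)) \<le> norm (latG k v (1/2) c) + M1"
      using b1[OF c] norm_triangle_ineq3[of "latG k v (1/2) c" "of_real c ^ k * uGamma v (pi * c\<^sup>2)"] by linarith
    moreover have "norm (of_real c ^ k * (Gamma v * exp (- (v * of_real (ln (pi * c\<^sup>2)))))) \<le> norm (of_real c ^ k * uGamma v (pi * c\<^sup>2)) + J0"
    proof -
      have "norm (of_real c ^ k * uGamma v (pi * c\<^sup>2) - of_real c ^ k * (Gamma v * exp (- (v * of_real (ln (pi * c\<^sup>2)))))) \<le> c ^ k * J0"
        unfolding right_diff_distrib[symmetric] norm_mult using bJ[OF x] c by (simp add: norm_power mult_left_mono)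
      also have "\<dots> \<le> 1 * J0" using c J0 by (intro mult_right_mono power_le_one) auto
      finally show ?thesis
        using norm_triangle_ineq3[of "of_real c ^ k * uGamma v (pi * c\<^sup>2)" "of_real c ^ k * (Gamma v * exp (- (v * of_real (ln (pi * c\<^sup>2)))))"] by linarith
    qed
    ultimately have "norm (of_real c ^ k * (Gamma v * exp (- (v * of_real (ln (pi * c\<^sup>2)))))) \<le> M" by (simp add: M_def)
    then show ?thesis using c by (simp add: norm_mult norm_power mult_ac)
  qed
  define A where "A = norm (Gamma v) * exp (- (Re v * ln pi))"
  have "Gamma v \<noteq> 0" using v by (auto simp: Gamma_eq_zero_iff elim!: nonpos_Ints_cases)
  then have A: "A > 0" by (simp add: A_def)
  \<comment> \<open>With c = exp (- m) the exponent is 2 Re v - k = Re s per unit of m; m >= 1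
    guarantees c <= 1/2.\<close>
  have grow: "A * exp (Re s * m) \<le> M" if m: "m \<ge> 1" for m
  proof -
    have "exp (1::real) \<ge> 2" using exp_ge_add_one_self[of 1] by simp
    then have "exp (- 1::real) \<le> 1/2" by (simp add: exp_minus field_simps)
    moreover have "exp (- m) \<le> exp (- 1)" using m by simp
    ultimately have c: "0 < exp (- m)" "exp (- m) \<le> 1/2" by (simp, linarith)
    have "ln (pi * (exp (- m))\<^sup>2) = ln pi - 2 * m" by (simp add: ln_mult ln_realpow)
    moreover have "exp (- m) ^ k = exp (- (real k * m))" by (simp flip: exp_of_nat_mult)
    moreover have "exp (- (real k * m)) * exp (- (Re v * (ln pi - 2 * m))) = exp (- (Re v * ln pi)) * exp (Re s * m)"
      unfolding exp_add[symmetric] Rv by (rule arg_cong[of _ _ exp]) (simp add: field_simps)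
    ultimately show ?thesis using main[OF c] by (simp add: A_def mult.assoc)
  qed
  \<comment> \<open>Chosen so that A Re s m is at least M; exp x > x then contradicts
    \<open>grow\<close>.\<close>
  define m where "m = max 1 (M / (A * Re s))"
  have "m \<ge> 1" by (simp add: m_def)
  have "M = A * (Re s * (M / (A * Re s)))" using A s by simp
  also have "\<dots> \<le> A * (Re s * m)" using A s by (intro mult_left_mono) (auto simp: m_def)
  also have "\<dots> < A * exp (Re s * m)"
  proof -
    have "Re s * m < exp (Re s * m)" using exp_ge_add_one_self[of "Re s * m"] by linarith
    then show ?thesis using A by simp
  qed
  also have "\<dots> \<le> M" by (rule grow[OF \<open>m \<ge> 1\<close>])
  finally show False by simp
qed

text \<open>For Re s <= 0 the symmetry under R transports the result from 1 - s, whose real part is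
  positive.\<close>

lemma Lambda_nonvanishing:
  assumes k: "k \<le> 1"
  shows "\<exists>a c. a \<notin> \<int> \<and> c \<notin> \<int> \<and> Lambda k s a c \<noteq> 0"
proof (cases "Re s > 0")
  case True
  then show ?thesis using Lambda_nonvanishing_pos[OF k] by blast
next
  case False
  then obtain a c where ac: "a \<notin> \<int>" "c \<notin> \<int>" "Lambda k (1 - s) a c \<noteq> 0"
    using Lambda_nonvanishing_pos[OF k, of "1 - s"] by auto
  have "Lambda k s (1 - c) a \<noteq> 0"
    using Lambda_fourier_symmetry[of a c k s] ac(3) by auto
  moreover have "1 - c \<notin> \<int>" using ac(2) Ints_diff[OF Ints_1, of "1 - c"] by auto
  ultimately show ?thesis using ac(1) by blast
qed

text \<open>\<open>Lambda_fourier_symmetry\<close> places \<open>a\<close> in the second argument,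
  where the c-derivatives apply at parameter - s. The parameter s + 1 on the left is the one that a
  first c-derivative leaves behind in \<open>D_L\<close>.\<close>

lemma Lambda_deriv_fst:
  assumes "a \<notin> \<int>" "c \<notin> \<int>"
  shows "((\<lambda>a. Lambda 0 (s + 1) a c) has_vector_derivative 2 * pi * \<i> * (Lambda 1 s a c - c * Lambda 0 (s + 1) a c)) (at a)"
    and "((\<lambda>a. Lambda 1 (s + 1) a c) has_vector_derivative \<i> * (s * Lambda 0 s a c) - 2 * pi * \<i> * (c * Lambda 1 (s + 1) a c)) (at a)"
proof -
  have c': "1 - c \<notin> \<int>" using assms(2) Ints_diff[OF Ints_1, of "1 - c"] by auto
  have e: "((\<lambda>a. ee (- (a * c))) has_vector_derivative (2 * pi * \<i> * - c * ee (- (a * c)))) (at a)"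
    using ee_has_vector_derivative[of "\<lambda>a. - (a * c)" "- c" a UNIV] by (auto intro!: derivative_eq_intros)
  have s0: "Lambda 0 z a c = ee (- (a * c)) * Lambda 0 (1 - z) (1 - c) a" for a z
    using Lambda_fourier_symmetry[of a c 0 "1 - z"] by simp
  have s1: "Lambda 1 z a c = \<i> * (ee (- (a * c)) * Lambda 1 (1 - z) (1 - c) a)" for a z
    using Lambda_fourier_symmetry[of a c 1 "1 - z"] by simp
  have n: "1 - (s + 1) = - s" "- s + 1 = 1 - s" by simp_all
  note d0 = has_vector_derivative_mult[OF e Lambda_zero_deriv[OF c' assms(1), of "- s"], unfolded n]
  note d1 = has_vector_derivative_mult_right[OF has_vector_derivative_mult[OF e Lambda_one_deriv[OF c' assms(1), of "- s"], unfolded n], of \<i>]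
  have "((\<lambda>a. ee (- (a * c)) * Lambda 0 (- s) (1 - c) a) has_vector_derivative 2 * pi * \<i> * (Lambda 1 s a c - c * (ee (- (a * c)) * Lambda 0 (- s) (1 - c) a))) (at a)"
    unfolding s1[of s a] by (rule has_vector_derivative_eq_rhs[OF d0]) (simp add: algebra_simps)
  then show "((\<lambda>a. Lambda 0 (s + 1) a c) has_vector_derivative 2 * pi * \<i> * (Lambda 1 s a c - c * Lambda 0 (s + 1) a c)) (at a)"
    unfolding s0 n .
  have "((\<lambda>a. \<i> * (ee (- (a * c)) * Lambda 1 (- s) (1 - c) a)) has_vector_derivative
     \<i> * (s * Lambda 0 s a c) - 2 * pi * \<i> * (c * (\<i> * (ee (- (a * c)) * Lambda 1 (- s) (1 - c) a)))) (at a)"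
    unfolding s0[of s a] by (rule has_vector_derivative_eq_rhs[OF d1]) (simp add: algebra_simps)
  then show "((\<lambda>a. Lambda 1 (s + 1) a c) has_vector_derivative \<i> * (s * Lambda 0 s a c) - 2 * pi * \<i> * (c * Lambda 1 (s + 1) a c)) (at a)"
    unfolding s1 n .
qed

section \<open>The distribution relation behind the operators T_m\<close>

lemma sum_ee_roots:
  assumes m: "m > 0"
  shows "(\<Sum>j<m. ee (of_int n * (real j / real m))) = (if int m dvd n then of_nat m else 0)"
proof -
  define q where "q = ee (of_int n / real m)"
  have p: "ee (of_int n * (real j / real m)) = q ^ j" for j
    using ee_mult_int[of "int j" "of_int n / real m"] by (simp add: q_def mult_ac)
  have qm: "q ^ m = 1"
    using ee_mult_int[of "int m" "of_int n / real m"] m by (simp add: q_def)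
  have "q = 1 \<longleftrightarrow> int m dvd n"
  proof -
    have "q = 1 \<longleftrightarrow> (\<exists>l::int. of_int n / real m = of_int l)"
      unfolding q_def ee_eq_1_iff by (simp add: Ints_def image_iff)
    also have "\<dots> \<longleftrightarrow> (\<exists>l::int. real_of_int n = of_int (int m * l))"
      using m by (simp add: divide_eq_eq mult.commute)
    also have "\<dots> \<longleftrightarrow> int m dvd n"
      unfolding of_int_eq_iff dvd_def ..
    finally show ?thesis .
  qed
  moreover have "(\<Sum>j<m. q ^ j) = 0" if "q \<noteq> 1"
    using that geometric_sum[OF that, of m] qm by simp
  ultimately show ?thesis unfolding p by (cases "q = 1") auto
qed

lemma divide_shift_not_Ints:
  assumes "a \<notin> \<int>" "m \<ge> 1"
  shows "(a + real j) / real m \<notin> \<int>"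
proof
  assume "(a + real j) / real m \<in> \<int>"
  then have "(a + real j) / real m * real m - real j \<in> \<int>" by (intro Ints_diff Ints_mult) auto
  then show False using assms by simp
qed

text \<open>Averaging over j kills the frequencies n not divisible by m, and n = m l gives n + m c =
  m (l + c); homogeneity of the summand then produces the power of m.\<close>

lemma Lambda_distribution_pos:
  assumes a: "a \<notin> \<int>" and c: "real m * c \<notin> \<int>" and m: "m \<ge> 1" and k: "k \<le> 1" and z: "Re z > 0"
  shows "1 / of_nat m * (\<Sum>j<m. Lambda k z ((a + real j) / real m) (real m * c)) = exp (- z * of_real (ln (real m))) * Lambda k z a c"
proof -
  let ?p = "\<lambda>j. (a + real j) / real m" and ?mz = "exp (- z * of_real (ln (real m)))"
  have c': "c \<notin> \<int>" using c Ints_mult[of "real m" c] by auto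
  have am: "(a + real j) / real m \<notin> \<int>" for j by (rule divide_shift_not_Ints[OF a m])
  define v where "v = (z + of_nat k) / 2"
  define h where "h = (\<lambda>y::real. of_real y ^ k * exp (- (v * of_real (ln (pi * y\<^sup>2)))))"
  define S where "S = (\<lambda>a c N. \<Sum>n\<in>{- int N..int N}. ee (of_int n * a) * h (of_int n + c))"
  have lim: "(\<lambda>N. Gamma v * S a c N) \<longlonglongrightarrow> Lambda k z a c" if "a \<notin> \<int>" "c \<notin> \<int>" for a c
    using Lambda_partial_sums[OF that k z] unfolding S_def h_def v_def by (simp only: mult.assoc)
  \<comment> \<open>Degree of homogeneity: k from the power and - 2 v = - z - k from the
    exponential, together - z.\<close>
  have hm: "h (real m * y) = ?mz * h y" if "y \<noteq> 0" for y
  proof -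
    have l: "ln (pi * (real m * y)\<^sup>2) = 2 * ln (real m) + ln (pi * y\<^sup>2)"
      using that m by (simp add: power_mult_distrib ln_mult ln_realpow)
    have e: "of_real (real m) ^ k = exp (of_nat k * complex_of_real (ln (real m)))"
      using m by (simp add: exp_of_nat_mult exp_of_real)
    have "of_nat k * complex_of_real (ln (real m)) + - (v * of_real (2 * ln (real m) + ln (pi * y\<^sup>2)))
       = - z * of_real (ln (real m)) + - (v * of_real (ln (pi * y\<^sup>2)))"
      by (simp add: v_def algebra_simps add_divide_distrib)
    then have "exp (of_nat k * complex_of_real (ln (real m))) * exp (- (v * of_real (2 * ln (real m) + ln (pi * y\<^sup>2))))
       = ?mz * exp (- (v * of_real (ln (pi * y\<^sup>2))))"
      by (simp only: exp_add[symmetric])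
    then show ?thesis
      unfolding h_def l of_real_mult[of "real m"] power_mult_distrib[of "of_real (real m)"] e by (simp only: mult_ac)
  qed
  \<comment> \<open>Truncating at m * N makes the surviving indices exactly m l with |l| <= N, so
    the identity is exact for partial sums; the limit is then taken along the subsequence m *
    N.\<close>
  have TS: "1 / of_nat m * (\<Sum>j<m. S (?p j) (real m * c) (m * N)) = ?mz * S a c N" for N
  proof -
    let ?A = "{- int (m * N)..int (m * N)}"
    have "(\<Sum>j<m. S (?p j) (real m * c) (m * N)) =
       (\<Sum>n\<in>?A. \<Sum>j<m. ee (of_int n * (?p j)) * h (of_int n + real m * c))"
      unfolding S_def by (rule sum.swap)
    also have "\<dots> = (\<Sum>n\<in>?A. if int m dvd n then of_nat m * ee (of_int n * (a / real m)) * h (of_int n + real m * c) else 0)"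
    proof (intro sum.cong refl)
      fix n
      have "of_int n * (?p j) = of_int n * (a / real m) + of_int n * (real j / real m)" for j
        by (simp add: add_divide_distrib distrib_left)
      then have "(\<Sum>j<m. ee (of_int n * (?p j)) * h (of_int n + real m * c)) =
          ee (of_int n * (a / real m)) * h (of_int n + real m * c) * (\<Sum>j<m. ee (of_int n * (real j / real m)))"
        by (simp only: ee_add sum_distrib_left mult_ac)
      then show "(\<Sum>j<m. ee (of_int n * (?p j)) * h (of_int n + real m * c)) =
          (if int m dvd n then of_nat m * ee (of_int n * (a / real m)) * h (of_int n + real m * c) else 0)"
        using sum_ee_roots[of m n] m by simp
    qed
    also have "\<dots> = (\<Sum>n\<in>(\<lambda>l. int m * l) ` {- int N..int N}. of_nat m * ee (of_int n * (a / real m)) * h (of_int n + real m * c))"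
    proof (rule sum.mono_neutral_cong_right)
      have "int m * l \<le> int m * int N \<longleftrightarrow> l \<le> int N" "int m * (- int N) \<le> int m * l \<longleftrightarrow> - int N \<le> l" for l
        using m by (simp_all only: mult_le_cancel_left_pos of_nat_0_less_iff)
      note * = this
      show "(\<lambda>l. int m * l) ` {- int N..int N} \<subseteq> ?A"
      proof (rule image_subsetI)
        fix l assume "l \<in> {- int N..int N}"
        then show "int m * l \<in> ?A" using *[of l] by simp
      qed
      show "\<forall>n\<in>?A - (\<lambda>l. int m * l) ` {- int N..int N}. (if int m dvd n then of_nat m * ee (of_int n * (a / real m)) * h (of_int n + real m * c) else 0) = 0"
      proof
        fix n assume n: "n \<in> ?A - (\<lambda>l. int m * l) ` {- int N..int N}"
        have "\<not> int m dvd n"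
        proof
          assume "int m dvd n"
          then obtain l where l: "n = int m * l" by (rule dvdE)
          then have "l \<in> {- int N..int N}" using n *[of l] by simp
          then show False using n l by blast
        qed
        then show "(if int m dvd n then of_nat m * ee (of_int n * (a / real m)) * h (of_int n + real m * c) else 0) = 0" by simp
      qed
    qed auto
    also have "\<dots> = (\<Sum>l\<in>{- int N..int N}. of_nat m * ee (of_int (int m * l) * (a / real m)) * h (of_int (int m * l) + real m * c))"
      using m by (subst sum.reindex) (auto intro: inj_onI)
    also have "\<dots> = (\<Sum>l\<in>{- int N..int N}. of_nat m * (?mz * (ee (of_int l * a) * h (of_int l + c))))"
    proof (intro sum.cong refl)
      fix l :: int
      have "of_int (int m * l) + real m * c = real m * (of_int l + c)" "of_int (int m * l) * (a / real m) = of_int l * a"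
        using m by (simp_all add: algebra_simps)
      then show "of_nat m * ee (of_int (int m * l) * (a / real m)) * h (of_int (int m * l) + real m * c) =
         of_nat m * (?mz * (ee (of_int l * a) * h (of_int l + c)))"
        using hm[OF of_int_add_nonzero[OF c', of l]] by (simp only: mult_ac)
    qed
    finally show ?thesis using m by (simp add: S_def sum_distrib_left)
  qed
  have "(\<lambda>N. 1 / of_nat m * (\<Sum>j<m. Gamma v * S (?p j) (real m * c) N)) \<longlonglongrightarrow>
      1 / of_nat m * (\<Sum>j<m. Lambda k z (?p j) (real m * c))"
    by (intro tendsto_mult tendsto_const tendsto_sum lim am c)
  moreover have "filterlim (\<lambda>N. m * N) at_top at_top"
    using m by (intro filterlim_subseq strict_monoI) auto
  ultimately have "(\<lambda>N. 1 / of_nat m * (\<Sum>j<m. Gamma v * S (?p j) (real m * c) (m * N))) \<longlonglongrightarrow>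
      1 / of_nat m * (\<Sum>j<m. Lambda k z (?p j) (real m * c))"
    by (rule filterlim_compose)
  moreover have "(\<lambda>N. 1 / of_nat m * (\<Sum>j<m. Gamma v * S (?p j) (real m * c) (m * N))) =
      (\<lambda>N. ?mz * (Gamma v * S a c N))"
  proof
    fix N
    have "1 / of_nat m * (\<Sum>j<m. Gamma v * S (?p j) (real m * c) (m * N)) =
      Gamma v * (1 / of_nat m * (\<Sum>j<m. S (?p j) (real m * c) (m * N)))"
      by (simp only: sum_distrib_left[symmetric] mult_ac)
    then show "1 / of_nat m * (\<Sum>j<m. Gamma v * S (?p j) (real m * c) (m * N)) =
      ?mz * (Gamma v * S a c N)"
      unfolding TS by (simp only: mult_ac)
  qed
  ultimately have "(\<lambda>N. ?mz * (Gamma v * S a c N)) \<longlonglongrightarrow>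
      1 / of_nat m * (\<Sum>j<m. Lambda k z (?p j) (real m * c))"
    by (simp only:)
  moreover have "(\<lambda>N. ?mz * (Gamma v * S a c N)) \<longlonglongrightarrow> ?mz * Lambda k z a c"
    by (intro tendsto_mult tendsto_const lim a c')
  ultimately show ?thesis by (rule LIMSEQ_unique)
qed

lemma Lambda_distribution:
  assumes a: "a \<notin> \<int>" and c: "real m * c \<notin> \<int>" and m: "m \<ge> 1" and k: "k \<le> 1"
  shows "1 / of_nat m * (\<Sum>j<m. Lambda k s ((a + real j) / real m) (real m * c)) = of_nat m powr (- s) * Lambda k s a c"
proof -
  have c': "c \<notin> \<int>" using c Ints_mult[of "real m" c] by auto
  have am: "(a + real j) / real m \<notin> \<int>" for j by (rule divide_shift_not_Ints[OF a m])
  define f where "f = (\<lambda>z. 1 / of_nat m * (\<Sum>j<m. Lambda k z ((a + real j) / real m) (real m * c)))"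
  define g where "g = (\<lambda>z. exp (- z * of_real (ln (real m))) * Lambda k z a c)"
  have "f s = g s"
  proof (rule analytic_continuation_open[of "{z. Re z > 0}" UNIV f g])
    show "f holomorphic_on UNIV"
      unfolding f_def by (intro holomorphic_on_mult holomorphic_on_sum holomorphic_on_const Lambda_holomorphic am c k)
    show "g holomorphic_on UNIV"
      unfolding g_def by (intro holomorphic_on_mult Lambda_holomorphic a c' k) (intro holomorphic_intros)
    show "{z::complex. Re z > 0} \<noteq> {}" by (auto intro: exI[of _ 1])
    show "f z = g z" if "z \<in> {z. Re z > 0}" for z
      using Lambda_distribution_pos[OF a c m k] that by (simp add: f_def g_def)
  qed (auto simp: open_halfspace_Re_gt)
  moreover have "of_nat m powr (- s) = exp (- s * of_real (ln (real m)))"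
    using m by (simp add: powr_def Ln_of_nat)
  ultimately show ?thesis by (simp add: f_def g_def)
qed

section \<open>The Lerch space\<close>

lemma exp_pi_eq_ee: "exp (2 * of_real pi * \<i> * of_int n * of_real a) = ee (of_int n * a)"
  "exp (- 2 * of_real pi * \<i> * of_real a) = ee (- a)"
  "exp (- 2 * of_real pi * \<i> * of_real a * of_real c) = ee (- (a * c))"
  unfolding exp_eq_ee[symmetric] by (simp_all add: mult_ac)

lemma one_minus_Ints_iff [simp]: "1 - x \<in> \<int> \<longleftrightarrow> x \<in> (\<int> :: real set)"
  using Ints_diff[OF Ints_1, of x] Ints_diff[OF Ints_1, of "1 - x"] by auto

text \<open>Gamma has no genuine zeros; with the convention that it is 0 at its poles, vanishing of
  \<open>Gamma_R\<close> marks a pole.\<close>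

lemma Gamma_R_eq_0_iff: "Gamma_R s = 0 \<longleftrightarrow> s / 2 \<in> \<int>\<^sub>\<le>\<^sub>0"
  by (simp add: Gamma_R_def Gamma_eq_zero_iff)

lemma Gamma_R_nonzero:
  assumes "Re s > 0"
  shows "Gamma_R s \<noteq> 0"
  using assms by (auto simp: Gamma_R_eq_0_iff elim!: nonpos_Ints_cases dest: arg_cong[of _ _ Re])

text \<open>Written through the entire function \<open>rGamma\<close>, the reciprocal has its
  correct value 0 at the poles, so no exceptional s arise in the formulas for L.\<close>

lemma inverse_Gamma_R: "inverse (Gamma_R s) = of_real pi powr (s / 2) * rGamma (s / 2)"
  by (simp add: Gamma_R_def rGamma_inverse_Gamma powr_minus)

lemma inverse_Gamma_R_holomorphic: "(\<lambda>s. inverse (Gamma_R s)) holomorphic_on UNIV"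
proof -
  have "(\<lambda>s. s / 2) holomorphic_on (UNIV :: complex set)"
    by (intro holomorphic_on_divide holomorphic_on_ident holomorphic_on_const) simp
  from holomorphic_on_compose_gen[OF this holomorphic_rGamma[of UNIV]]
  show ?thesis
    unfolding inverse_Gamma_R by (intro holomorphic_intros) (simp_all add: o_def)
qed

definition Lerch_partial_sum :: "nat \<Rightarrow> complex \<Rightarrow> real \<Rightarrow> real \<Rightarrow> nat \<Rightarrow> complex" where
  "Lerch_partial_sum k z a c N =
     (\<Sum>n\<in>{- int N..int N}. of_real (sgn (of_int n + c) ^ k) * exp (2 * of_real pi * \<i> * of_int n * of_real a)
        * of_real \<bar>of_int n + c\<bar> powr (- z))"

text \<open>\<open>Lambda_partial_sums\<close> supplies the limit on the half-plane and the identity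
  theorem the uniqueness, so the definite description in \<open>entire_continuation\<close> denotes
  this function.\<close>

lemma entire_continuation_Lerch:
  assumes a: "a \<notin> \<int>" and c: "c \<notin> \<int>" and k: "k \<le> 1"
  shows "entire_continuation (\<lambda>z. Lerch_partial_sum k z a c) s = inverse (Gamma_R (s + of_nat k)) * Lambda k s a c"
proof -
  define g where "g = (\<lambda>s. inverse (Gamma_R (s + of_nat k)) * Lambda k s a c)"
  have "(\<lambda>s. s + of_nat k) holomorphic_on (UNIV :: complex set)"
    by (intro holomorphic_on_add holomorphic_on_ident holomorphic_on_const)
  from holomorphic_on_compose_gen[OF this inverse_Gamma_R_holomorphic]
  have hol: "g holomorphic_on UNIV"
    unfolding g_def by (intro holomorphic_on_mult Lambda_holomorphic a c k) (simp add: o_def)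
  have lim: "Lerch_partial_sum k z a c \<longlonglongrightarrow> g z" if z: "Re z > 0" for z
  proof -
    define v where "v = (z + of_nat k) / 2"
    have G: "Gamma_R (z + of_nat k) \<noteq> 0" using z by (intro Gamma_R_nonzero) simp
    \<comment> \<open>The k powers of n + c against k powers of 1 / |n + c| leave the sign, and
      Gamma v with the power of pi forms \<open>Gamma_R (z + of_nat k)\<close>.\<close>
    have summand: "Gamma v * (ee (of_int n * a) * of_real (of_int n + c) ^ k * exp (- (v * of_real (ln (pi * (of_int n + c)\<^sup>2))))) =
       Gamma_R (z + of_nat k) * (of_real (sgn (of_int n + c) ^ k) * exp (2 * of_real pi * \<i> * of_int n * of_real a) * of_real \<bar>of_int n + c\<bar> powr (- z))" for n
    proof -
      define y where "y = of_int n + c"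
      have y: "y \<noteq> 0" using of_int_add_nonzero[OF c] by (simp add: y_def)
      have "ln (pi * y\<^sup>2) = ln pi + 2 * ln \<bar>y\<bar>"
        using y ln_mult[of pi "y\<^sup>2"] ln_realpow[of "\<bar>y\<bar>" 2] by simp
      then have "- (v * of_real (ln (pi * y\<^sup>2))) = - v * of_real (ln pi) + (- z * of_real (ln \<bar>y\<bar>) + - (of_nat k * of_real (ln \<bar>y\<bar>)))"
        by (simp add: v_def algebra_simps add_divide_distrib)
      then have "exp (- (v * of_real (ln (pi * y\<^sup>2)))) = exp (- v * of_real (ln pi)) * (exp (- z * of_real (ln \<bar>y\<bar>)) * exp (- (of_nat k * of_real (ln \<bar>y\<bar>))))"
        by (simp only: exp_add)
      also have "exp (- v * of_real (ln pi)) = of_real pi powr (- (z + of_nat k) / 2)"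
      proof -
        have "- v = - (z + of_nat k) / 2" by (simp only: v_def minus_divide_left)
        then show ?thesis by (simp only: powr_def) (simp add: Ln_of_real)
      qed
      also have "exp (- z * of_real (ln \<bar>y\<bar>)) = of_real \<bar>y\<bar> powr (- z)"
        using y by (simp add: powr_def Ln_of_real)
      also have "exp (- (of_nat k * complex_of_real (ln \<bar>y\<bar>))) = inverse (of_real \<bar>y\<bar>) ^ k"
        using y by (simp add: exp_minus exp_of_nat_mult exp_of_real power_inverse)
      finally have e: "exp (- (v * of_real (ln (pi * y\<^sup>2)))) = of_real pi powr (- (z + of_nat k) / 2) * (of_real \<bar>y\<bar> powr (- z) * inverse (of_real \<bar>y\<bar>) ^ k)" .
      have "y * inverse \<bar>y\<bar> = sgn y" using y by (simp add: sgn_if)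
      then have "complex_of_real y ^ k * inverse (of_real \<bar>y\<bar>) ^ k = of_real (sgn y ^ k)"
        by (simp flip: power_mult_distrib of_real_mult of_real_inverse of_real_power)
      then show ?thesis
        unfolding y_def[symmetric] e exp_pi_eq_ee Gamma_R_def by (simp add: v_def mult_ac)
    qed
    have "(\<lambda>N. Gamma_R (z + of_nat k) * Lerch_partial_sum k z a c N) \<longlonglongrightarrow> Lambda k z a c"
      using Lambda_partial_sums[OF a c k z] unfolding v_def[symmetric] sum_distrib_left summand
      by (simp only: Lerch_partial_sum_def sum_distrib_left)
    from tendsto_mult[OF tendsto_const[of "inverse (Gamma_R (z + of_nat k))"] this]
    show ?thesis using G by (simp add: g_def mult.assoc[symmetric])
  qed
  have "entire_continuation (\<lambda>z. Lerch_partial_sum k z a c) = g"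
    unfolding entire_continuation_def
  proof (rule the_equality)
    show "g holomorphic_on UNIV \<and> (\<forall>z. Re z > 0 \<longrightarrow> Lerch_partial_sum k z a c \<longlonglongrightarrow> g z)"
      using hol lim by blast
    fix h assume h: "h holomorphic_on UNIV \<and> (\<forall>z. Re z > 0 \<longrightarrow> Lerch_partial_sum k z a c \<longlonglongrightarrow> h z)"
    show "h = g"
    proof
      fix w
      show "h w = g w"
      proof (rule analytic_continuation_open[of "{z. Re z > 0}" UNIV h g])
        show "{z::complex. Re z > 0} \<noteq> {}" by (auto intro: exI[of _ 1])
        show "h z = g z" if "z \<in> {z. Re z > 0}" for z
          using h lim[of z] that LIMSEQ_unique by blast
      qed (use h hol in \<open>auto simp: open_halfspace_Re_gt\<close>)
    qed
  qed
  then show ?thesis by (simp add: g_def)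
qed

text \<open>Extension by zero at integers, as for \<open>Lplus\<close> and \<open>Lminus\<close>;
  otherwise the junk values of \<open>Lambda\<close> there would break the equalities of functions
  on the whole plane.\<close>

definition Lerch_basis :: "nat \<Rightarrow> complex \<Rightarrow> real \<Rightarrow> real \<Rightarrow> complex" where
  "Lerch_basis k s a c = (if a \<in> \<int> \<or> c \<in> \<int> then 0 else Lambda k s a c)"

lemma Lplus_eq: "Lplus s = cscale (inverse (Gamma_R s)) (Lerch_basis 0 s)"
proof (intro ext)
  fix a c
  have "Lplus_sum z a c = Lerch_partial_sum 0 z a c" for z
    by (simp add: Lplus_sum_def Lerch_partial_sum_def fun_eq_iff)
  then show "Lplus s a c = cscale (inverse (Gamma_R s)) (Lerch_basis 0 s) a c"
    using entire_continuation_Lerch[of a c 0 s] by (simp add: Lplus_def cscale_def Lerch_basis_def)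
qed

lemma Lminus_eq: "Lminus s = cscale (inverse (Gamma_R (s + 1))) (Lerch_basis 1 s)"
proof (intro ext)
  fix a c
  have "Lminus_sum z a c = Lerch_partial_sum 1 z a c" for z
    by (simp add: Lminus_sum_def Lerch_partial_sum_def fun_eq_iff)
  then show "Lminus s a c = cscale (inverse (Gamma_R (s + 1))) (Lerch_basis 1 s) a c"
    using entire_continuation_Lerch[of a c 1 s] by (simp add: Lminus_def cscale_def Lerch_basis_def)
qed

section \<open>The operators R and J on the basis, and the structure of the Lerch space\<close>

lemma R_op_linear: "R_op (f + g) = R_op f + R_op g" "R_op (cscale \<alpha> f) = cscale \<alpha> (R_op f)"
  by (simp_all add: R_op_def cscale_def fun_eq_iff algebra_simps)

lemma J_op_linear: "J_op (f + g) = J_op f + J_op g" "J_op (cscale \<alpha> f) = cscale \<alpha> (J_op f)"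
  by (simp_all add: J_op_def cscale_def fun_eq_iff algebra_simps)

lemma R_op_Lerch_basis: "R_op (Lerch_basis k s) = cscale ((- \<i>) ^ k) (Lerch_basis k (1 - s))"
proof (intro ext)
  fix a c
  show "R_op (Lerch_basis k s) a c = cscale ((- \<i>) ^ k) (Lerch_basis k (1 - s)) a c"
    using Lambda_fourier_symmetry[of a c k s]
    unfolding R_op_def exp_pi_eq_ee Lerch_basis_def cscale_def one_minus_Ints_iff
    by (auto simp del: power_minus)
qed

lemma J_op_Lerch_basis: "J_op (Lerch_basis k s) = cscale ((-1) ^ k) (Lerch_basis k s)"
proof (intro ext)
  fix a c
  show "J_op (Lerch_basis k s) a c = cscale ((-1) ^ k) (Lerch_basis k s) a c"
    using Lambda_reflect[of a k s c]
    unfolding J_op_def exp_pi_eq_ee Lerch_basis_def cscale_def one_minus_Ints_iff by auto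
qed

lemma J_op_involution: "J_op (J_op f) = f"
proof (intro ext)
  fix a c
  have "ee (- a) * ee (- (1 - a)) = ee (of_int (-1))" unfolding ee_add[symmetric] by simp
  then have "ee (- a) * ee (- (1 - a)) = 1" by (simp only: ee_of_int)
  then show "J_op (J_op f) a c = f a c"
    unfolding J_op_def exp_pi_eq_ee by (simp add: mult.assoc[symmetric])
qed

lemma Lerch_space_eq: "Lerch_space s = cfun.span {Lerch_basis 0 s, Lerch_basis 1 s}"
proof -
  let ?F = "\<lambda>k. Lerch_basis k s"
  have g3: "(\<lambda>a c. exp (- 2 * of_real pi * \<i> * of_real a * of_real c) * Lplus (1 - s) (1 - c) a) = cscale (inverse (Gamma_R (1 - s))) (?F 0)"
    unfolding R_op_def[symmetric] Lplus_eq R_op_linear R_op_Lerch_basis by simp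
  have g4: "(\<lambda>a c. exp (- 2 * of_real pi * \<i> * of_real a * of_real c) * Lminus (1 - s) (1 - c) a) = cscale (inverse (Gamma_R (2 - s)) * (- \<i>)) (?F 1)"
    unfolding R_op_def[symmetric] Lminus_eq R_op_linear R_op_Lerch_basis by simp
  let ?G = "{cscale (inverse (Gamma_R s)) (?F 0), cscale (inverse (Gamma_R (s + 1))) (?F 1),
     cscale (inverse (Gamma_R (1 - s))) (?F 0), cscale (inverse (Gamma_R (2 - s)) * (- \<i>)) (?F 1)}"
  have L: "Lerch_space s = cfun.span ?G"
    unfolding Lerch_space_def g3 g4 unfolding Lplus_eq Lminus_eq ..
  have unscale: "F \<in> cfun.span ?G" if "cscale x F \<in> ?G" "x \<noteq> 0" for x F
  proof -
    have "cscale (inverse x) (cscale x F) \<in> cfun.span ?G"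
      by (intro cfun.span_scale cfun.span_base that)
    then show ?thesis using that(2) by simp
  qed
  have "?F 0 \<in> cfun.span ?G"
  \<comment> \<open>One of s and 1 - s has positive real part, where \<open>Gamma_R\<close> has no
    pole, so the corresponding generator is a nonzero multiple of the basis function.\<close>
  proof (cases "Re s > 0")
    case True
    then show ?thesis by (intro unscale[of "inverse (Gamma_R s)"]) (simp_all add: Gamma_R_nonzero)
  next
    case False
    then show ?thesis by (intro unscale[of "inverse (Gamma_R (1 - s))"]) (simp_all add: Gamma_R_nonzero)
  qed
  moreover have "?F 1 \<in> cfun.span ?G"
  proof (cases "Re s > 0")
    case True
    then show ?thesis by (intro unscale[of "inverse (Gamma_R (s + 1))"]) (simp_all add: Gamma_R_nonzero)
  next
    case False
    then show ?thesis by (intro unscale[of "inverse (Gamma_R (2 - s)) * (- \<i>)"]) (simp_all add: Gamma_R_nonzero)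
  qed
  ultimately have "cfun.span {?F 0, ?F 1} \<subseteq> cfun.span ?G"
    by (intro cfun.span_minimal) auto
  moreover have "cfun.span ?G \<subseteq> cfun.span {?F 0, ?F 1}"
  proof (rule cfun.span_minimal[OF _ cfun.subspace_span])
    have "cscale x F \<in> cfun.span {?F 0, ?F 1}" if "F \<in> {?F 0, ?F 1}" for x F
      by (intro cfun.span_scale cfun.span_base that)
    then show "?G \<subseteq> cfun.span {?F 0, ?F 1}" by blast
  qed
  ultimately show ?thesis using L by blast
qed

abbreviation Lerch_comb :: "complex \<Rightarrow> complex \<Rightarrow> complex \<Rightarrow> real \<Rightarrow> real \<Rightarrow> complex" where
  "Lerch_comb s \<alpha> \<beta> \<equiv> cscale \<alpha> (Lerch_basis 0 s) + cscale \<beta> (Lerch_basis 1 s)"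

lemma Lerch_space_iff: "f \<in> Lerch_space s \<longleftrightarrow> (\<exists>\<alpha> \<beta>. f = Lerch_comb s \<alpha> \<beta>)"
proof -
  have "f \<in> Lerch_space s \<longleftrightarrow> (\<exists>\<alpha> \<beta>. f - cscale \<alpha> (Lerch_basis 0 s) = cscale \<beta> (Lerch_basis 1 s))"
    unfolding Lerch_space_eq cfun.span_insert[of _ "{Lerch_basis 1 s}"] cfun.span_singleton by auto
  then show ?thesis by (simp add: diff_eq_eq add.commute)
qed

lemma Lerch_basis_nonzero: "k \<le> 1 \<Longrightarrow> Lerch_basis k s \<noteq> 0"
  using Lambda_nonvanishing[of k s] by (auto simp: Lerch_basis_def fun_eq_iff)

lemma J_op_combination:
  "J_op (Lerch_comb s \<alpha> \<beta>) = cscale \<alpha> (Lerch_basis 0 s) + cscale (- \<beta>) (Lerch_basis 1 s)"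
  by (simp add: J_op_linear J_op_Lerch_basis)

lemma cscale_add_self: "cscale \<alpha> f = - cscale \<alpha> f \<longleftrightarrow> \<alpha> = 0 \<or> f = 0"
  by (auto simp: cscale_def fun_eq_iff)

text \<open>J acts diagonally on the basis, so invariance forces \<open>\<beta>\<close> F = -
  \<open>\<beta>\<close> F with F = \<open>Lerch_basis 1 s\<close>, and F is not zero.\<close>

lemma Lerch_space_plus_eq: "Lerch_space_plus s = cfun.span {Lerch_basis 0 s}"
proof -
  have "f \<in> Lerch_space_plus s \<longleftrightarrow> (\<exists>\<alpha>. f = cscale \<alpha> (Lerch_basis 0 s))" for f
  proof
    assume "f \<in> Lerch_space_plus s"
    then obtain \<alpha> \<beta> where f: "f = Lerch_comb s \<alpha> \<beta>" and J: "J_op f = f"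
      by (auto simp: Lerch_space_plus_def Lerch_space_iff)
    from J have "cscale \<beta> (Lerch_basis 1 s) = - cscale \<beta> (Lerch_basis 1 s)"
      unfolding f J_op_combination by (simp add: cfun.scale_minus_left)
    then have "\<beta> = 0" using Lerch_basis_nonzero[of 1 s] by (simp add: cscale_add_self)
    then show "\<exists>\<alpha>. f = cscale \<alpha> (Lerch_basis 0 s)" using f by auto
  next
    assume "\<exists>\<alpha>. f = cscale \<alpha> (Lerch_basis 0 s)"
    then obtain \<alpha> where f: "f = cscale \<alpha> (Lerch_basis 0 s)" ..
    have "f = cscale \<alpha> (Lerch_basis 0 s) + cscale 0 (Lerch_basis 1 s)" by (simp add: f)
    then have "f \<in> Lerch_space s" unfolding Lerch_space_iff by blast
    moreover have "J_op f = f" by (simp add: f J_op_linear J_op_Lerch_basis)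
    ultimately show "f \<in> Lerch_space_plus s" by (simp add: Lerch_space_plus_def)
  qed
  then show ?thesis by (auto simp: cfun.span_singleton)
qed

lemma Lerch_space_minus_eq: "Lerch_space_minus s = cfun.span {Lerch_basis 1 s}"
proof -
  have "f \<in> Lerch_space_minus s \<longleftrightarrow> (\<exists>\<beta>. f = cscale \<beta> (Lerch_basis 1 s))" for f
  proof
    assume "f \<in> Lerch_space_minus s"
    then obtain \<alpha> \<beta> where f: "f = Lerch_comb s \<alpha> \<beta>" and J: "J_op f = - f"
      by (auto simp: Lerch_space_minus_def Lerch_space_iff)
    from J have "cscale \<alpha> (Lerch_basis 0 s) = - cscale \<alpha> (Lerch_basis 0 s)"
      unfolding f J_op_combination by (simp add: cfun.scale_minus_left)
    then have "\<alpha> = 0" using Lerch_basis_nonzero[of 0 s] by (simp add: cscale_add_self)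
    then show "\<exists>\<beta>. f = cscale \<beta> (Lerch_basis 1 s)" using f by auto
  next
    assume "\<exists>\<beta>. f = cscale \<beta> (Lerch_basis 1 s)"
    then obtain \<beta> where f: "f = cscale \<beta> (Lerch_basis 1 s)" ..
    have "f = cscale 0 (Lerch_basis 0 s) + cscale \<beta> (Lerch_basis 1 s)" by (simp add: f)
    then have "f \<in> Lerch_space s" unfolding Lerch_space_iff by blast
    moreover have "J_op f = - f" by (simp add: f J_op_linear J_op_Lerch_basis cfun.scale_minus_left)
    ultimately show "f \<in> Lerch_space_minus s" by (simp add: Lerch_space_minus_def)
  qed
  then show ?thesis by (auto simp: cfun.span_singleton)
qed

text \<open>The two functions are nonzero and belong to different eigenvalues of J.\<close>

lemma Lerch_basis_independent: "cfun.independent {Lerch_basis 0 s, Lerch_basis 1 s}" "Lerch_basis 0 s \<noteq> Lerch_basis 1 s"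
proof -
  have n: "Lerch_basis 0 s \<notin> cfun.span {Lerch_basis 1 s}"
  proof
    assume "Lerch_basis 0 s \<in> cfun.span {Lerch_basis 1 s}"
    then have "J_op (Lerch_basis 0 s) = - Lerch_basis 0 s"
      unfolding Lerch_space_minus_eq[symmetric] Lerch_space_minus_def by simp
    then have "cscale 1 (Lerch_basis 0 s) = - cscale 1 (Lerch_basis 0 s)" by (simp add: J_op_Lerch_basis)
    then show False using Lerch_basis_nonzero[of 0 s] by (simp add: cscale_add_self del: cfun.scale_one)
  qed
  then show "Lerch_basis 0 s \<noteq> Lerch_basis 1 s" using cfun.span_base by fastforce
  show "cfun.independent {Lerch_basis 0 s, Lerch_basis 1 s}"
    using n Lerch_basis_nonzero[of 1 s] \<open>Lerch_basis 0 s \<noteq> Lerch_basis 1 s\<close>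
    by (simp add: cfun.independent_insert cfun.dependent_single)
qed

text \<open>The terms carrying c in the mixed derivative cancel against c times the c-derivative,
  leaving - s f. All derivatives are computed on the open set of non-integers, where the extension
  by zero agrees with \<open>Lambda\<close>.\<close>

lemma Lerch_combination_derivatives:
  fixes s \<alpha> \<beta> :: complex
  defines "f \<equiv> Lerch_comb s \<alpha> \<beta>"
  assumes a: "a \<notin> \<int>" and c: "c \<notin> \<int>"
  shows "(\<lambda>y. f a y) differentiable (at c)" "(\<lambda>x. partial_c f x c) differentiable (at a)" "D_L f a c = - s * f a c"
proof -
  have op: "open (- \<int> :: real set)" using closed_Ints by blast
  have f: "f x y = \<alpha> * Lambda 0 s x y + \<beta> * Lambda 1 s x y" if "x \<notin> \<int>" "y \<notin> \<int>" for x y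
    using that by (simp add: f_def cscale_def Lerch_basis_def)
  have dc: "((\<lambda>y. f x y) has_vector_derivative \<alpha> * (- (2 * pi) * Lambda 1 (s + 1) x c) + \<beta> * (- s * Lambda 0 (s + 1) x c)) (at c)" if x: "x \<notin> \<int>" for x
  proof (rule has_vector_derivative_transform_within_open[OF _ op])
    show "((\<lambda>y. \<alpha> * Lambda 0 s x y + \<beta> * Lambda 1 s x y) has_vector_derivative \<alpha> * (- (2 * pi) * Lambda 1 (s + 1) x c) + \<beta> * (- s * Lambda 0 (s + 1) x c)) (at c)"
      by (intro has_vector_derivative_add has_vector_derivative_mult_right Lambda_zero_deriv Lambda_one_deriv x c)
  qed (use c x f in auto)
  show "(\<lambda>y. f a y) differentiable (at c)"
    using dc[OF a] by (rule differentiableI_vector)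
  have pc: "partial_c f x c = \<alpha> * (- (2 * pi) * Lambda 1 (s + 1) x c) + \<beta> * (- s * Lambda 0 (s + 1) x c)" if "x \<notin> \<int>" for x
    unfolding partial_c_def by (rule vector_derivative_at[OF dc[OF that]])
  define d where "d = \<alpha> * (- (2 * pi) * (\<i> * (s * Lambda 0 s a c) - 2 * pi * \<i> * (c * Lambda 1 (s + 1) a c))) +
     \<beta> * (- s * (2 * pi * \<i> * (Lambda 1 s a c - c * Lambda 0 (s + 1) a c)))"
  have da: "((\<lambda>x. partial_c f x c) has_vector_derivative d) (at a)"
  proof (rule has_vector_derivative_transform_within_open[OF _ op])
    show "((\<lambda>x. \<alpha> * (- (2 * pi) * Lambda 1 (s + 1) x c) + \<beta> * (- s * Lambda 0 (s + 1) x c)) has_vector_derivative d) (at a)"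
      unfolding d_def
      by (intro has_vector_derivative_add has_vector_derivative_mult_right Lambda_deriv_fst a c)
  qed (use a pc in auto)
  show "(\<lambda>x. partial_c f x c) differentiable (at a)"
    using da by (rule differentiableI_vector)
  have pa: "partial_a (partial_c f) a c = d"
    unfolding partial_a_def by (rule vector_derivative_at[OF da])
  show "D_L f a c = - s * f a c"
    unfolding D_L_def pa pc[OF a] f[OF a c] d_def by (simp add: field_simps)
qed

lemma T_op_combination:
  fixes s \<alpha> \<beta> :: complex
  assumes a: "a \<notin> \<int>" and c: "real m * c \<notin> \<int>" and m: "m \<ge> 1"
  shows "T_op m (Lerch_comb s \<alpha> \<beta>) a c =
    of_nat m powr (- s) * (Lerch_comb s \<alpha> \<beta>) a c"
proof -
  have c': "c \<notin> \<int>" using c Ints_mult[of "real m" c] by auto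
  have am: "(a + real j) / real m \<notin> \<int>" for j by (rule divide_shift_not_Ints[OF a m])
  have "T_op m (Lerch_comb s \<alpha> \<beta>) a c =
    \<alpha> * (1 / of_nat m * (\<Sum>j<m. Lambda 0 s ((a + real j) / real m) (real m * c))) +
    \<beta> * (1 / of_nat m * (\<Sum>j<m. Lambda 1 s ((a + real j) / real m) (real m * c)))"
    using am c by (simp add: T_op_def cscale_def Lerch_basis_def sum.distrib sum_distrib_left distrib_left mult_ac)
  also have "\<dots> = of_nat m powr (- s) * (\<alpha> * Lambda 0 s a c + \<beta> * Lambda 1 s a c)"
    using Lambda_distribution[OF a c m, of 0 s] Lambda_distribution[OF a c m, of 1 s] by (simp add: algebra_simps)
  finally show ?thesis using a c' by (simp add: cscale_def Lerch_basis_def)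
qed

section \<open>The functional equation and its gamma factors\<close>

lemma gamma_plus_eq: "gamma_plus (1 - s) = Gamma_R (1 - s) / Gamma_R s"
  by (simp add: gamma_plus_def)

lemma gamma_minus_eq: "gamma_minus (1 - s) = Gamma_R (2 - s) / Gamma_R (s + 1)"
  by (simp add: gamma_minus_def Gamma_R_def add.commute)

text \<open>The hypothesis excludes the poles of the numerator of the gamma factor, where the
  quotient defaults to 0. At poles of the denominator both sides are 0, the left one because
  \<open>Lplus s\<close> vanishes.\<close>

lemma functional_equation_plus:
  assumes "Gamma_R (1 - s) \<noteq> 0"
  shows "R_op (Lplus s) a c = inverse w_plus * gamma_plus (1 - s) * Lplus (1 - s) a c"
  using assms R_op_Lerch_basis[of 0 s]
  by (simp add: Lplus_eq R_op_linear gamma_plus_eq w_plus_def) (simp add: cscale_def field_simps)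

lemma functional_equation_minus:
  assumes "Gamma_R (2 - s) \<noteq> 0"
  shows "R_op (Lminus s) a c = inverse w_minus * gamma_minus (1 - s) * Lminus (1 - s) a c"
  using assms R_op_Lerch_basis[of 1 s]
  by (simp add: Lminus_eq R_op_linear gamma_minus_eq w_minus_def) (simp add: cscale_def field_simps)

text \<open>Any set of integers is closed, so the nonpositive integers without the value (r - s) / 2
  at s itself have an open complement, whose preimage contains s.\<close>

lemma eventually_Gamma_R_nonzero: "\<forall>\<^sub>F z in at s. Gamma_R (r - z) \<noteq> 0"
proof -
  let ?A = "(\<int>\<^sub>\<le>\<^sub>0 :: complex set) - {(r - s) / 2}"
  have "closed ?A" by (rule closed_subset_Ints) (auto dest: nonpos_Ints_Int)
  then have "open (- ?A)" by blast
  then have "open ((\<lambda>z. (r - z) / 2) -` (- ?A))"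
    by (rule open_vimage) (auto intro!: continuous_intros)
  moreover have "s \<in> (\<lambda>z. (r - z) / 2) -` (- ?A)" by simp
  ultimately have "\<forall>\<^sub>F z in at s. z \<in> (\<lambda>z. (r - z) / 2) -` (- ?A)"
    by (rule eventually_at_in_open')
  moreover have "\<forall>\<^sub>F z in at s. z \<noteq> s" by (rule eventually_neq_at_within)
  ultimately show ?thesis
    by eventually_elim (auto simp: Gamma_R_eq_0_iff)
qed

text \<open>The left side of the functional equation is entire in s, so at a pole of the gamma
  factor it is the limit of the right side.\<close>

lemma R_op_continuous:
  assumes a: "a \<notin> \<int>" and c: "c \<notin> \<int>"
  shows "((\<lambda>z. R_op (Lplus z) a c) \<longlongrightarrow> R_op (Lplus s) a c) (at s)"
    and "((\<lambda>z. R_op (Lminus z) a c) \<longlongrightarrow> R_op (Lminus s) a c) (at s)"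
proof -
  have c': "1 - c \<notin> \<int>" using c by simp
  have G: "isCont (\<lambda>z. inverse (Gamma_R z)) z" for z
    using holomorphic_on_imp_continuous_on[OF inverse_Gamma_R_holomorphic]
    by (simp add: continuous_on_eq_continuous_at)
  have L: "isCont (\<lambda>z. Lambda k z (1 - c) a) s" if "k \<le> 1" for k
    using holomorphic_on_imp_continuous_on[OF Lambda_holomorphic[OF c' a that]]
    by (simp add: continuous_on_eq_continuous_at)
  have G1: "isCont (\<lambda>z. inverse (Gamma_R (z + 1))) s"
    using isCont_o2[where f="\<lambda>z. z + 1" and g="\<lambda>z. inverse (Gamma_R z)" and a=s, OF _ G] by simp
  have "isCont (\<lambda>z. ee (- (a * c)) * (inverse (Gamma_R z) * Lambda 0 z (1 - c) a)) s"
    by (intro continuous_intros G L) simp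
  then show "((\<lambda>z. R_op (Lplus z) a c) \<longlongrightarrow> R_op (Lplus s) a c) (at s)"
    using a c by (simp add: R_op_def exp_pi_eq_ee Lplus_eq cscale_def Lerch_basis_def isCont_def)
  have "isCont (\<lambda>z. ee (- (a * c)) * (inverse (Gamma_R (z + 1)) * Lambda 1 z (1 - c) a)) s"
    by (intro continuous_intros G1 L) simp
  then show "((\<lambda>z. R_op (Lminus z) a c) \<longlongrightarrow> R_op (Lminus s) a c) (at s)"
    using a c by (simp add: R_op_def exp_pi_eq_ee Lminus_eq cscale_def Lerch_basis_def isCont_def)
qed

lemma R_op_Lerch_space: "R_op ` Lerch_space s = Lerch_space (1 - s)"
proof -
  have R: "R_op (Lerch_comb s \<alpha> \<beta>) =
     cscale \<alpha> (Lerch_basis 0 (1 - s)) + cscale (\<beta> * (- \<i>)) (Lerch_basis 1 (1 - s))" for \<alpha> \<beta> s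
    by (simp add: R_op_linear R_op_Lerch_basis)
  show ?thesis
  proof (intro equalityI subsetI)
    fix g assume "g \<in> R_op ` Lerch_space s"
    then obtain f where "g = R_op f" "f \<in> Lerch_space s" by blast
    then obtain \<alpha> \<beta> where "g = R_op (Lerch_comb s \<alpha> \<beta>)"
      unfolding Lerch_space_iff by blast
    then have "g = cscale \<alpha> (Lerch_basis 0 (1 - s)) + cscale (\<beta> * (- \<i>)) (Lerch_basis 1 (1 - s))"
      by (simp only: R)
    then show "g \<in> Lerch_space (1 - s)" unfolding Lerch_space_iff by blast
  next
    fix g assume "g \<in> Lerch_space (1 - s)"
    then obtain \<alpha> \<beta> where "g = cscale \<alpha> (Lerch_basis 0 (1 - s)) + cscale \<beta> (Lerch_basis 1 (1 - s))"
      by (auto simp: Lerch_space_iff)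
    \<comment> \<open>The preimage has second coefficient \<open>\<beta> * \<i>\<close>, which
      undoes the factor - i that R attaches to the odd basis function.\<close>
    moreover have "\<beta> * \<i> * (- \<i>) = \<beta>" by (simp add: mult.assoc)
    ultimately have "g = R_op (cscale \<alpha> (Lerch_basis 0 s) + cscale (\<beta> * \<i>) (Lerch_basis 1 s))"
      by (simp only: R)
    moreover have "cscale \<alpha> (Lerch_basis 0 s) + cscale (\<beta> * \<i>) (Lerch_basis 1 s) \<in> Lerch_space s"
      unfolding Lerch_space_iff by blast
    ultimately show "g \<in> R_op ` Lerch_space s" by (rule image_eqI)
  qed
qed

lemma Lerch_space_decomposition: "Lerch_space s = {f + g | f g. f \<in> Lerch_space_plus s \<and> g \<in> Lerch_space_minus s}"
  unfolding set_eq_iff mem_Collect_eq Lerch_space_iff Lerch_space_plus_eq Lerch_space_minus_eq cfun.span_singleton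
  by blast

text \<open>Differentiability accompanies the \<open>D_L\<close> equation because
  \<open>vector_derivative\<close> has an unspecified value where no derivative exists. The
  conditional functional equations exclude exactly the poles of the numerator of the gamma factor,
  where the library value 0 of the quotient is wrong; the two limits express the equation at every
  s, including those points.\<close>

theorem theorem2p2:
  fixes s :: complex
  shows
    "cfun.dim (Lerch_space s) = 2
   \<and> (\<forall>f\<in>Lerch_space s. \<forall>a c. a \<notin> \<int> \<and> c \<notin> \<int> \<longrightarrow>
        (\<lambda>y. f a y) differentiable (at c)
        \<and> (\<lambda>x. partial_c f x c) differentiable (at a)
        \<and> D_L f a c = - s * f a c)
   \<and> (\<forall>m\<ge>1. \<forall>f\<in>Lerch_space s. \<forall>a c. a \<notin> \<int> \<and> real m * c \<notin> \<int> \<longrightarrow>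
        T_op m f a c = of_nat m powr (- s) * f a c)
   \<and> ((\<forall>f\<in>Lerch_space s. J_op f \<in> Lerch_space s \<and> J_op (J_op f) = f)
      \<and> Lerch_space s = {f + g | f g. f \<in> Lerch_space_plus s \<and> g \<in> Lerch_space_minus s}
      \<and> Lerch_space_plus s \<inter> Lerch_space_minus s = {0}
      \<and> cfun.dim (Lerch_space_plus s) = 1
      \<and> cfun.dim (Lerch_space_minus s) = 1
      \<and> (\<exists>Fp Fm. Lerch_space_plus s = cfun.span {Fp} \<and> Lerch_space_minus s = cfun.span {Fm}
                \<and> J_op Fp = Fp \<and> J_op Fm = - Fm))
   \<and> (R_op ` Lerch_space s = Lerch_space (1 - s)
      \<and> (\<forall>a c. a \<notin> \<int> \<and> c \<notin> \<int> \<longrightarrow>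
          ((1 - s) / 2 \<notin> \<int>\<^sub>\<le>\<^sub>0 \<longrightarrow>
             R_op (Lplus s) a c = inverse w_plus * gamma_plus (1 - s) * Lplus (1 - s) a c)
          \<and> ((1 - s + 1) / 2 \<notin> \<int>\<^sub>\<le>\<^sub>0 \<longrightarrow>
             R_op (Lminus s) a c = inverse w_minus * gamma_minus (1 - s) * Lminus (1 - s) a c)
          \<and> ((\<lambda>z. inverse w_plus * gamma_plus (1 - z) * Lplus (1 - z) a c)
               \<longlongrightarrow> R_op (Lplus s) a c) (at s)
          \<and> ((\<lambda>z. inverse w_minus * gamma_minus (1 - z) * Lminus (1 - z) a c)
               \<longlongrightarrow> R_op (Lminus s) a c) (at s)))"
proof (intro conjI ballI allI impI; (elim conjE)?)
  show "cfun.dim (Lerch_space s) = 2"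
    unfolding Lerch_space_eq cfun.dim_span cfun.dim_eq_card_independent[OF Lerch_basis_independent(1)]
    using Lerch_basis_independent(2) by simp
next
  fix f :: "real \<Rightarrow> real \<Rightarrow> complex" and a c :: real assume f: "f \<in> Lerch_space s" and ac: "a \<notin> \<int>" "c \<notin> \<int>"
  from f obtain \<alpha> \<beta> where f: "f = Lerch_comb s \<alpha> \<beta>"
    by (auto simp: Lerch_space_iff)
  show "(\<lambda>y. f a y) differentiable (at c)" "(\<lambda>x. partial_c f x c) differentiable (at a)" "D_L f a c = - s * f a c"
    unfolding f by (rule Lerch_combination_derivatives[OF ac])+
next
  fix m :: nat and f :: "real \<Rightarrow> real \<Rightarrow> complex" and a c :: real assume m: "1 \<le> m" and f: "f \<in> Lerch_space s" and ac: "a \<notin> \<int>" "real m * c \<notin> \<int>"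
  from f obtain \<alpha> \<beta> where f: "f = Lerch_comb s \<alpha> \<beta>"
    by (auto simp: Lerch_space_iff)
  show "T_op m f a c = of_nat m powr (- s) * f a c"
    unfolding f by (rule T_op_combination[OF ac m])
next
  fix f assume "f \<in> Lerch_space s"
  then show "J_op f \<in> Lerch_space s"
    unfolding Lerch_space_iff using J_op_combination by metis
  show "J_op (J_op f) = f" by (rule J_op_involution)
next
  show "Lerch_space s = {f + g | f g. f \<in> Lerch_space_plus s \<and> g \<in> Lerch_space_minus s}"
    by (rule Lerch_space_decomposition)
next
  have "f = 0" if "f \<in> Lerch_space_plus s \<inter> Lerch_space_minus s" for f
    using that cscale_add_self[of 1 f] by (auto simp: Lerch_space_plus_def Lerch_space_minus_def)
  moreover have "0 \<in> Lerch_space_plus s \<inter> Lerch_space_minus s"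
    by (simp add: Lerch_space_plus_eq Lerch_space_minus_eq cfun.span_zero)
  ultimately show "Lerch_space_plus s \<inter> Lerch_space_minus s = {0}" by blast
next
  show "cfun.dim (Lerch_space_plus s) = 1" "cfun.dim (Lerch_space_minus s) = 1"
    using Lerch_basis_nonzero[of 0 s] Lerch_basis_nonzero[of 1 s]
    by (simp_all add: Lerch_space_plus_eq Lerch_space_minus_eq cfun.dim_eq_card_independent cfun.dependent_single)
next
  have "J_op (Lerch_basis 0 s) = Lerch_basis 0 s" "J_op (Lerch_basis 1 s) = - Lerch_basis 1 s"
    by (simp_all add: J_op_Lerch_basis cfun.scale_minus_left)
  then show "\<exists>Fp Fm. Lerch_space_plus s = cfun.span {Fp} \<and> Lerch_space_minus s = cfun.span {Fm} \<and> J_op Fp = Fp \<and> J_op Fm = - Fm"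
    using Lerch_space_plus_eq Lerch_space_minus_eq by blast
next
  show "R_op ` Lerch_space s = Lerch_space (1 - s)" by (rule R_op_Lerch_space)
next
  fix a c :: real
  assume "(1 - s) / 2 \<notin> \<int>\<^sub>\<le>\<^sub>0"
  then show "R_op (Lplus s) a c = inverse w_plus * gamma_plus (1 - s) * Lplus (1 - s) a c"
    by (intro functional_equation_plus) (simp add: Gamma_R_eq_0_iff)
next
  fix a c :: real
  assume "(1 - s + 1) / 2 \<notin> \<int>\<^sub>\<le>\<^sub>0"
  then show "R_op (Lminus s) a c = inverse w_minus * gamma_minus (1 - s) * Lminus (1 - s) a c"
    by (intro functional_equation_minus) (simp add: Gamma_R_eq_0_iff)
next
  fix a c :: real
  assume ac: "a \<notin> \<int>" "c \<notin> \<int>"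
  \<comment> \<open>Even at an exceptional s the equation holds on a punctured neighbourhood, so the
    right side inherits the limit of the continuous left side.\<close>
  have "\<forall>\<^sub>F z in at s. R_op (Lplus z) a c = inverse w_plus * gamma_plus (1 - z) * Lplus (1 - z) a c"
    using eventually_Gamma_R_nonzero[where r=1] by eventually_elim (rule functional_equation_plus)
  then show "((\<lambda>z. inverse w_plus * gamma_plus (1 - z) * Lplus (1 - z) a c) \<longlongrightarrow> R_op (Lplus s) a c) (at s)"
    by (rule Lim_transform_eventually[OF R_op_continuous(1)[OF ac]])
next
  fix a c :: real
  assume ac: "a \<notin> \<int>" "c \<notin> \<int>"
  have "\<forall>\<^sub>F z in at s. R_op (Lminus z) a c = inverse w_minus * gamma_minus (1 - z) * Lminus (1 - z) a c"
    using eventually_Gamma_R_nonzero[where r=2] by eventually_elim (rule functional_equation_minus)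
  then show "((\<lambda>z. inverse w_minus * gamma_minus (1 - z) * Lminus (1 - z) a c) \<longlongrightarrow> R_op (Lminus s) a c) (at s)"
    by (rule Lim_transform_eventually[OF R_op_continuous(2)[OF ac]])
qed

end
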